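(* In the setting of the context, assume the null hypothesis $H_0$ (i.e. $Y_i=X_i^t\beta^0+\varepsilon_i$ for all $i=1,\dots,n$), and assume that there are a real $q\ge 4$ and positive constants $C_0,\dots,C_5$ such that: - $0<C_0<\inf_n\gamma_p(V_n^0)\le \sup_n\gamma_1(V_n^0)<C_1<\infty$; - $\mathbb{E}[\varepsilon_1^4]<C_2$; - $p^{-1}\sum_{s=1}^p|X_{i,s}|^q<C_3$ for all $1\le i\le n$; - $\mathbb{E}|\varepsilon_1|^{2q}<C_4$; - $p\,k^{(2-q)/(2q)}\to0$ and $p\,(n-k)^{(2-q)/(2q)}\to0$ as $n\to\infty$; - $p^{2+4/q}k^{-1}\to0$ and $p^{2+4/q}(n-k)^{-1}\to0$ as $n\to\infty$; - $\sum_{r,s=1}^p\alpha^{rrss}=O(p^2)$; - $\sum_{r,s,u=1}^p\alpha^{rsu}\alpha^{rsu}=O(p^{5/2})$ and $\sum_{r,s,u=1}^p\alpha^{rss}\alpha^{suu}=O(p^{5/2})$; - for all $i=1,\dots,n$, all $l\ge1$, all $j_1,\dots,j_l\in\{1,\dots,p\}$ and all nonnegative integers $d_1,\dots,d_l$ with $\sum_{m=1}^l d_m\le 6$, $\mathbb{E}[(w^0_{i,j_1})^{d_1}\cdots(w^0_{i,j_l})^{d_l}]\le C_5$. Assume moreover $p=o(n^{1/3})$. Then, as $n\to\infty$, (i) $\displaystyle \frac{n\,\psi_n^{0t}(V_n^0)^{-1}\psi_n^0-p}{\Delta_n/n}\to\mathcal N(0,1)$ in distribution; (ii) $\displaystyle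 \frac{EL_{nk}(\beta^0)-p}{\Delta_n/n}\to\mathcal N(0,1)$ in distribution, where $\Delta_n^2=\sum_{i=1}^n\sigma_i^2$ with $$\sigma_1^2=\theta^{-4}\Big((X_1^t(V_n^0)^{-1}X_1)^2\,\mathbb{E}[\varepsilon_1^4]-[\mathrm{tr}((V_n^0)^{-1}V^0_{(1)})]^2\Big),$$ for $i=2,\dots,k+1$, $$\sigma_i^2=\frac{4}{\theta^4}\sum_{l=1}^{i-1}\mathrm{tr}\big((V_n^0)^{-1}V^0_{(i)}(V_n^0)^{-1}V^0_{(l)}\big)+\frac{(X_i^t(V_n^0)^{-1}X_i)^2\,\mathbb{E}[\varepsilon_1^4]-[\mathrm{tr}((V_n^0)^{-1}V^0_{(i)})]^2}{\theta^4},$$ and for $i=k+2,\dots,n$, $$\sigma_i^2=\frac{4}{\theta^2(1-\theta)^2}\sum_{l=1}^{k}\mathrm{tr}\big((V_n^0)^{-1}V^0_{(i)}(V_n^0)^{-1}V^0_{(l)}\big)+\frac{4}{(1-\theta)^4}\sum_{l=k+1}^{i-1}\mathrm{tr}\big((V_n^0)^{-1}V^0_{(i)}(V_n^0)^{-1}V^0_{(l)}\big)+\frac{(X_i^t(V_n^0)^{-1}X_i)^2\,\mathbb{E}[\varepsilon_1^4]-[\mathrm{tr}((V_n^0)^{-1}V^0_{(i)})]^2}{(1-\theta)^4}.$$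
   Context: Setting. $n$ is the sample size; $p=p_n\to\infty$ as $n\to\infty$; $k=k_n$ is a known index, $1\le k<n$, and $\theta=\theta_{nk}=k/n\to\theta^0\in(0,1)$. The vectors $X_1,\dots,X_n\in\mathbb{R}^p$ are deterministic (they may depend on $n$), $X_{i,s}$ denoting the $s$-th component of $X_i$; the errors $\varepsilon_i$ are i.i.d. with mean $0$ and finite variance $\sigma^2$. The two-phase linear model is $Y_i=X_i^t\beta+\varepsilon_i$ for $1\le i\le k$ and $Y_i=X_i^t\beta_2+\varepsilon_i$ for $k<i\le n$, with $\beta,\beta_2\in\mathbb{R}^p$; the true value of $\beta$ is $\beta^0$. The null hypothesis $H_0$ is $\beta_2=\beta=\beta^0$. Notation. $z_i(\beta)=X_i(Y_i-X_i^t\beta)$ and $z_i^0=X_i\varepsilon_i$; under $H_0$, $z_i(\beta^0)=z_i^0$. $\gamma_1(A)\ge\dots\ge\gamma_p(A)$ are the eigenvalues of a symmetric $p\times p$ matrix $A$. $$V^0_{(i)}=\sigma^2X_iX_i^t,\quad V_n^0=\frac1{n\theta^2}\sum_{i=1}^kV^0_{(i)}+\frac1{n(1-\theta)^2}\sum_{j=k+1}^nV^0_{(j)},\quad \psi_n^0=\frac1{n\theta}\sum_{i=1}^kz_i^0-\frac1{n(1-\theta)}\sum_{j=k+1}^nz_j^0.$$ Set $w_i^0=(V_n^0)^{-1/2}z_i^0=(w^0_{i,1},\dots,w^0_{i,p})^t$ and, for $r\ge1$, $t_1,\dots,t_r\in\{1,\dots,p\}$, $$\alpha^{t_1\cdots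 t_r}=\frac1{n\theta^r}\sum_{i=1}^k\mathbb{E}[w^0_{i,t_1}\cdots w^0_{i,t_r}]+\frac1{n(\theta-1)^r}\sum_{j=k+1}^n\mathbb{E}[w^0_{j,t_1}\cdots w^0_{j,t_r}].$$ The empirical likelihood ratio statistic is $$EL_{nk}(\beta)=2\sum_{i=1}^k\log\Big(1+\frac nk\lambda^tz_i(\beta)\Big)+2\sum_{j=k+1}^n\log\Big(1-\frac n{n-k}\lambda^tz_j(\beta)\Big),$$ where the Lagrange multiplier $\lambda=\lambda(\beta)\in\mathbb{R}^p$ satisfies $$\sum_{i=1}^k\frac{z_i(\beta)}{k/n+\lambda^tz_i(\beta)}-\sum_{j=k+1}^n\frac{z_j(\beta)}{1-k/n-\lambda^tz_j(\beta)}=0,$$ all arguments of the logarithms being positive. *)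

theory Defs
  imports
    "HOL-Probability.Probability"
    "HOL-Library.Landau_Symbols"
    "Jordan_Normal_Form.Char_Poly"
    "Jordan_Normal_Form.Gauss_Jordan_Elimination"
begin

unbundle no vec_syntax
no_notation inner (infix "\<bullet>" 70)

(* Since the dimension p = p(n) varies with n, vectors and matrices are those of
   Jordan_Normal_Form. Observations are indexed by 1..n; components of vectors by 0..<p. *)

definition mat_trace :: "real mat \<Rightarrow> real" where
  "mat_trace A = (\<Sum>s<dim_row A. A $$ (s, s))"

definition outer :: "real Matrix.vec \<Rightarrow> real mat" where
  "outer v = mat (dim_vec v) (dim_vec v) (\<lambda>(r, s). v $ r * v $ s)"

(* eigval A j is the j-th largest eigenvalue (j = 1, 2, ...) counted with multiplicity;
   meant for symmetric A, whose characteristic polynomial splits over the reals. *)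
definition eigval :: "real mat \<Rightarrow> nat \<Rightarrow> real" where
  "eigval A j = rev (sorted_list_of_multiset (proots (char_poly A))) ! (j - 1)"

definition mat_inv :: "real mat \<Rightarrow> real mat" where
  "mat_inv A = the (mat_inverse A)"

(* the symmetric positive semidefinite square root *)
definition mat_sqrt :: "real mat \<Rightarrow> real mat" where
  "mat_sqrt A = (THE B. B \<in> carrier_mat (dim_row A) (dim_row A) \<and> transpose_mat B = B
     \<and> (\<forall>x \<in> carrier_vec (dim_row A). 0 \<le> x \<bullet> (B *\<^sub>v x)) \<and> B * B = A)"

(* In what follows n, k, p and the design X are those of one fixed sample size,
   s2 is the error variance, and Y, z, e are the values at one outcome. *)

definition zvec :: "(nat \<Rightarrow> real Matrix.vec) \<Rightarrow> (nat \<Rightarrow> real) \<Rightarrow> real Matrix.vec \<Rightarrow> nat \<Rightarrow> real Matrix.vec" where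
  "zvec X Y b i = (Y i - X i \<bullet> b) \<cdot>\<^sub>v X i"

definition z0vec :: "(nat \<Rightarrow> real Matrix.vec) \<Rightarrow> (nat \<Rightarrow> real) \<Rightarrow> nat \<Rightarrow> real Matrix.vec" where
  "z0vec X e i = e i \<cdot>\<^sub>v X i"

definition Vi :: "real \<Rightarrow> (nat \<Rightarrow> real Matrix.vec) \<Rightarrow> nat \<Rightarrow> real mat" where
  "Vi s2 X i = s2 \<cdot>\<^sub>m outer (X i)"

definition Vn :: "nat \<Rightarrow> nat \<Rightarrow> nat \<Rightarrow> real \<Rightarrow> (nat \<Rightarrow> real Matrix.vec) \<Rightarrow> real mat" where
  "Vn n k p s2 X = (let \<theta> = real k / real n in
     mat p p (\<lambda>rs. 1 / (real n * \<theta>^2) * (\<Sum>i=1..k. Vi s2 X i $$ rs)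
                 + 1 / (real n * (1 - \<theta>)^2) * (\<Sum>j=k+1..n. Vi s2 X j $$ rs)))"

definition psi :: "nat \<Rightarrow> nat \<Rightarrow> nat \<Rightarrow> (nat \<Rightarrow> real Matrix.vec) \<Rightarrow> real Matrix.vec" where
  "psi n k p z = (let \<theta> = real k / real n in
     Matrix.vec p (\<lambda>s. 1 / (real n * \<theta>) * (\<Sum>i=1..k. z i $ s)
                     - 1 / (real n * (1 - \<theta>)) * (\<Sum>j=k+1..n. z j $ s)))"

definition w0vec :: "nat \<Rightarrow> nat \<Rightarrow> nat \<Rightarrow> real \<Rightarrow> (nat \<Rightarrow> real Matrix.vec) \<Rightarrow> (nat \<Rightarrow> real) \<Rightarrow> nat \<Rightarrow> real Matrix.vec" where
  "w0vec n k p s2 X e i = mat_inv (mat_sqrt (Vn n k p s2 X)) *\<^sub>v z0vec X e i"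

(* ts lists the upper indices t_1, ..., t_r *)
definition alpha :: "'a measure \<Rightarrow> nat \<Rightarrow> nat \<Rightarrow> (nat \<Rightarrow> 'a \<Rightarrow> real Matrix.vec) \<Rightarrow> nat list \<Rightarrow> real" where
  "alpha M n k w ts = (let \<theta> = real k / real n; r = length ts in
       1 / (real n * \<theta>^r) * (\<Sum>i=1..k. \<integral>\<omega>. prod_list (map (\<lambda>t. w i \<omega> $ t) ts) \<partial>M)
     + 1 / (real n * (\<theta> - 1)^r) * (\<Sum>j=k+1..n. \<integral>\<omega>. prod_list (map (\<lambda>t. w j \<omega> $ t) ts) \<partial>M))"

definition EL_multiplier :: "nat \<Rightarrow> nat \<Rightarrow> nat \<Rightarrow> (nat \<Rightarrow> real Matrix.vec) \<Rightarrow> real Matrix.vec \<Rightarrow> bool" where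
  "EL_multiplier n k p z l \<longleftrightarrow> l \<in> carrier_vec p
     \<and> (\<forall>i\<in>{1..k}. 0 < 1 + real n / real k * (l \<bullet> z i))
     \<and> (\<forall>j\<in>{k+1..n}. 0 < 1 - real n / real (n - k) * (l \<bullet> z j))
     \<and> (\<forall>s<p. (\<Sum>i=1..k. z i $ s / (real k / real n + l \<bullet> z i))
             - (\<Sum>j=k+1..n. z j $ s / (1 - real k / real n - l \<bullet> z j)) = 0)"

definition EL_at :: "nat \<Rightarrow> nat \<Rightarrow> (nat \<Rightarrow> real Matrix.vec) \<Rightarrow> real Matrix.vec \<Rightarrow> real" where
  "EL_at n k z l = 2 * (\<Sum>i=1..k. ln (1 + real n / real k * (l \<bullet> z i)))
                 + 2 * (\<Sum>j=k+1..n. ln (1 - real n / real (n - k) * (l \<bullet> z j)))"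

(* The value does not depend on the multiplier chosen, because EL_at is concave in l and
   multipliers are its stationary points. For some outcomes there is no
   multiplier; the statistic is then given the arbitrary value c. *)
definition EL :: "real \<Rightarrow> nat \<Rightarrow> nat \<Rightarrow> nat \<Rightarrow> (nat \<Rightarrow> real Matrix.vec) \<Rightarrow> real" where
  "EL c n k p z = (if \<exists>l. EL_multiplier n k p z l
                   then EL_at n k z (SOME l. EL_multiplier n k p z l) else c)"

(* m4 is the fourth moment of the errors. *)
definition sigma_sq :: "nat \<Rightarrow> nat \<Rightarrow> nat \<Rightarrow> real \<Rightarrow> real \<Rightarrow> (nat \<Rightarrow> real Matrix.vec) \<Rightarrow> nat \<Rightarrow> real" where
  "sigma_sq n k p s2 m4 X i =
    (let \<theta> = real k / real n;
         W = mat_inv (Vn n k p s2 X);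
         T = (\<lambda>i l. mat_trace (W * Vi s2 X i * W * Vi s2 X l));
         D = (X i \<bullet> (W *\<^sub>v X i))^2 * m4 - (mat_trace (W * Vi s2 X i))^2
     in if i = 1 then D / \<theta>^4
        else if i \<le> k + 1 then 4 / \<theta>^4 * (\<Sum>l=1..i-1. T i l) + D / \<theta>^4
        else 4 / (\<theta>^2 * (1 - \<theta>)^2) * (\<Sum>l=1..k. T i l)
             + 4 / (1 - \<theta>)^4 * (\<Sum>l=k+1..i-1. T i l)
             + D / (1 - \<theta>)^4)"

definition Delta :: "nat \<Rightarrow> nat \<Rightarrow> nat \<Rightarrow> real \<Rightarrow> real \<Rightarrow> (nat \<Rightarrow> real Matrix.vec) \<Rightarrow> real" where
  "Delta n k p s2 m4 X = sqrt (\<Sum>i=1..n. sigma_sq n k p s2 m4 X i)"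

end

theory Submission
  imports Defs
begin

text \<open>
  Under the null hypothesis both statistics are governed by one quadratic form. Give observation
  \<open>i\<close> the signed weight \<open>c i = n/k\<close> for \<open>i \<le> k\<close> and \<open>c i = -n/(n-k)\<close> for \<open>i > k\<close>, and let
  \<open>\<eta> i = \<epsilon> i / \<bar>\<sigma>\<bar>\<close> and \<open>W\<close> the inverse of the normalized covariance matrix \<open>V\<close>. Then \<open>\<psi>\<close> is the
  mean of the vectors \<open>m i = c i \<epsilon> i X i\<close>, so that \<open>T = n \<psi>\<^sup>t W \<psi>\<close> equals \<open>\<Sum> P i l \<eta> i \<eta> l\<close> with
  \<open>P i l = \<sigma>\<^sup>2 c i c l X i\<^sup>t W X l / n\<close>. Because \<open>V\<close> is the mean of \<open>\<sigma>\<^sup>2 (c i)\<^sup>2 X i X i\<^sup>t\<close>, the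
  matrix \<open>P\<close> is an orthogonal projection of trace \<open>p\<close>; the lower bound on the eigenvalues of \<open>V\<close>
  and the bound on the design make its diagonal entries (the leverages) at most \<open>\<rho>\<^sup>2\<close>, of order
  \<open>p/n\<close>.

  The central limit theorem for \<open>T\<close> comes from a differential equation for its characteristic
  function (\<open>stein_step\<close>, \<open>gaussian_ode_bound\<close>, \<open>char_quadratic_form_bound\<close>). With \<open>L = P \<eta>\<close> one
  has \<open>T = \<Sum> \<eta> i L i\<close> and, by idempotence, also \<open>T = \<Sum> (L i)\<^sup>2\<close>. Isolating the single error
  \<open>\<eta> i\<close>, which is independent of all others, and expanding the exponential to second order shows
  that \<open>e\<^sup>i\<^sup>s\<^sup>T (\<eta> i L i - P i i)\<close> and \<open>2is e\<^sup>i\<^sup>s\<^sup>T (L i)\<^sup>2\<close> have the same expectation up to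
  \<open>O(\<rho> P i i)\<close>. Summing over \<open>i\<close>, the expectations of \<open>e\<^sup>i\<^sup>s\<^sup>T (T - p)\<close> and \<open>2is e\<^sup>i\<^sup>s\<^sup>T T\<close>
  differ by \<open>O(\<rho> p)\<close>. For the characteristic function \<open>\<phi>\<close> of \<open>(T - p) / sqrt(2p)\<close> this says that
  \<open>\<phi>'(t) = - t \<phi>(t)\<close> up to a vanishing error, hence \<open>\<phi>(t)\<close> tends to \<open>exp(-t\<^sup>2/2)\<close>.

  The normalization is the right one (\<open>Delta_squared_approx\<close>): for all indices but one,
  \<open>\<sigma>\<^sub>i\<^sup>2 / n\<^sup>2\<close> is \<open>4 \<Sum> (P i l)\<^sup>2\<close>, summed over \<open>l < i\<close>, plus a multiple of \<open>(P i i)\<^sup>2\<close>. The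
  squares of all entries of \<open>P\<close> add up to its trace \<open>p\<close>, and the squared diagonal entries to
  \<open>O(\<rho>\<^sup>2 p)\<close>, so \<open>\<Delta>\<^sup>2 / n\<^sup>2\<close> is asymptotic to \<open>2p\<close>.

  For the empirical likelihood it suffices that \<open>EL - T\<close> is \<open>o(sqrt p)\<close> in probability
  (\<open>el_remainder\<close>). \<open>EL\<close> is twice the maximum of the concave function \<open>l \<mapsto> \<Sum> ln (1 + l\<^sup>t m i)\<close>,
  whose Hessian at \<open>0\<close> is approximately \<open>-nV\<close>. Its expansion is made at the explicit point
  \<open>l0 = W \<psi>\<close>, one Newton step from the origin, where \<open>l0\<^sup>t m i = \<eta> i L i\<close>: twice the value there
  is \<open>T\<close> up to cubic terms and to the deviation of the sample covariance from \<open>V\<close>. As the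
  function is strongly concave near \<open>l0\<close> and its gradient at \<open>l0\<close> is small, a maximizer, that is
  a multiplier, exists nearby, and passing to it changes the value little
  (\<open>multiplier_near_point\<close>, \<open>el_quadratic_approximation\<close>). All these errors are controlled by
  moments of \<open>T\<close>, \<open>\<Sum> \<bar>\<eta> i L i\<bar>\<^sup>3\<close>, \<open>\<Sum> (\<eta> i L i)\<^sup>4\<close> and of the covariance deviation; they turn
  out to be \<open>sqrt p\<close> times a quantity that vanishes with \<open>p / n powr (1/3)\<close>.

  Convergence in distribution follows from the theorem of Levy. The step from \<open>T\<close> to \<open>EL\<close> speaks
  of the law of \<open>EL\<close>, which is measurable because the existence of a multiplier and the value of
  the maximum can be decided on a countable set of rational vectors (\<open>el_statistic_measurable\<close>).
\<close>

section \<open>The smallest eigenvalue bounds the quadratic form\<close>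

lemma map_poly_of_real_prod_linear:
  "map_poly complex_of_real (\<Prod>a\<leftarrow>as. [:- a, 1:]) = (\<Prod>a\<leftarrow>as. [:- complex_of_real a, 1:])"
proof -
  interpret map_poly_comm_ring_hom complex_of_real ..
  show ?thesis by (simp add: hom_distribs hom_prod_list o_def)
qed

text \<open>
  For \<open>A v = a v\<close> the number \<open>v\<^sup>* A v\<close>, which is \<open>a\<close> times the squared length of \<open>v\<close>, is its own
  complex conjugate when \<open>A\<close> is real and symmetric.
\<close>

lemma symmetric_real_eigenvalue_is_real:
  fixes A :: "real mat"
  assumes A: "A \<in> carrier_mat p p" and sym: "transpose_mat A = A"
    and ev: "eigenvalue (map_mat complex_of_real A) a"
  shows "a \<in> \<real>"
proof -
  obtain v where v: "v \<in> carrier_vec p" "v \<noteq> 0\<^sub>v p"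
    and Av: "map_mat complex_of_real A *\<^sub>v v = a \<cdot>\<^sub>v v"
    using ev A unfolding eigenvalue_def eigenvector_def by auto
  have row: "(\<Sum>s<p. complex_of_real (A $$ (r,s)) * v $ s) = a * v $ r" if "r < p" for r
    using arg_cong[OF Av, of "\<lambda>u. u $ r"] that A v
    by (simp add: scalar_prod_def lessThan_atLeast0)
  have symA: "A $$ (r,s) = A $$ (s,r)" if "r < p" "s < p" for r s
    using arg_cong[OF sym, of "\<lambda>B. B $$ (r,s)"] that A by simp
  define N where "N = (\<Sum>r<p. (cmod (v $ r))^2)"
  have "complex_of_real N * a = (\<Sum>r<p. cnj (v $ r) * (a * v $ r))"
    unfolding N_def of_real_sum sum_distrib_right
    by (intro sum.cong refl) (simp add: complex_norm_square[unfolded of_real_power] algebra_simps)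
  also have "\<dots> = (\<Sum>r<p. \<Sum>s<p. complex_of_real (A $$ (r,s)) * (cnj (v $ r) * v $ s))"
    by (intro sum.cong refl) (simp add: row[symmetric] sum_distrib_left algebra_simps)
  finally have Q: "complex_of_real N * a = (\<Sum>r<p. \<Sum>s<p. complex_of_real (A $$ (r,s)) * (cnj (v $ r) * v $ s))" .
  have "cnj (complex_of_real N * a) = (\<Sum>r<p. \<Sum>s<p. complex_of_real (A $$ (s,r)) * (v $ r * cnj (v $ s)))"
    unfolding Q by (simp add: symA)
  also have "\<dots> = complex_of_real N * a"
    unfolding Q by (subst sum.swap) (simp add: algebra_simps)
  finally have *: "complex_of_real N * cnj a = complex_of_real N * a" by simp
  have "\<exists>r<p. v $ r \<noteq> 0"
  proof (rule ccontr)
    assume "\<not> (\<exists>r<p. v $ r \<noteq> 0)"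
    hence "v = 0\<^sub>v p" using v by (intro eq_vecI) auto
    thus False using v by simp
  qed
  then obtain r where "r < p" "v $ r \<noteq> 0" by blast
  hence "N > 0" unfolding N_def by (intro sum_pos2[of _ r]) auto
  thus ?thesis using * by (simp add: complex_eq_iff complex_is_Real_iff)
qed

text \<open>
  This makes \<open>eigval\<close> meaningful: all \<open>p\<close> roots of the characteristic polynomial are present in
  the multiset of its real roots.
\<close>

lemma symmetric_char_poly_splits:
  fixes A :: "real mat"
  assumes A: "A \<in> carrier_mat p p" and sym: "transpose_mat A = A"
  shows "\<exists>as. char_poly A = (\<Prod>a\<leftarrow>as. [:- a, 1:]) \<and> length as = p"
proof -
  let ?C = "map_mat complex_of_real A"
  have C: "?C \<in> carrier_mat p p" using A by simp
  obtain as where as: "char_poly ?C = (\<Prod>a\<leftarrow>as. [:- a, 1:])" "length as = p"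
    using char_poly_factorized[OF C] by blast
  have re: "a \<in> \<real>" if "a \<in> set as" for a
  proof (rule symmetric_real_eigenvalue_is_real[OF A sym])
    show "eigenvalue ?C a" unfolding eigenvalue_root_char_poly[OF C] as(1)
      using that by (induction as) (auto simp: poly_prod_list)
  qed
  define bs where "bs = map Re as"
  have asbs: "as = map complex_of_real bs"
    unfolding bs_def using re by (induction as) (auto simp: complex_is_Real_iff complex_eq_iff)
  interpret inj: map_poly_inj_comm_ring_hom complex_of_real ..
  have "map_poly complex_of_real (char_poly A) = map_poly complex_of_real (\<Prod>a\<leftarrow>bs. [:- a, 1:])"
    unfolding map_poly_of_real_prod_linear of_real_hom.char_poly_hom[OF A, symmetric] as(1)
    by (simp add: asbs o_def)
  hence "char_poly A = (\<Prod>a\<leftarrow>bs. [:- a, 1:])" by (simp del: inj.hom_prod_list)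
  thus ?thesis using as(2) bs_def by (intro exI[of _ bs]) auto
qed

lemma proots_prod_linear:
  "proots (\<Prod>a\<leftarrow>as. [:- a, 1:] :: real poly) = mset as"
proof (induction as)
  case (Cons a as)
  have "(\<Prod>a\<leftarrow>as. [:- a, 1:] :: real poly) \<noteq> 0" by (auto simp: prod_list_zero_iff)
  thus ?case using Cons by (simp add: proots_mult del: mult_pCons_left)
qed simp

text \<open>
  The list behind \<open>eigval\<close> is in decreasing order and has length exactly \<open>p\<close>, so its entry
  number \<open>p\<close> is the least root of the characteristic polynomial.
\<close>

lemma eigval_last_le_eigenvalue:
  fixes A :: "real mat"
  assumes A: "A \<in> carrier_mat p p" and sym: "transpose_mat A = A" and p: "p \<ge> 1"
    and ev: "eigenvalue A a"
  shows "eigval A p \<le> a"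
proof -
  obtain as where as: "char_poly A = (\<Prod>a\<leftarrow>as. [:- a, 1:])" "length as = p"
    using symmetric_char_poly_splits[OF A sym] by blast
  have pr: "proots (char_poly A) = mset as" by (simp add: as proots_prod_linear)
  define l where "l = sort as"
  have l: "length l = p" "sorted l" "set l = set as" by (simp_all add: l_def as)
  have "eigval A p = rev l ! (p - 1)" unfolding eigval_def pr l_def by simp
  also have "\<dots> = l ! 0" using l p by (simp add: rev_nth)
  finally have e: "eigval A p = l ! 0" .
  have "a \<in> set as" using ev unfolding eigenvalue_root_char_poly[OF A] as(1)
    by (induction as) (auto simp: poly_prod_list)
  then obtain i where "i < p" "l ! i = a" using l by (metis in_set_conv_nth)
  thus ?thesis using e l by (metis sorted_nth_mono zero_le)
qed

text \<open>
  Vectors with \<open>p\<close> coordinates are encoded as functions that vanish from \<open>p\<close> on. In the product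
  topology on all functions, a cube of such vectors is then compact by the theorem of Tychonoff,
  and no type of dimension \<open>p\<close> is involved.
\<close>

definition box_fun :: "nat \<Rightarrow> real \<Rightarrow> (nat \<Rightarrow> real) set" where
  "box_fun p N = (\<Pi>\<^sub>E s\<in>UNIV. if s < p then {-N..N} else {0})"

lemma compact_box_fun: "compact (box_fun p N)"
proof -
  have "compactin (product_topology (\<lambda>_. euclidean) UNIV) (box_fun p N)"
    unfolding box_fun_def by (subst compactin_PiE) auto
  thus ?thesis by (simp add: euclidean_product_topology)
qed

lemma in_box_fun: "x \<in> box_fun p N \<longleftrightarrow> (\<forall>s<p. \<bar>x s\<bar> \<le> N) \<and> (\<forall>s\<ge>p. x s = 0)"
proof -
  have "\<bar>t\<bar> \<le> N \<longleftrightarrow> t \<in> {-N..N}" for t by auto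
  thus ?thesis unfolding box_fun_def
    by (auto simp: PiE_iff Pi_iff split: if_splits)
qed

lemma continuous_on_coord [continuous_intros]: "continuous_on S (\<lambda>x::nat\<Rightarrow>real. x s)"
  by (rule continuous_on_subset[OF continuous_on_product_coordinates]) auto

lemma coord_sq_le_sum_sq:
  fixes x :: "nat \<Rightarrow> real"
  assumes "s < p"
  shows "(x s)^2 \<le> (\<Sum>r<p. (x r)^2)"
  using assms by (intro member_le_sum) auto

text \<open>
  The quadratic form attains its minimum \<open>\<mu>\<close> over the unit sphere, by compactness. A minimizer
  \<open>x0\<close> is an eigenvector for \<open>\<mu>\<close>, because otherwise the form minus \<open>\<mu>\<close> times the squared length
  would become negative in the direction of its gradient. So \<open>\<mu>\<close> is an eigenvalue, and the
  smallest one is at most \<open>\<mu>\<close>.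
\<close>

lemma quadratic_form_bound_by_eigval:
  fixes A :: "real mat"
  assumes A: "A \<in> carrier_mat p p" and sym: "transpose_mat A = A" and p: "p \<ge> 1"
  shows "eigval A p * (\<Sum>r<p. (x r)^2) \<le> (\<Sum>r<p. \<Sum>s<p. x r * A $$ (r,s) * x s)"
proof -
  define q where "q x = (\<Sum>r<p. \<Sum>s<p. x r * A $$ (r,s) * x s)" for x :: "nat \<Rightarrow> real"
  define nn where "nn x = (\<Sum>r<p. (x r)^2)" for x :: "nat \<Rightarrow> real"
  have symA: "A $$ (r,s) = A $$ (s,r)" if "r < p" "s < p" for r s
    using arg_cong[OF sym, of "\<lambda>B. B $$ (r,s)"] that A by simp
  define K where "K = box_fun p 1 \<inter> {x. nn x = 1}"
  have "closed {x. nn x = 1}" unfolding nn_def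
    by (intro closed_Collect_eq continuous_intros)
  hence cK: "compact K" unfolding K_def by (intro compact_Int_closed compact_box_fun)
  have "(\<lambda>s. if s = 0 then 1 else 0) \<in> K"
    unfolding K_def Int_iff in_box_fun nn_def mem_Collect_eq using p
    by (auto simp: if_distrib[of "\<lambda>x. x^2"] cong: if_cong)
  hence ne: "K \<noteq> {}" by auto
  have "continuous_on K q" unfolding q_def by (intro continuous_intros)
  then obtain x0 where x0: "x0 \<in> K" and min: "\<And>y. y \<in> K \<Longrightarrow> q x0 \<le> q y"
    using continuous_attains_inf[OF cK ne] by blast
  define \<mu> where "\<mu> = q x0"
  have n0: "nn x0 = 1" using x0 by (simp add: K_def)
  have scale: "q (\<lambda>s. t * y s) = t^2 * q y" "nn (\<lambda>s. t * y s) = t^2 * nn y" for t y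
    unfolding q_def nn_def sum_distrib_left
    by (auto intro!: sum.cong simp: power_mult_distrib power2_eq_square algebra_simps)
  have low: "\<mu> * nn y \<le> q y" for y
  proof (cases "nn y = 0")
    case True
    hence "\<And>r. r < p \<Longrightarrow> y r = 0" unfolding nn_def by (simp add: sum_nonneg_eq_0_iff)
    hence "q y = 0" unfolding q_def by simp
    thus ?thesis using True by simp
  next
    case False
    hence pos: "nn y > 0" unfolding nn_def by (simp add: sum_nonneg order_less_le)
    define z where "z s = (1 / sqrt (nn y)) * (if s < p then y s else 0)" for s
    have cut: "nn (\<lambda>s. if s < p then y s else 0) = nn y" "q (\<lambda>s. if s < p then y s else 0) = q y"
      unfolding nn_def q_def by auto
    have nz: "nn z = 1" unfolding z_def scale cut using pos by (simp add: power_divide)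
    have z1: "\<bar>z s\<bar> \<le> 1" if "s < p" for s
      using coord_sq_le_sum_sq[OF that, of z] nz by (simp add: nn_def abs_square_le_1)
    have z0: "z s = 0" if "s \<ge> p" for s using that by (simp add: z_def)
    have "z \<in> K" unfolding K_def Int_iff in_box_fun mem_Collect_eq using nz z0 z1 by blast
    hence "\<mu> \<le> q z" unfolding \<mu>_def by (rule min)
    also have "q z = q y / nn y" unfolding z_def scale cut using pos by (simp add: power_divide)
    finally show ?thesis using pos by (simp add: field_simps)
  qed
  \<comment> \<open>Half the gradient at x0 of the nonnegative form q - \<mu> nn; x0 is an eigenvector as soon as
    it vanishes.\<close>
  define u where "u r = (\<Sum>s<p. A $$ (r,s) * x0 s) - \<mu> * x0 r" for r
  have expand_q: "q (\<lambda>s. x0 s + t * u s) = q x0 + 2 * t * (\<Sum>r<p. u r * (\<Sum>s<p. A $$ (r,s) * x0 s)) + t^2 * q u" for t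
  proof -
    have "(\<Sum>r<p. \<Sum>s<p. x0 r * A $$ (r,s) * u s) = (\<Sum>r<p. \<Sum>s<p. u r * A $$ (r,s) * x0 s)"
      by (subst sum.swap) (auto intro!: sum.cong simp: symA)
    moreover have "q (\<lambda>s. x0 s + t * u s) = q x0 + t * (\<Sum>r<p. \<Sum>s<p. u r * A $$ (r,s) * x0 s)
         + t * (\<Sum>r<p. \<Sum>s<p. x0 r * A $$ (r,s) * u s) + t^2 * q u"
      unfolding q_def sum_distrib_left sum.distrib[symmetric]
      by (intro sum.cong refl) (simp add: algebra_simps power2_eq_square)
    ultimately show ?thesis by (simp add: sum_distrib_left algebra_simps)
  qed
  have expand_n: "nn (\<lambda>s. x0 s + t * u s) = nn x0 + 2 * t * (\<Sum>r<p. u r * x0 r) + t^2 * nn u" for t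
    unfolding nn_def sum_distrib_left sum.distrib[symmetric]
    by (intro sum.cong refl) (simp add: algebra_simps power2_eq_square)
  have grad: "(\<Sum>r<p. u r * (\<Sum>s<p. A $$ (r,s) * x0 s)) - \<mu> * (\<Sum>r<p. u r * x0 r) = nn u"
    unfolding nn_def sum_distrib_left[of \<mu>] sum_subtractf[symmetric]
    by (intro sum.cong refl) (simp add: u_def power2_eq_square left_diff_distrib right_diff_distrib)
  have ineq: "0 \<le> 2 * t * nn u + t^2 * (q u - \<mu> * nn u)" for t
  proof -
    have "0 \<le> q (\<lambda>s. x0 s + t * u s) - \<mu> * nn (\<lambda>s. x0 s + t * u s)"
      using low[of "\<lambda>s. x0 s + t * u s"] by simp
    also have "\<dots> = 2 * t * nn u + t^2 * (q u - \<mu> * nn u)"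
      unfolding expand_q expand_n n0 grad[symmetric] by (simp add: \<mu>_def algebra_simps)
    finally show ?thesis .
  qed
  have "nn u = 0"
  proof (rule ccontr)
    assume "nn u \<noteq> 0"
    hence pos: "nn u > 0" unfolding nn_def by (simp add: sum_nonneg order_less_le)
    define c where "c = q u - \<mu> * nn u"
    have c: "c \<ge> 0" using low[of u] by (simp add: c_def)
    define z where "z = 1 / (c + 1)"
    have z: "z > 0" "z * c = 1 - z" using c by (simp_all add: z_def field_simps)
    \<comment> \<open>A step against the gradient, short enough for the linear term to dominate the quadratic
      one.\<close>
    define t where "t = - (nn u * z)"
    have "2 * t * nn u + t^2 * c = (nn u)^2 * (z * (z * c) - 2 * z)"
      by (simp add: t_def power2_eq_square algebra_simps)
    also have "\<dots> = - ((nn u)^2 * (z + z^2))"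
      unfolding z(2) by (simp add: power2_eq_square algebra_simps)
    also have "\<dots> < 0" using pos z(1) by (simp add: add_pos_pos)
    finally have "2 * t * nn u + t^2 * c < 0" .
    thus False using ineq[of t] by (simp add: c_def)
  qed
  hence u0: "u r = 0" if "r < p" for r
    using that unfolding nn_def by (simp add: sum_nonneg_eq_0_iff)
  have "eigenvalue A \<mu>" unfolding eigenvalue_def eigenvector_def
  proof (intro exI conjI)
    show "vec p x0 \<in> carrier_vec (dim_row A)" using A by simp
    show "vec p x0 \<noteq> 0\<^sub>v (dim_row A)"
    proof
      assume "vec p x0 = 0\<^sub>v (dim_row A)"
      hence "x0 r = 0" if "r < p" for r using that A by (metis index_vec index_zero_vec(1) carrier_matD(1))
      thus False using n0 by (simp add: nn_def)
    qed
    show "A *\<^sub>v vec p x0 = \<mu> \<cdot>\<^sub>v vec p x0"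
      using A u0 by (intro eq_vecI) (auto simp: scalar_prod_def lessThan_atLeast0 u_def)
  qed
  hence "eigval A p \<le> \<mu>" by (rule eigval_last_le_eigenvalue[OF A sym p])
  hence "eigval A p * nn x \<le> \<mu> * nn x" by (intro mult_right_mono) (auto simp: nn_def sum_nonneg)
  also have "\<dots> \<le> q x" by (rule low)
  finally show ?thesis by (simp add: q_def nn_def)
qed

section \<open>Moments of linear forms in independent errors\<close>

lemma abs_power_le_one_plus:
  fixes x :: real assumes "k \<le> m" shows "\<bar>x\<bar>^k \<le> 1 + \<bar>x\<bar>^m"
proof (cases "\<bar>x\<bar> \<le> 1")
  case True thus ?thesis using power_le_one[of "\<bar>x\<bar>" k] by (simp add: add_increasing2)
next
  case False thus ?thesis using power_increasing[OF assms, of "\<bar>x\<bar>"] by linarith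
qed

text \<open>
  The summand \<open>1\<close> in the bound by \<open>\<kappa>\<close> lets this one constant dominate all absolute moments up to
  the eighth, since \<open>\<bar>x\<bar>\<^sup>k \<le> 1 + \<bar>x\<bar>\<^sup>8\<close>.
\<close>

locale standardized_errors = prob_space M for M :: "'a measure" +
  fixes I :: "nat set" and \<eta> :: "nat \<Rightarrow> 'a \<Rightarrow> real" and \<kappa> :: real
  assumes fin: "finite I"
    and ind: "indep_vars (\<lambda>_. borel) \<eta> I"
    and int8: "\<And>i. i \<in> I \<Longrightarrow> integrable M (\<lambda>\<omega>. \<bar>\<eta> i \<omega>\<bar>^8)"
    and mom8: "\<And>i. i \<in> I \<Longrightarrow> 1 + expectation (\<lambda>\<omega>. \<bar>\<eta> i \<omega>\<bar>^8) \<le> \<kappa>"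
    and mean0: "\<And>i. i \<in> I \<Longrightarrow> expectation (\<eta> i) = 0"
    and var1: "\<And>i. i \<in> I \<Longrightarrow> expectation (\<lambda>\<omega>. (\<eta> i \<omega>)^2) = 1"
    and \<kappa>1: "1 \<le> \<kappa>"
begin

lemma rv [measurable]: "i \<in> I \<Longrightarrow> \<eta> i \<in> borel_measurable M"
  using ind by (auto simp: indep_vars_def)

lemma integrable_abs_power:
  assumes "i \<in> I" "k \<le> 8" shows "integrable M (\<lambda>\<omega>. \<bar>\<eta> i \<omega>\<bar>^k)"
  by (rule Bochner_Integration.integrable_bound[of M "\<lambda>\<omega>. 1 + \<bar>\<eta> i \<omega>\<bar>^8"])
     (use assms int8[OF assms(1)] abs_power_le_one_plus[OF assms(2)] in \<open>auto intro!: AE_I2\<close>)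

lemma expectation_abs_power_le:
  assumes "i \<in> I" "k \<le> 8" shows "expectation (\<lambda>\<omega>. \<bar>\<eta> i \<omega>\<bar>^k) \<le> \<kappa>"
proof -
  have "expectation (\<lambda>\<omega>. \<bar>\<eta> i \<omega>\<bar>^k) \<le> expectation (\<lambda>\<omega>. 1 + \<bar>\<eta> i \<omega>\<bar>^8)"
    using abs_power_le_one_plus[OF assms(2)] integrable_abs_power[OF assms] int8[OF assms(1)]
    by (intro integral_mono) auto
  also have "\<dots> = 1 + expectation (\<lambda>\<omega>. \<bar>\<eta> i \<omega>\<bar>^8)"
    using int8[OF assms(1)] by (simp add: prob_space)
  finally show ?thesis using mom8[OF assms(1)] by linarith
qed

lemma integrable_power:
  assumes "i \<in> I" "k \<le> 8" shows "integrable M (\<lambda>\<omega>. \<eta> i \<omega>^k)"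
  by (rule Bochner_Integration.integrable_bound[OF integrable_abs_power[OF assms]])
     (use assms in \<open>auto simp: power_abs\<close>)

lemma abs_expectation_power_le:
  assumes "i \<in> I" "k \<le> 8" shows "\<bar>expectation (\<lambda>\<omega>. \<eta> i \<omega>^k)\<bar> \<le> \<kappa>"
proof -
  have "\<bar>expectation (\<lambda>\<omega>. \<eta> i \<omega>^k)\<bar> \<le> expectation (\<lambda>\<omega>. \<bar>\<eta> i \<omega>^k\<bar>)" by (rule integral_abs_bound)
  thus ?thesis using expectation_abs_power_le[OF assms] by (simp add: power_abs)
qed

text \<open>
  All cancellations rest on this: functions of one error are independent of functions of any
  other errors.
\<close>

lemma indep_of_the_others:
  assumes i: "i \<in> I" and J: "J \<subseteq> I" "i \<notin> J"
    and g: "g \<in> measurable (PiM J (\<lambda>_. borel)) N" and q: "q \<in> measurable borel N'"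
  shows "indep_var N (\<lambda>\<omega>. g (\<lambda>l\<in>J. \<eta> l \<omega>)) N' (\<lambda>\<omega>. q (\<eta> i \<omega>))"
proof -
  have *: "indep_var (PiM J (\<lambda>_. borel)) (\<lambda>\<omega>. \<lambda>l\<in>J. \<eta> l \<omega>) (PiM {i} (\<lambda>_. borel)) (\<lambda>\<omega>. \<lambda>l\<in>{i}. \<eta> l \<omega>)"
    using i J by (intro indep_var_restrict[OF ind]) auto
  have "(\<lambda>x. q (x i)) \<in> measurable (PiM {i} (\<lambda>_. borel)) N'" using q by measurable
  from indep_var_compose[OF * g this] show ?thesis by (simp add: o_def)
qed

text \<open>
  Adding one error at a time, independence and vanishing means kill the terms with a first power
  of the new error or of the old sum in the expansions of the second and fourth powers. The
  remaining terms of the fourth moment assemble to the square of \<open>v + (b i)\<^sup>2\<close>, for which the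
  constant \<open>3 \<kappa>\<close> is large enough.
\<close>

lemma linear_form_moments:
  assumes "J \<subseteq> I"
  shows "integrable M (\<lambda>\<omega>. (\<Sum>l\<in>J. b l * \<eta> l \<omega>)^4) \<and>
         expectation (\<lambda>\<omega>. \<Sum>l\<in>J. b l * \<eta> l \<omega>) = 0 \<and>
         expectation (\<lambda>\<omega>. (\<Sum>l\<in>J. b l * \<eta> l \<omega>)^2) = (\<Sum>l\<in>J. (b l)^2) \<and>
         expectation (\<lambda>\<omega>. (\<Sum>l\<in>J. b l * \<eta> l \<omega>)^4) \<le> 3 * \<kappa> * (\<Sum>l\<in>J. (b l)^2)^2"
proof -
  have "finite J" using assms fin finite_subset by blast
  thus ?thesis using assms
  proof (induction J rule: finite_induct)
    case empty thus ?case by simp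
  next
    case (insert i J)
    have iI: "i \<in> I" and JI: "J \<subseteq> I" using insert.prems by auto
    define S where "S \<omega> = (\<Sum>l\<in>J. b l * \<eta> l \<omega>)" for \<omega>
    define v where "v = (\<Sum>l\<in>J. (b l)^2)"
    have v0: "v \<ge> 0" unfolding v_def by (simp add: sum_nonneg)
    have IH: "integrable M (\<lambda>\<omega>. S \<omega>^4)" "expectation S = 0" "expectation (\<lambda>\<omega>. S \<omega>^2) = v"
       "expectation (\<lambda>\<omega>. S \<omega>^4) \<le> 3 * \<kappa> * v^2"
      using insert.IH[OF JI] unfolding S_def[abs_def] v_def by auto
    have [measurable]: "S \<in> borel_measurable M" unfolding S_def[abs_def]
      using JI by (intro borel_measurable_sum borel_measurable_times) (auto intro: rv)
    have indS: "indep_var borel S borel (\<eta> i)"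
    proof -
      have "indep_var borel (\<lambda>\<omega>. (\<lambda>x. \<Sum>l\<in>J. b l * x l) (\<lambda>l\<in>J. \<eta> l \<omega>)) borel (\<lambda>\<omega>. (\<lambda>x. x) (\<eta> i \<omega>))"
        using iI JI insert.hyps by (intro indep_of_the_others) auto
      moreover have "(\<lambda>\<omega>. (\<lambda>x. \<Sum>l\<in>J. b l * x l) (\<lambda>l\<in>J. \<eta> l \<omega>)) = S"
        by (auto simp: S_def fun_eq_iff intro!: sum.cong)
      ultimately show ?thesis by simp
    qed
    have Sint: "integrable M (\<lambda>\<omega>. S \<omega>^k)" if "k \<le> 4" for k
    proof (rule Bochner_Integration.integrable_bound[of M "\<lambda>\<omega>. 1 + \<bar>S \<omega>\<bar>^4"])
      show "integrable M (\<lambda>\<omega>. 1 + \<bar>S \<omega>\<bar>^4)" using IH(1) by (simp add: power_even_abs)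
    qed (use abs_power_le_one_plus[OF that] in \<open>auto simp: power_abs intro!: AE_I2\<close>)
    have prod: "integrable M (\<lambda>\<omega>. S \<omega>^k * \<eta> i \<omega>^m) \<and>
        expectation (\<lambda>\<omega>. S \<omega>^k * \<eta> i \<omega>^m) = expectation (\<lambda>\<omega>. S \<omega>^k) * expectation (\<lambda>\<omega>. \<eta> i \<omega>^m)"
      if "k \<le> 4" "m \<le> 8" for k m
    proof -
      have iv: "indep_var borel (\<lambda>\<omega>. S \<omega>^k) borel (\<lambda>\<omega>. \<eta> i \<omega>^m)"
        using indep_var_compose[OF indS, of "\<lambda>x. x^k" borel "\<lambda>x. x^m" borel] by (simp add: o_def)
      show ?thesis
        using indep_var_integrable[OF iv Sint[OF that(1)] integrable_power[OF iI that(2)]]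
          indep_var_lebesgue_integral[OF iv Sint[OF that(1)] integrable_power[OF iI that(2)]] by simp
    qed
    have eq: "(\<Sum>l\<in>insert i J. b l * \<eta> l \<omega>) = S \<omega> + b i * \<eta> i \<omega>" for \<omega>
      using insert.hyps by (simp add: S_def)
    have p31: "integrable M (\<lambda>\<omega>. S \<omega>^3 * \<eta> i \<omega>)" "expectation (\<lambda>\<omega>. S \<omega>^3 * \<eta> i \<omega>) = 0"
      using prod[of 3 1] mean0[OF iI] by simp_all
    have p22: "integrable M (\<lambda>\<omega>. S \<omega>^2 * \<eta> i \<omega>^2)" "expectation (\<lambda>\<omega>. S \<omega>^2 * \<eta> i \<omega>^2) = v"
      using prod[of 2 2] var1[OF iI] IH(3) by simp_all
    have p13: "integrable M (\<lambda>\<omega>. S \<omega> * \<eta> i \<omega>^3)" "expectation (\<lambda>\<omega>. S \<omega> * \<eta> i \<omega>^3) = 0"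
      using prod[of 1 3] IH(2) by simp_all
    have p11: "integrable M (\<lambda>\<omega>. S \<omega> * \<eta> i \<omega>)" "expectation (\<lambda>\<omega>. S \<omega> * \<eta> i \<omega>) = 0"
      using prod[of 1 1] mean0[OF iI] by simp_all
    have ints: "integrable M (\<lambda>\<omega>. S \<omega>^2)" "integrable M S" "integrable M (\<lambda>\<omega>. \<eta> i \<omega>^4)"
       "integrable M (\<lambda>\<omega>. \<eta> i \<omega>^2)" "integrable M (\<eta> i)"
      using Sint[of 2] Sint[of 1] integrable_power[OF iI, of 4] integrable_power[OF iI, of 2]
        integrable_power[OF iI, of 1] by simp_all
    have exp4: "(S \<omega> + b i * \<eta> i \<omega>)^4 = S \<omega>^4 + 4 * b i * (S \<omega>^3 * \<eta> i \<omega>)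
       + 6 * (b i)^2 * (S \<omega>^2 * \<eta> i \<omega>^2) + 4 * (b i)^3 * (S \<omega> * \<eta> i \<omega>^3) + (b i)^4 * \<eta> i \<omega>^4" for \<omega>
      by (simp add: power4_eq_xxxx power2_eq_square power3_eq_cube algebra_simps)
    have exp2: "(S \<omega> + b i * \<eta> i \<omega>)^2 = S \<omega>^2 + 2 * b i * (S \<omega> * \<eta> i \<omega>) + (b i)^2 * \<eta> i \<omega>^2" for \<omega>
      by (simp add: power2_eq_square algebra_simps)
    have i4: "integrable M (\<lambda>\<omega>. (S \<omega> + b i * \<eta> i \<omega>)^4)"
      unfolding exp4 by (simp add: p31 p22 p13 ints IH(1))
    have e4: "expectation (\<lambda>\<omega>. (S \<omega> + b i * \<eta> i \<omega>)^4)
        = expectation (\<lambda>\<omega>. S \<omega>^4) + 6 * (b i)^2 * v + (b i)^4 * expectation (\<lambda>\<omega>. \<eta> i \<omega>^4)"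
      unfolding exp4 by (simp add: p31 p22 p13 ints IH(1))
    have e2: "expectation (\<lambda>\<omega>. (S \<omega> + b i * \<eta> i \<omega>)^2) = v + (b i)^2"
      unfolding exp2 by (simp add: p11 ints IH(3) var1[OF iI])
    have e1: "expectation (\<lambda>\<omega>. S \<omega> + b i * \<eta> i \<omega>) = 0"
      by (simp add: ints IH(2) mean0[OF iI])
    have "expectation (\<lambda>\<omega>. \<eta> i \<omega>^4) \<le> \<kappa>" using abs_expectation_power_le[OF iI, of 4] by simp
    hence "(b i)^4 * expectation (\<lambda>\<omega>. \<eta> i \<omega>^4) \<le> (b i)^4 * \<kappa>" by (intro mult_left_mono) auto
    moreover have "6 * (b i)^2 * v \<le> 6 * \<kappa> * (b i)^2 * v"
      using \<kappa>1 v0 by (intro mult_right_mono) auto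
    moreover have "(b i)^4 * \<kappa> \<le> 3 * \<kappa> * (b i)^4" using \<kappa>1 by simp
    ultimately have "expectation (\<lambda>\<omega>. (S \<omega> + b i * \<eta> i \<omega>)^4)
       \<le> 3 * \<kappa> * v^2 + 6 * \<kappa> * (b i)^2 * v + 3 * \<kappa> * (b i)^4"
      unfolding e4 using IH(4) by linarith
    also have "\<dots> = 3 * \<kappa> * (v + (b i)^2)^2"
      by (simp add: power4_eq_xxxx power2_eq_square algebra_simps)
    finally have b4: "expectation (\<lambda>\<omega>. (S \<omega> + b i * \<eta> i \<omega>)^4) \<le> 3 * \<kappa> * (v + (b i)^2)^2" .
    have vi: "(\<Sum>l\<in>insert i J. (b l)^2) = v + (b i)^2" using insert.hyps by (simp add: v_def)
    show ?case unfolding eq vi using i4 e1 e2 b4 by simp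
  qed
qed

end

section \<open>Quadratic forms of projections with small leverages\<close>

text \<open>
  A projection matrix \<open>P\<close> on the index set of the errors whose diagonal entries, the leverages,
  are uniformly small. They are bounded by a square, since \<open>\<rho>\<close> itself is the rate of the normal
  approximation.
\<close>

locale leverage_form = standardized_errors +
  fixes P :: "nat \<Rightarrow> nat \<Rightarrow> real" and \<rho> :: real
  assumes P_sym: "\<And>i l. i \<in> I \<Longrightarrow> l \<in> I \<Longrightarrow> P i l = P l i"
    and P_idem: "\<And>i j. i \<in> I \<Longrightarrow> j \<in> I \<Longrightarrow> (\<Sum>l\<in>I. P i l * P l j) = P i j"
    and \<rho>: "0 < \<rho>" "\<rho> \<le> 1"
    and leverage: "\<And>i. i \<in> I \<Longrightarrow> P i i \<le> \<rho>^2"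
begin

text \<open>
  \<open>L\<close> is the projected error vector. \<open>A i\<close> and \<open>B i\<close> are the parts of the quadratic form \<open>T\<close> and
  of the coordinate \<open>L i\<close> that do not involve \<open>\<eta> i\<close>; conditioning on them turns \<open>T\<close> into a
  quadratic polynomial in the single independent variable \<open>\<eta> i\<close> (see \<open>T_split\<close>).
\<close>

definition T :: "'a \<Rightarrow> real" where "T \<omega> = (\<Sum>i\<in>I. \<Sum>l\<in>I. P i l * \<eta> i \<omega> * \<eta> l \<omega>)"
definition L :: "nat \<Rightarrow> 'a \<Rightarrow> real" where "L i \<omega> = (\<Sum>l\<in>I. P i l * \<eta> l \<omega>)"
definition B :: "nat \<Rightarrow> 'a \<Rightarrow> real" where "B i \<omega> = (\<Sum>l\<in>I-{i}. P i l * \<eta> l \<omega>)"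
definition A :: "nat \<Rightarrow> 'a \<Rightarrow> real" where "A i \<omega> = (\<Sum>j\<in>I-{i}. \<Sum>l\<in>I-{i}. P j l * \<eta> j \<omega> * \<eta> l \<omega>)"
definition d :: real where "d = (\<Sum>i\<in>I. P i i)"

lemma leverage_eq: "i \<in> I \<Longrightarrow> P i i = (\<Sum>l\<in>I. (P i l)^2)"
  using P_idem[of i i] P_sym by (auto simp: power2_eq_square intro!: sum.cong)

lemma leverage_nonneg: "i \<in> I \<Longrightarrow> 0 \<le> P i i"
  by (subst leverage_eq) (auto intro: sum_nonneg)

lemma leverage_le_1: "i \<in> I \<Longrightarrow> P i i \<le> 1"
  using leverage[of i] \<rho> power_le_one[of \<rho> 2] by linarith

lemma leverage_sq_le: assumes "i \<in> I" shows "(P i i)^2 \<le> \<rho> * P i i" "(P i i)^2 \<le> \<rho>^2 * P i i"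
  "(P i i)^3 \<le> \<rho> * P i i" "(P i i)^4 \<le> \<rho>^2 * P i i"
proof -
  have h: "0 \<le> P i i" "P i i \<le> 1" "P i i \<le> \<rho>^2" using leverage_nonneg leverage_le_1 leverage assms by auto
  have r: "\<rho>^2 \<le> \<rho>" using \<rho> by (simp add: power2_eq_square mult_left_le)
  show a: "(P i i)^2 \<le> \<rho> * P i i" "(P i i)^2 \<le> \<rho>^2 * P i i"
    using h r unfolding power2_eq_square[of "P i i"] by (auto intro!: mult_right_mono)
  have "(P i i)^3 \<le> (P i i)^2" "(P i i)^4 \<le> (P i i)^2" using h by (auto intro!: power_decreasing)
  thus "(P i i)^3 \<le> \<rho> * P i i" "(P i i)^4 \<le> \<rho>^2 * P i i" using a by linarith+
qed

lemma meas_TLBA [measurable]: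
  shows "i \<in> I \<Longrightarrow> L i \<in> borel_measurable M" "i \<in> I \<Longrightarrow> B i \<in> borel_measurable M"
    "i \<in> I \<Longrightarrow> A i \<in> borel_measurable M" "T \<in> borel_measurable M"
  unfolding L_def[abs_def] B_def[abs_def] A_def[abs_def] T_def[abs_def]
  by (intro borel_measurable_sum borel_measurable_times borel_measurable_const rv; auto)+

lemma L_split: "i \<in> I \<Longrightarrow> L i \<omega> = B i \<omega> + P i i * \<eta> i \<omega>"
  unfolding L_def B_def using fin by (simp add: sum.remove algebra_simps)

lemma T_eq_sum_L: "T \<omega> = (\<Sum>i\<in>I. \<eta> i \<omega> * L i \<omega>)"
  unfolding T_def L_def sum_distrib_left by (intro sum.cong refl) (simp add: algebra_simps)

text \<open>
  Idempotence enters the central limit theorem here: it makes the correction term of the Stein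
  identity, a multiple of \<open>\<Sum> (L i)\<^sup>2\<close>, a multiple of \<open>T\<close> itself.
\<close>

lemma T_eq_sum_L_sq: "T \<omega> = (\<Sum>i\<in>I. (L i \<omega>)^2)"
proof -
  have "(\<Sum>i\<in>I. (L i \<omega>)^2) = (\<Sum>i\<in>I. \<Sum>j\<in>I. \<Sum>l\<in>I. P i j * P i l * (\<eta> j \<omega> * \<eta> l \<omega>))"
    unfolding L_def power2_eq_square sum_product
    by (intro sum.cong refl) (simp add: algebra_simps)
  also have "\<dots> = (\<Sum>j\<in>I. \<Sum>i\<in>I. \<Sum>l\<in>I. P i j * P i l * (\<eta> j \<omega> * \<eta> l \<omega>))" by (rule sum.swap)
  also have "\<dots> = (\<Sum>j\<in>I. \<Sum>l\<in>I. \<Sum>i\<in>I. P i j * P i l * (\<eta> j \<omega> * \<eta> l \<omega>))"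
    by (intro sum.cong refl sum.swap)
  also have "\<dots> = (\<Sum>j\<in>I. \<Sum>l\<in>I. P j l * \<eta> j \<omega> * \<eta> l \<omega>)"
  proof (intro sum.cong refl)
    fix j l assume jl: "j \<in> I" "l \<in> I"
    have "(\<Sum>i\<in>I. P i j * P i l * (\<eta> j \<omega> * \<eta> l \<omega>)) = (\<Sum>i\<in>I. P j i * P i l) * (\<eta> j \<omega> * \<eta> l \<omega>)"
      unfolding sum_distrib_right using jl by (intro sum.cong refl) (simp add: P_sym[of j])
    thus "(\<Sum>i\<in>I. P i j * P i l * (\<eta> j \<omega> * \<eta> l \<omega>)) = P j l * \<eta> j \<omega> * \<eta> l \<omega>"
      unfolding P_idem[OF jl] by simp
  qed
  finally show ?thesis by (simp add: T_def)
qed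

lemma T_nonneg: "0 \<le> T \<omega>" unfolding T_eq_sum_L_sq by (simp add: sum_nonneg)

lemma T_split:
  assumes i: "i \<in> I" shows "T \<omega> = A i \<omega> + 2 * B i \<omega> * \<eta> i \<omega> + P i i * (\<eta> i \<omega>)^2"
proof -
  have "T \<omega> = (\<Sum>l\<in>I. P i l * \<eta> i \<omega> * \<eta> l \<omega>) + (\<Sum>j\<in>I-{i}. \<Sum>l\<in>I. P j l * \<eta> j \<omega> * \<eta> l \<omega>)"
    unfolding T_def by (rule sum.remove[OF fin i])
  also have "(\<Sum>j\<in>I-{i}. \<Sum>l\<in>I. P j l * \<eta> j \<omega> * \<eta> l \<omega>)
      = (\<Sum>j\<in>I-{i}. P j i * \<eta> j \<omega> * \<eta> i \<omega> + (\<Sum>l\<in>I-{i}. P j l * \<eta> j \<omega> * \<eta> l \<omega>))"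
    by (intro sum.cong refl sum.remove[OF fin i])
  also have "\<dots> = \<eta> i \<omega> * B i \<omega> + A i \<omega>"
    unfolding sum.distrib A_def B_def sum_distrib_left using i
    by (auto intro!: sum.cong simp: P_sym[OF i] algebra_simps)
  also have "(\<Sum>l\<in>I. P i l * \<eta> i \<omega> * \<eta> l \<omega>) = \<eta> i \<omega> * L i \<omega>"
    unfolding L_def sum_distrib_left by (auto intro!: sum.cong simp: algebra_simps)
  finally show ?thesis using L_split[OF i] by (simp add: algebra_simps power2_eq_square)
qed

text \<open>
  The odd moments are interpolated between the even ones by the inequality of the arithmetic and
  geometric mean with weight \<open>\<rho>\<close>. Since \<open>\<rho>\<close> bounds the standard deviation of \<open>B i\<close>, each
  additional power of \<open>\<bar>B i\<bar>\<close> beyond the second costs a factor \<open>\<rho>\<close>.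
\<close>

lemma B_moments:
  assumes i: "i \<in> I"
  shows "k \<le> 4 \<Longrightarrow> integrable M (\<lambda>\<omega>. \<bar>B i \<omega>\<bar>^k)"
    "expectation (\<lambda>\<omega>. \<bar>B i \<omega>\<bar>^2) \<le> P i i"
    "expectation (\<lambda>\<omega>. \<bar>B i \<omega>\<bar>^4) \<le> 3 * \<kappa> * (P i i)^2"
    "expectation (\<lambda>\<omega>. \<bar>B i \<omega>\<bar>) \<le> \<rho>"
    "expectation (\<lambda>\<omega>. \<bar>B i \<omega>\<bar>^3) \<le> 2 * \<kappa> * (\<rho> * P i i)"
proof -
  have le: "(\<Sum>l\<in>I-{i}. (P i l)^2) \<le> P i i" "0 \<le> (\<Sum>l\<in>I-{i}. (P i l)^2)"
    using leverage_eq[OF i] sum.remove[OF fin i, of "\<lambda>l. (P i l)^2"] zero_le_power2[of "P i i"]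
    by (linarith, auto intro: sum_nonneg)
  note lm = linear_form_moments[of "I-{i}" "P i", folded B_def]
  have i4: "integrable M (\<lambda>\<omega>. \<bar>B i \<omega>\<bar>^4)" using lm by (simp add: power_even_abs)
  show int: "integrable M (\<lambda>\<omega>. \<bar>B i \<omega>\<bar>^k)" if "k \<le> 4" for k
    by (rule Bochner_Integration.integrable_bound[of M "\<lambda>\<omega>. 1 + \<bar>B i \<omega>\<bar>^4"])
       (use i4 i abs_power_le_one_plus[OF that] in \<open>auto intro!: AE_I2\<close>)
  show e2: "expectation (\<lambda>\<omega>. \<bar>B i \<omega>\<bar>^2) \<le> P i i" using lm le by simp
  have "((\<Sum>l\<in>I-{i}. (P i l)^2))^2 \<le> (P i i)^2" using le by (intro power_mono) auto
  hence "3 * \<kappa> * (\<Sum>l\<in>I-{i}. (P i l)^2)^2 \<le> 3 * \<kappa> * (P i i)^2" using \<kappa>1 by (intro mult_left_mono) auto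
  thus e4: "expectation (\<lambda>\<omega>. \<bar>B i \<omega>\<bar>^4) \<le> 3 * \<kappa> * (P i i)^2" using lm by (auto simp: power_even_abs)
  have amgm: "\<bar>x\<bar> \<le> \<rho> / 2 + \<bar>x\<bar>^2 / (2 * \<rho>)" for x :: real
  proof -
    have "0 \<le> (\<bar>x\<bar> - \<rho>)^2 / (2 * \<rho>)" using \<rho> by simp
    also have "\<dots> = \<rho> / 2 + \<bar>x\<bar>^2 / (2 * \<rho>) - \<bar>x\<bar>" using \<rho> by (simp add: power2_diff field_simps power2_eq_square)
    finally show ?thesis by simp
  qed
  have hr: "P i i / (2 * \<rho>) \<le> \<rho> / 2" using leverage[OF i] \<rho> by (simp add: field_simps power2_eq_square)
  have "expectation (\<lambda>\<omega>. \<bar>B i \<omega>\<bar>) \<le> expectation (\<lambda>\<omega>. \<rho> / 2 + \<bar>B i \<omega>\<bar>^2 / (2 * \<rho>))"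
    using int[of 1] int[of 2] amgm by (intro integral_mono) auto
  also have "\<dots> = \<rho> / 2 + expectation (\<lambda>\<omega>. \<bar>B i \<omega>\<bar>^2) / (2 * \<rho>)"
    using int[of 2] by (simp add: prob_space)
  also have "\<dots> \<le> \<rho> / 2 + P i i / (2 * \<rho>)" using e2 \<rho> by (simp add: divide_right_mono)
  also have "\<dots> \<le> \<rho>" using hr by simp
  finally show "expectation (\<lambda>\<omega>. \<bar>B i \<omega>\<bar>) \<le> \<rho>" .
  have "expectation (\<lambda>\<omega>. \<bar>B i \<omega>\<bar>^3) \<le> expectation (\<lambda>\<omega>. \<rho> / 2 * \<bar>B i \<omega>\<bar>^2 + \<bar>B i \<omega>\<bar>^4 / (2 * \<rho>))"
  proof (intro integral_mono)
    fix \<omega>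
    have "\<bar>B i \<omega>\<bar>^2 * \<bar>B i \<omega>\<bar> \<le> \<bar>B i \<omega>\<bar>^2 * (\<rho> / 2 + \<bar>B i \<omega>\<bar>^2 / (2 * \<rho>))"
      using amgm by (intro mult_left_mono) auto
    thus "\<bar>B i \<omega>\<bar>^3 \<le> \<rho> / 2 * \<bar>B i \<omega>\<bar>^2 + \<bar>B i \<omega>\<bar>^4 / (2 * \<rho>)"
      by (simp add: power3_eq_cube power4_eq_xxxx power2_eq_square algebra_simps)
  qed (use int[of 3] int[of 2] int[of 4] in simp_all)
  also have "\<dots> = \<rho> / 2 * expectation (\<lambda>\<omega>. \<bar>B i \<omega>\<bar>^2) + expectation (\<lambda>\<omega>. \<bar>B i \<omega>\<bar>^4) / (2 * \<rho>)"
    using int[of 2] int[of 4] by simp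
  also have "\<dots> \<le> \<rho> / 2 * P i i + 3 * \<kappa> * (P i i)^2 / (2 * \<rho>)"
    using e2 e4 \<rho> by (intro add_mono mult_left_mono divide_right_mono) auto
  also have "3 * \<kappa> * (P i i)^2 / (2 * \<rho>) = 3 * \<kappa> * P i i * (P i i / (2 * \<rho>))"
    by (simp add: power2_eq_square)
  also have "\<rho> / 2 * P i i + 3 * \<kappa> * P i i * (P i i / (2 * \<rho>)) \<le> \<rho> / 2 * P i i + 3 * \<kappa> * P i i * (\<rho> / 2)"
    using hr \<kappa>1 leverage_nonneg[OF i] by (intro add_left_mono mult_left_mono) auto
  also have "\<dots> = \<rho> / 2 * P i i * 1 + 3 * \<kappa> * P i i * (\<rho> / 2)" by simp
  also have "\<dots> \<le> \<rho> / 2 * P i i * \<kappa> + 3 * \<kappa> * P i i * (\<rho> / 2)"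
    using \<kappa>1 leverage_nonneg[OF i] \<rho> by (intro add_right_mono mult_left_mono) auto
  also have "\<dots> = 2 * \<kappa> * (\<rho> * P i i)" by (simp add: algebra_simps)
  finally show "expectation (\<lambda>\<omega>. \<bar>B i \<omega>\<bar>^3) \<le> 2 * \<kappa> * (\<rho> * P i i)" .
qed

lemma indep_AB:
  assumes i: "i \<in> I" and G: "G \<in> measurable (borel \<Otimes>\<^sub>M borel) N" and q: "q \<in> measurable borel N'"
  shows "indep_var N (\<lambda>\<omega>. G (A i \<omega>, B i \<omega>)) N' (\<lambda>\<omega>. q (\<eta> i \<omega>))"
proof -
  let ?g = "\<lambda>x. ((\<Sum>j\<in>I-{i}. \<Sum>l\<in>I-{i}. P j l * x j * x l), (\<Sum>l\<in>I-{i}. P i l * x l))"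
  have g: "?g \<in> measurable (PiM (I-{i}) (\<lambda>_. borel)) (borel \<Otimes>\<^sub>M borel)"
    by (intro measurable_Pair borel_measurable_sum borel_measurable_times borel_measurable_const
          measurable_component_singleton)
  have "indep_var N (\<lambda>\<omega>. (\<lambda>x. G (?g x)) (\<lambda>l\<in>I-{i}. \<eta> l \<omega>)) N' (\<lambda>\<omega>. q (\<eta> i \<omega>))"
    by (rule indep_of_the_others[OF i _ _ measurable_compose[OF g G] q]) auto
  moreover have "?g (\<lambda>l\<in>I-{i}. \<eta> l \<omega>) = (A i \<omega>, B i \<omega>)" for \<omega>
    unfolding A_def B_def by (auto intro!: sum.cong)
  ultimately show ?thesis by simp
qed

lemma mixed_abs_moment:
  assumes i: "i \<in> I" and ab: "a \<le> 4" "b \<le> 8"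
  shows "integrable M (\<lambda>\<omega>. \<bar>B i \<omega>\<bar>^a * \<bar>\<eta> i \<omega>\<bar>^b)"
    and "expectation (\<lambda>\<omega>. \<bar>B i \<omega>\<bar>^a * \<bar>\<eta> i \<omega>\<bar>^b) \<le> \<kappa> * expectation (\<lambda>\<omega>. \<bar>B i \<omega>\<bar>^a)"
proof -
  have iv: "indep_var borel (\<lambda>\<omega>. \<bar>B i \<omega>\<bar>^a) borel (\<lambda>\<omega>. \<bar>\<eta> i \<omega>\<bar>^b)"
    using indep_AB[OF i, of "\<lambda>x. \<bar>snd x\<bar>^a" borel "\<lambda>x. \<bar>x\<bar>^b" borel] by simp
  note ii = B_moments(1)[OF i ab(1)] integrable_abs_power[OF i ab(2)]
  show "integrable M (\<lambda>\<omega>. \<bar>B i \<omega>\<bar>^a * \<bar>\<eta> i \<omega>\<bar>^b)" by (rule indep_var_integrable[OF iv ii])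
  have "expectation (\<lambda>\<omega>. \<bar>B i \<omega>\<bar>^a * \<bar>\<eta> i \<omega>\<bar>^b) = expectation (\<lambda>\<omega>. \<bar>B i \<omega>\<bar>^a) * expectation (\<lambda>\<omega>. \<bar>\<eta> i \<omega>\<bar>^b)"
    by (rule indep_var_lebesgue_integral[OF iv ii])
  also have "\<dots> \<le> expectation (\<lambda>\<omega>. \<bar>B i \<omega>\<bar>^a) * \<kappa>"
    by (intro mult_left_mono expectation_abs_power_le i ab Bochner_Integration.integral_nonneg) auto
  finally show "expectation (\<lambda>\<omega>. \<bar>B i \<omega>\<bar>^a * \<bar>\<eta> i \<omega>\<bar>^b) \<le> \<kappa> * expectation (\<lambda>\<omega>. \<bar>B i \<omega>\<bar>^a)"
    by (simp add: mult.commute)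
qed

text \<open>
  \<open>A i\<close> and \<open>B i\<close> depend on each other, but jointly they are independent of \<open>\<eta> i\<close>. The moments
  of \<open>\<eta> i\<close> therefore split off as numbers even in the presence of the phase \<open>e\<^sup>i\<^sup>s\<^sup>A\<close>.
\<close>

lemma mixed_phase_moment:
  fixes s :: real
  assumes i: "i \<in> I" and ab: "a \<le> 4" "b \<le> 8"
  shows "integrable M (\<lambda>\<omega>. iexp (s * A i \<omega>) * of_real (B i \<omega>^a) * of_real (\<eta> i \<omega>^b))"
    and "(CLINT \<omega>|M. iexp (s * A i \<omega>) * of_real (B i \<omega>^a) * of_real (\<eta> i \<omega>^b))
       = (CLINT \<omega>|M. iexp (s * A i \<omega>) * of_real (B i \<omega>^a)) * of_real (expectation (\<lambda>\<omega>. \<eta> i \<omega>^b))"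
    and "integrable M (\<lambda>\<omega>. iexp (s * A i \<omega>) * of_real (B i \<omega>^a))"
    and "cmod (CLINT \<omega>|M. iexp (s * A i \<omega>) * of_real (B i \<omega>^a)) \<le> expectation (\<lambda>\<omega>. \<bar>B i \<omega>\<bar>^a)"
proof -
  have iv: "indep_var borel (\<lambda>\<omega>. iexp (s * A i \<omega>) * complex_of_real (B i \<omega>^a)) borel (\<lambda>\<omega>. complex_of_real (\<eta> i \<omega>^b))"
    using indep_AB[OF i, of "\<lambda>x. iexp (s * fst x) * complex_of_real (snd x^a)" borel "\<lambda>x. complex_of_real (x^b)" borel]
    by simp
  show i1: "integrable M (\<lambda>\<omega>. iexp (s * A i \<omega>) * complex_of_real (B i \<omega>^a))"
    by (rule Bochner_Integration.integrable_bound[OF B_moments(1)[OF i ab(1)]])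
       (use i in \<open>auto simp: norm_mult norm_power intro!: AE_I2\<close>)
  have i2: "integrable M (\<lambda>\<omega>. complex_of_real (\<eta> i \<omega>^b))"
    using integrable_power[OF i ab(2)] by (simp del: of_real_power add: complex_of_real_integrable_eq)
  show "integrable M (\<lambda>\<omega>. iexp (s * A i \<omega>) * of_real (B i \<omega>^a) * of_real (\<eta> i \<omega>^b))"
    by (rule indep_var_integrable[OF iv i1 i2])
  show "(CLINT \<omega>|M. iexp (s * A i \<omega>) * of_real (B i \<omega>^a) * of_real (\<eta> i \<omega>^b))
       = (CLINT \<omega>|M. iexp (s * A i \<omega>) * of_real (B i \<omega>^a)) * of_real (expectation (\<lambda>\<omega>. \<eta> i \<omega>^b))"
    unfolding indep_var_lebesgue_integral[OF iv i1 i2] by (simp only: integral_complex_of_real)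
  have "cmod (CLINT \<omega>|M. iexp (s * A i \<omega>) * of_real (B i \<omega>^a)) \<le> expectation (\<lambda>\<omega>. cmod (iexp (s * A i \<omega>) * of_real (B i \<omega>^a)))"
    by (rule integral_norm_bound)
  thus "cmod (CLINT \<omega>|M. iexp (s * A i \<omega>) * of_real (B i \<omega>^a)) \<le> expectation (\<lambda>\<omega>. \<bar>B i \<omega>\<bar>^a)"
    by (simp add: norm_mult norm_power)
qed

end

lemma iexp_taylor1: "cmod (iexp x - 1) \<le> \<bar>x\<bar>"
  using iexp_approx1[of x 0] by simp

lemma iexp_taylor2: "cmod (iexp x - 1 - \<i> * x) \<le> x^2 / 2"
  using iexp_approx1[of x 1] by (simp add: power2_eq_square diff_diff_eq)

lemma abs_sum_power_le:
  fixes x y :: real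
  assumes "0 \<le> x" "0 \<le> y"
  shows "(x + y)^2 \<le> 2 * (x^2 + y^2)" "(x + y)^3 \<le> 4 * (x^3 + y^3)" "(x + y)^4 \<le> 8 * (x^4 + y^4)"
proof -
  show 2: "(x + y)^2 \<le> 2 * (x^2 + y^2)" for x y :: real
    using zero_le_power2[of "x - y"] by (simp add: power2_eq_square algebra_simps)
  have "0 \<le> 3 * ((x + y) * (x - y)^2)" using assms by simp
  also have "\<dots> = 4 * (x^3 + y^3) - (x + y)^3"
    by (simp add: power2_eq_square power3_eq_cube algebra_simps)
  finally show "(x + y)^3 \<le> 4 * (x^3 + y^3)" by simp
  have "(x + y)^4 = ((x + y)^2)^2" by (simp add: power4_eq_xxxx power2_eq_square)
  also have "\<dots> \<le> (2 * (x^2 + y^2))^2" by (intro power_mono 2) simp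
  also have "\<dots> = 4 * (x^2 + y^2)^2" by (simp only: power_mult_distrib) simp
  also have "\<dots> \<le> 4 * (2 * ((x^2)^2 + (y^2)^2))" using 2[of "x^2" "y^2"] by simp
  finally show "(x + y)^4 \<le> 8 * (x^4 + y^4)" by simp
qed

context leverage_form
begin

text \<open>
  A bound for \<open>\<bar>L i\<bar>\<close> in which \<open>B i\<close> and \<open>\<eta> i\<close> are separated, so that its mixed moments with
  \<open>\<eta> i\<close> factor.
\<close>

definition G :: "nat \<Rightarrow> 'a \<Rightarrow> real" where "G i \<omega> = \<bar>B i \<omega>\<bar> + P i i * \<bar>\<eta> i \<omega>\<bar>"

lemma abs_L_le: "i \<in> I \<Longrightarrow> \<bar>L i \<omega>\<bar> \<le> G i \<omega>"
  unfolding G_def using leverage_nonneg[of i] by (simp add: L_split abs_mult order_trans[OF abs_triangle_ineq])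

lemma G_nonneg: "i \<in> I \<Longrightarrow> 0 \<le> G i \<omega>"
  using abs_L_le[of i \<omega>] abs_ge_zero order_trans by blast

lemma G_power_le:
  assumes i: "i \<in> I"
  shows "G i \<omega>^2 \<le> 2 * \<bar>B i \<omega>\<bar>^2 + 2 * (P i i)^2 * \<bar>\<eta> i \<omega>\<bar>^2"
    "G i \<omega>^3 \<le> 4 * \<bar>B i \<omega>\<bar>^3 + 4 * (P i i)^3 * \<bar>\<eta> i \<omega>\<bar>^3"
    "G i \<omega>^4 \<le> 8 * \<bar>B i \<omega>\<bar>^4 + 8 * (P i i)^4 * \<bar>\<eta> i \<omega>\<bar>^4"
  using abs_sum_power_le[of "\<bar>B i \<omega>\<bar>" "P i i * \<bar>\<eta> i \<omega>\<bar>"] leverage_nonneg[OF i]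
  unfolding G_def power_mult_distrib distrib_left by (auto simp del: power_abs power2_abs simp: mult.assoc)

lemma meas_G [measurable]: "i \<in> I \<Longrightarrow> G i \<in> borel_measurable M"
  unfolding G_def[abs_def] by measurable

text \<open>
  The common pattern of the second, third and fourth moment: once the power of the sum has been
  split (with constant \<open>c\<close>), independence leaves moments of \<open>B i\<close> and \<open>\<eta> i\<close> alone.
\<close>

lemma G_moment:
  assumes i: "i \<in> I" and m: "m \<le> 4" "b + m \<le> 8"
    and c: "\<And>\<omega>. G i \<omega>^m \<le> c * \<bar>B i \<omega>\<bar>^m + c * (P i i)^m * \<bar>\<eta> i \<omega>\<bar>^m" "c \<ge> 0"
  shows "integrable M (\<lambda>\<omega>. \<bar>\<eta> i \<omega>\<bar>^b * G i \<omega>^m)"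
    "expectation (\<lambda>\<omega>. \<bar>\<eta> i \<omega>\<bar>^b * G i \<omega>^m) \<le> c * \<kappa> * (expectation (\<lambda>\<omega>. \<bar>B i \<omega>\<bar>^m) + (P i i)^m)"
proof -
  let ?U = "\<lambda>\<omega>. c * (\<bar>B i \<omega>\<bar>^m * \<bar>\<eta> i \<omega>\<bar>^b) + c * (P i i)^m * \<bar>\<eta> i \<omega>\<bar>^(b + m)"
  have int: "integrable M ?U" using mixed_abs_moment(1)[OF i m(1), of b] m integrable_abs_power[OF i m(2)]
    by simp
  have le: "\<bar>\<eta> i \<omega>\<bar>^b * G i \<omega>^m \<le> ?U \<omega>" for \<omega>
  proof -
    have "\<bar>\<eta> i \<omega>\<bar>^b * G i \<omega>^m \<le> \<bar>\<eta> i \<omega>\<bar>^b * (c * \<bar>B i \<omega>\<bar>^m + c * (P i i)^m * \<bar>\<eta> i \<omega>\<bar>^m)"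
      by (intro mult_left_mono c) auto
    thus ?thesis by (simp add: algebra_simps power_add)
  qed
  show "integrable M (\<lambda>\<omega>. \<bar>\<eta> i \<omega>\<bar>^b * G i \<omega>^m)"
    by (rule Bochner_Integration.integrable_bound[OF int])
       (use i le G_nonneg[OF i] in \<open>auto intro!: AE_I2 order_trans[OF le abs_ge_self]\<close>)
  hence "expectation (\<lambda>\<omega>. \<bar>\<eta> i \<omega>\<bar>^b * G i \<omega>^m) \<le> expectation ?U"
    by (intro integral_mono int le)
  also have "\<dots> = c * expectation (\<lambda>\<omega>. \<bar>B i \<omega>\<bar>^m * \<bar>\<eta> i \<omega>\<bar>^b) + c * (P i i)^m * expectation (\<lambda>\<omega>. \<bar>\<eta> i \<omega>\<bar>^(b+m))"
    using mixed_abs_moment(1)[OF i m(1), of b] m integrable_abs_power[OF i m(2)] by simp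
  also have "\<dots> \<le> c * (\<kappa> * expectation (\<lambda>\<omega>. \<bar>B i \<omega>\<bar>^m)) + c * (P i i)^m * \<kappa>"
    using leverage_nonneg[OF i] m c
    by (intro add_mono mult_left_mono mixed_abs_moment(2)[OF i] expectation_abs_power_le[OF i]) auto
  finally show "expectation (\<lambda>\<omega>. \<bar>\<eta> i \<omega>\<bar>^b * G i \<omega>^m) \<le> c * \<kappa> * (expectation (\<lambda>\<omega>. \<bar>B i \<omega>\<bar>^m) + (P i i)^m)"
    by (simp add: algebra_simps)
qed

lemma G2_moment:
  assumes i: "i \<in> I" and b: "b \<le> 4"
  shows "integrable M (\<lambda>\<omega>. \<bar>\<eta> i \<omega>\<bar>^b * G i \<omega>^2)"
    "expectation (\<lambda>\<omega>. \<bar>\<eta> i \<omega>\<bar>^b * G i \<omega>^2) \<le> 4 * \<kappa> * P i i"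
proof -
  have c: "G i \<omega>^2 \<le> 2 * \<bar>B i \<omega>\<bar>^2 + 2 * (P i i)^2 * \<bar>\<eta> i \<omega>\<bar>^2" for \<omega> by (rule G_power_le[OF i])
  show "integrable M (\<lambda>\<omega>. \<bar>\<eta> i \<omega>\<bar>^b * G i \<omega>^2)"
    by (rule G_moment(1)[OF i _ _ c]) (use b in auto)
  have "expectation (\<lambda>\<omega>. \<bar>\<eta> i \<omega>\<bar>^b * G i \<omega>^2) \<le> 2 * \<kappa> * (expectation (\<lambda>\<omega>. \<bar>B i \<omega>\<bar>^2) + (P i i)^2)"
    by (rule G_moment(2)[OF i _ _ c]) (use b in auto)
  also have "\<dots> \<le> 2 * \<kappa> * (P i i + P i i)"
    using B_moments(2)[OF i] leverage_le_1[OF i] leverage_nonneg[OF i] \<kappa>1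
    by (intro mult_left_mono add_mono) (auto simp: power2_eq_square mult_left_le)
  finally show "expectation (\<lambda>\<omega>. \<bar>\<eta> i \<omega>\<bar>^b * G i \<omega>^2) \<le> 4 * \<kappa> * P i i" by simp
qed

lemma G3_moment:
  assumes i: "i \<in> I" and b: "b \<le> 4"
  shows "integrable M (\<lambda>\<omega>. \<bar>\<eta> i \<omega>\<bar>^b * G i \<omega>^3)"
    "expectation (\<lambda>\<omega>. \<bar>\<eta> i \<omega>\<bar>^b * G i \<omega>^3) \<le> 12 * \<kappa>^2 * (\<rho> * P i i)"
proof -
  have c: "G i \<omega>^3 \<le> 4 * \<bar>B i \<omega>\<bar>^3 + 4 * (P i i)^3 * \<bar>\<eta> i \<omega>\<bar>^3" for \<omega> by (rule G_power_le[OF i])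
  show "integrable M (\<lambda>\<omega>. \<bar>\<eta> i \<omega>\<bar>^b * G i \<omega>^3)"
    by (rule G_moment(1)[OF i _ _ c]) (use b in auto)
  have "expectation (\<lambda>\<omega>. \<bar>\<eta> i \<omega>\<bar>^b * G i \<omega>^3) \<le> 4 * \<kappa> * (expectation (\<lambda>\<omega>. \<bar>B i \<omega>\<bar>^3) + (P i i)^3)"
    by (rule G_moment(2)[OF i _ _ c]) (use b in auto)
  also have "\<dots> \<le> 4 * \<kappa> * (2 * \<kappa> * (\<rho> * P i i) + \<kappa> * (\<rho> * P i i))"
  proof (intro mult_left_mono add_mono B_moments(5)[OF i])
    have "(P i i)^3 \<le> 1 * (\<rho> * P i i)" using leverage_sq_le[OF i] by simp
    also have "\<dots> \<le> \<kappa> * (\<rho> * P i i)" using \<kappa>1 \<rho> leverage_nonneg[OF i] by (intro mult_right_mono) auto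
    finally show "(P i i)^3 \<le> \<kappa> * (\<rho> * P i i)" .
  qed (use \<kappa>1 in auto)
  finally show "expectation (\<lambda>\<omega>. \<bar>\<eta> i \<omega>\<bar>^b * G i \<omega>^3) \<le> 12 * \<kappa>^2 * (\<rho> * P i i)"
    by (simp add: algebra_simps power2_eq_square)
qed

lemma G4_moment:
  assumes i: "i \<in> I" and b: "b \<le> 4"
  shows "integrable M (\<lambda>\<omega>. \<bar>\<eta> i \<omega>\<bar>^b * G i \<omega>^4)"
    "expectation (\<lambda>\<omega>. \<bar>\<eta> i \<omega>\<bar>^b * G i \<omega>^4) \<le> 32 * \<kappa>^2 * (\<rho>^2 * P i i)"
proof -
  have c: "G i \<omega>^4 \<le> 8 * \<bar>B i \<omega>\<bar>^4 + 8 * (P i i)^4 * \<bar>\<eta> i \<omega>\<bar>^4" for \<omega> by (rule G_power_le[OF i])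
  show "integrable M (\<lambda>\<omega>. \<bar>\<eta> i \<omega>\<bar>^b * G i \<omega>^4)"
    by (rule G_moment(1)[OF i _ _ c]) (use b in auto)
  have "expectation (\<lambda>\<omega>. \<bar>\<eta> i \<omega>\<bar>^b * G i \<omega>^4) \<le> 8 * \<kappa> * (expectation (\<lambda>\<omega>. \<bar>B i \<omega>\<bar>^4) + (P i i)^4)"
    by (rule G_moment(2)[OF i _ _ c]) (use b in auto)
  also have "\<dots> \<le> 8 * \<kappa> * (3 * \<kappa> * (\<rho>^2 * P i i) + \<kappa> * (\<rho>^2 * P i i))"
  proof (intro mult_left_mono add_mono)
    show "expectation (\<lambda>\<omega>. \<bar>B i \<omega>\<bar>^4) \<le> 3 * \<kappa> * (\<rho>^2 * P i i)"
      by (rule order_trans[OF B_moments(3)[OF i]]) (use leverage_sq_le[OF i] \<kappa>1 in \<open>auto intro!: mult_left_mono\<close>)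
    have "(P i i)^4 \<le> 1 * (\<rho>^2 * P i i)" using leverage_sq_le[OF i] by simp
    also have "\<dots> \<le> \<kappa> * (\<rho>^2 * P i i)" using \<kappa>1 \<rho> leverage_nonneg[OF i] by (intro mult_right_mono) auto
    finally show "(P i i)^4 \<le> \<kappa> * (\<rho>^2 * P i i)" .
  qed (use \<kappa>1 in auto)
  finally show "expectation (\<lambda>\<omega>. \<bar>\<eta> i \<omega>\<bar>^b * G i \<omega>^4) \<le> 32 * \<kappa>^2 * (\<rho>^2 * P i i)"
    by (simp add: algebra_simps power2_eq_square)
qed

end

section \<open>Normal approximation by a differential equation\<close>

text \<open>
  The expansion behind the Stein identity, with \<open>e, b, h, \<sigma>\<close> in the place of \<open>\<eta> i\<close>, \<open>B i\<close>,
  \<open>P i i\<close>, \<open>is\<close>, where \<open>f\<close> stands for the phase of \<open>A i\<close> and \<open>E\<close> for the phase of the part of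
  \<open>T\<close> with \<open>\<eta> i\<close>. The first bracket collects what remains when \<open>E\<close> is replaced by its Taylor
  polynomial: a polynomial in \<open>e\<close> whose coefficients are free of \<open>e\<close>, arranged by powers of \<open>h\<close>.
  The second bracket holds the Taylor remainders.
\<close>

lemma stein_expansion:
  fixes f E b e h \<sigma> :: complex
  shows "f * E * ((e * (b + h * e) - h) - 2 * \<sigma> * (b + h * e)^2)
    = (f * b * e + h * (f * e^2 - f) + \<sigma> * (2 * (f * b^2 * e^2 - f * b^2)
        + h * (3 * (f * b * e^3) - 6 * (f * b * e)) + h^2 * (f * e^4 - 3 * (f * e^2))))
     + f * ((E - 1 - \<sigma> * (2 * b * e + h * e^2)) * (e * (b + h * e) - h) - 2 * \<sigma> * (b + h * e)^2 * (E - 1))"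
  by (simp add: algebra_simps power2_eq_square power3_eq_cube power4_eq_xxxx)

context leverage_form
begin

text \<open>
  In the polynomial part of the expansion mean \<open>0\<close> and variance \<open>1\<close> of \<open>\<eta> i\<close> cancel everything
  but a multiple of \<open>P i i B i\<close> (size \<open>\<rho> P i i\<close>) and one of \<open>(P i i)\<^sup>2\<close>; the cancellation of
  \<open>2is (B i)\<^sup>2\<close> is the reason for the correction term \<open>2is (L i)\<^sup>2\<close>. The Taylor remainders are
  of third order in \<open>L i\<close> or of second order with an extra factor \<open>P i i\<close>, hence again of size
  \<open>\<rho> P i i\<close>. In the constant, \<open>72\<close> comes from the third moments of \<open>G i\<close> and \<open>8\<close> from the
  second.
\<close>

lemma stein_step:
  assumes i: "i \<in> I"
  shows "cmod (CLINT \<omega>|M. iexp (s * T \<omega>) * (of_real (\<eta> i \<omega> * L i \<omega> - P i i) - 2 * (\<i> * s) * of_real ((L i \<omega>)^2)))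
     \<le> 80 * \<kappa>^2 * (\<rho> * P i i) * (\<bar>s\<bar> + s^2)"
proof -
  define h where "h = P i i"
  have h: "0 \<le> h" "h \<le> 1" "h^2 \<le> \<rho> * h"
    unfolding h_def using leverage_nonneg leverage_le_1 leverage_sq_le i by auto
  define Z where "Z a b \<omega> = iexp (s * A i \<omega>) * of_real (B i \<omega>^a) * of_real (\<eta> i \<omega>^b)" for a b \<omega>
  define \<Xi> where "\<Xi> \<omega> = 2 * B i \<omega> * \<eta> i \<omega> + h * (\<eta> i \<omega>)^2" for \<omega>
  define main where "main \<omega> = Z 1 1 \<omega> + of_real h * (Z 0 2 \<omega> - Z 0 0 \<omega>)
      + \<i> * s * (2 * (Z 2 2 \<omega> - Z 2 0 \<omega>) + of_real h * (3 * Z 1 3 \<omega> - 6 * Z 1 1 \<omega>)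
         + of_real h^2 * (Z 0 4 \<omega> - 3 * Z 0 2 \<omega>))" for \<omega>
  define rem where "rem \<omega> = iexp (s * A i \<omega>) * ((iexp (s * \<Xi> \<omega>) - 1 - \<i> * of_real (s * \<Xi> \<omega>)) * of_real (\<eta> i \<omega> * L i \<omega> - h)
       - 2 * (\<i> * s) * of_real ((L i \<omega>)^2) * (iexp (s * \<Xi> \<omega>) - 1))" for \<omega>
  have dec: "iexp (s * T \<omega>) * (of_real (\<eta> i \<omega> * L i \<omega> - P i i) - 2 * (\<i> * s) * of_real ((L i \<omega>)^2)) = main \<omega> + rem \<omega>" for \<omega>
  proof -
    have "iexp (s * T \<omega>) = iexp (s * A i \<omega>) * iexp (s * \<Xi> \<omega>)"
      unfolding exp_add[symmetric] T_split[OF i] \<Xi>_def h_def by (simp add: algebra_simps)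
    thus ?thesis
      using stein_expansion[of "iexp (s * A i \<omega>)" "iexp (s * \<Xi> \<omega>)" "of_real (\<eta> i \<omega>)" "of_real (B i \<omega>)" "of_real h" "\<i> * s"]
      unfolding main_def rem_def Z_def \<Xi>_def L_split[OF i] h_def[symmetric]
      by (simp add: mult.assoc power_one_right)
  qed
  have Zint: "integrable M (Z a b)" if "a \<le> 4" "b \<le> 8" for a b
    unfolding Z_def[abs_def] by (rule mixed_phase_moment(1)[OF i that])
  define g where "g a = (CLINT \<omega>|M. iexp (s * A i \<omega>) * of_real (B i \<omega>^a))" for a :: nat
  have Zexp: "(CLINT \<omega>|M. Z a b \<omega>) = g a * of_real (expectation (\<lambda>\<omega>. \<eta> i \<omega>^b))" if "a \<le> 4" "b \<le> 8" for a b
    unfolding Z_def[abs_def] g_def by (rule mixed_phase_moment(2)[OF i that])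
  have main_int: "integrable M main"
    unfolding main_def[abs_def] by (intro Bochner_Integration.integrable_add Bochner_Integration.integrable_diff integrable_mult_right Zint) auto
  have mom: "expectation (\<lambda>\<omega>. \<eta> i \<omega>^0) = 1" "expectation (\<lambda>\<omega>. \<eta> i \<omega>^1) = 0" "expectation (\<lambda>\<omega>. \<eta> i \<omega>^2) = 1"
    using mean0[OF i] var1[OF i] by (simp_all add: prob_space)
  define m where "m k = expectation (\<lambda>\<omega>. \<eta> i \<omega>^k)" for k :: nat
  have m: "m 0 = 1" "m 1 = 0" "m 2 = 1" using mom by (simp_all add: m_def)
  have zi: "integrable M (Z 1 1)" "integrable M (Z 0 2)" "integrable M (Z 0 0)" "integrable M (Z 2 2)"
    "integrable M (Z 2 0)" "integrable M (Z 1 3)" "integrable M (Z 0 4)"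
    by (auto intro!: Zint)
  have ze: "(CLINT \<omega>|M. Z 1 1 \<omega>) = g 1 * of_real (m 1)" "(CLINT \<omega>|M. Z 0 2 \<omega>) = g 0 * of_real (m 2)"
    "(CLINT \<omega>|M. Z 0 0 \<omega>) = g 0 * of_real (m 0)" "(CLINT \<omega>|M. Z 2 2 \<omega>) = g 2 * of_real (m 2)"
    "(CLINT \<omega>|M. Z 2 0 \<omega>) = g 2 * of_real (m 0)" "(CLINT \<omega>|M. Z 1 3 \<omega>) = g 1 * of_real (m 3)"
    "(CLINT \<omega>|M. Z 0 4 \<omega>) = g 0 * of_real (m 4)"
    unfolding m_def by (rule Zexp; simp)+
  have "(CLINT \<omega>|M. main \<omega>) = g 1 * of_real (m 1) + of_real h * (g 0 * of_real (m 2) - g 0 * of_real (m 0))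
      + \<i> * s * (2 * (g 2 * of_real (m 2) - g 2 * of_real (m 0)) + of_real h * (3 * (g 1 * of_real (m 3)) - 6 * (g 1 * of_real (m 1)))
         + of_real h^2 * (g 0 * of_real (m 4) - 3 * (g 0 * of_real (m 2))))"
    unfolding main_def by (simp add: zi ze del: One_nat_def)
  also have "\<dots> = \<i> * s * (of_real (3 * h * m 3) * g 1 + of_real (h^2 * (m 4 - 3)) * g 0)"
    unfolding m by (simp add: algebra_simps)
  finally have main_eq: "(CLINT \<omega>|M. main \<omega>) = \<i> * s * (of_real (3 * h * m 3) * g 1 + of_real (h^2 * (m 4 - 3)) * g 0)" .
  have gb: "cmod (g 1) \<le> \<rho>" "cmod (g 0) \<le> 1"
    unfolding g_def using mixed_phase_moment(4)[OF i, of 1 0 s] mixed_phase_moment(4)[OF i, of 0 0 s] B_moments(4)[OF i]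
    by (auto simp: prob_space simp del: One_nat_def)
  have mb: "\<bar>m 3\<bar> \<le> \<kappa>" "\<bar>m 4 - 3\<bar> \<le> 4 * \<kappa>"
  proof -
    have "\<bar>m 3\<bar> \<le> \<kappa>" "\<bar>m 4\<bar> \<le> \<kappa>"
      unfolding m_def by (rule abs_expectation_power_le[OF i]; simp)+
    thus "\<bar>m 3\<bar> \<le> \<kappa>" "\<bar>m 4 - 3\<bar> \<le> 4 * \<kappa>" using \<kappa>1 by linarith+
  qed
  have "cmod (of_real (3 * h * m 3) * g 1 + of_real (h^2 * (m 4 - 3)) * g 0) \<le> 3 * h * \<kappa> * \<rho> + h^2 * (4 * \<kappa>) * 1"
  proof (rule norm_triangle_le, unfold norm_mult norm_of_real abs_mult, intro add_mono mult_mono)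
  qed (use gb mb h \<rho> \<kappa>1 in auto)
  also have "\<dots> \<le> 3 * h * \<kappa> * \<rho> + (\<rho> * h) * (4 * \<kappa>) * 1"
    using h \<kappa>1 by (intro add_left_mono mult_right_mono) auto
  also have "\<dots> = 7 * \<kappa> * (\<rho> * h)" by (simp add: algebra_simps)
  finally have mainb: "cmod (CLINT \<omega>|M. main \<omega>) \<le> \<bar>s\<bar> * (7 * \<kappa> * (\<rho> * h))"
    unfolding main_eq norm_mult[of "\<i> * s"] by (simp only: norm_mult norm_ii norm_of_real mult_1 mult_left_mono abs_ge_zero)
  \<comment> \<open>The remainder is dominated pointwise by products of powers of |\<eta> i| and G i, since |L i| \<le>
    G i and |\<Xi>| \<le> 2 |\<eta> i| G i.\<close>
  define U where "U \<omega> = s^2 * (2 * (\<bar>\<eta> i \<omega>\<bar>^3 * G i \<omega>^3) + 2 * h * (\<bar>\<eta> i \<omega>\<bar>^2 * G i \<omega>^2) + 4 * (\<bar>\<eta> i \<omega>\<bar>^1 * G i \<omega>^3))" for \<omega>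
  have remU: "cmod (rem \<omega>) \<le> U \<omega>" for \<omega>
  proof -
    define e g where "e = \<bar>\<eta> i \<omega>\<bar>" and "g = G i \<omega>"
    have e: "0 \<le> e" and g: "0 \<le> g" using G_nonneg[OF i] by (auto simp: e_def g_def)
    have L: "\<bar>L i \<omega>\<bar> \<le> g" using abs_L_le[OF i] by (simp add: g_def)
    have X: "\<bar>\<Xi> \<omega>\<bar> \<le> 2 * e * g"
    proof -
      have "\<bar>\<Xi> \<omega>\<bar> = e * \<bar>2 * B i \<omega> + h * \<eta> i \<omega>\<bar>"
        unfolding \<Xi>_def e_def abs_mult[symmetric] by (simp add: algebra_simps power2_eq_square)
      also have "\<dots> \<le> e * (2 * g)"
      proof (rule mult_left_mono[OF _ e])
        have "\<bar>2 * B i \<omega> + h * \<eta> i \<omega>\<bar> \<le> \<bar>2 * B i \<omega>\<bar> + \<bar>h * \<eta> i \<omega>\<bar>" by (rule abs_triangle_ineq)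
        also have "\<dots> \<le> 2 * g" unfolding g_def G_def h_def[symmetric] using h by (simp add: abs_mult)
        finally show "\<bar>2 * B i \<omega> + h * \<eta> i \<omega>\<bar> \<le> 2 * g" .
      qed
      finally show ?thesis by simp
    qed
    have X2: "(\<Xi> \<omega>)^2 \<le> (2 * e * g)^2" using X by (metis abs_ge_zero power2_abs power_mono)
    have c1: "cmod (iexp (s * \<Xi> \<omega>) - 1 - \<i> * of_real (s * \<Xi> \<omega>)) \<le> s^2 * (2 * e * g)^2 / 2"
      by (rule order_trans[OF iexp_taylor2], unfold power_mult_distrib[of s])
         (intro divide_right_mono mult_left_mono X2; simp)
    have c2: "\<bar>\<eta> i \<omega> * L i \<omega> - h\<bar> \<le> e * g + h"
      using L e h mult_left_mono[OF L e] by (simp add: e_def abs_mult order_trans[OF abs_triangle_ineq4])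
    have c3: "cmod (iexp (s * \<Xi> \<omega>) - 1) \<le> \<bar>s\<bar> * (2 * e * g)"
      by (rule order_trans[OF iexp_taylor1], unfold abs_mult) (intro mult_left_mono X; simp)
    have c4: "(L i \<omega>)^2 \<le> g^2" using L by (metis abs_ge_zero power2_abs power_mono)
    have "cmod (rem \<omega>) \<le> cmod ((iexp (s * \<Xi> \<omega>) - 1 - \<i> * of_real (s * \<Xi> \<omega>)) * of_real (\<eta> i \<omega> * L i \<omega> - h))
       + cmod (2 * (\<i> * s) * of_real ((L i \<omega>)^2) * (iexp (s * \<Xi> \<omega>) - 1))"
      unfolding rem_def norm_mult[of "iexp (s * A i \<omega>)"] by (simp add: norm_triangle_ineq4)
    also have "\<dots> \<le> (s^2 * (2 * e * g)^2 / 2) * (e * g + h) + 2 * \<bar>s\<bar> * g^2 * (\<bar>s\<bar> * (2 * e * g))"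
      unfolding norm_mult norm_of_real using c1 c2 c3 c4 e g
      by (intro add_mono mult_mono) (auto simp: norm_mult abs_mult)
    also have "\<dots> = s^2 * (2 * (e^3 * g^3) + 2 * h * (e^2 * g^2) + 4 * (e^1 * g^3))"
    proof -
      have "S^2 * (2 * e * g)^2 / 2 * (e * g + h) + 2 * S * g^2 * (S * (2 * e * g))
         = S^2 * (2 * (e^3 * g^3) + 2 * h * (e^2 * g^2) + 4 * (e^1 * g^3))" for S :: real
        by (simp add: algebra_simps power2_eq_square power3_eq_cube)
      from this[of "\<bar>s\<bar>"] show ?thesis by (simp only: power2_abs)
    qed
    finally show ?thesis unfolding U_def e_def g_def .
  qed
  have Uint: "integrable M U" unfolding U_def[abs_def]
    using G3_moment(1)[OF i, of 3] G2_moment(1)[OF i, of 2] G3_moment(1)[OF i, of 1] by simp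
  have [measurable]: "rem \<in> borel_measurable M" unfolding rem_def[abs_def] \<Xi>_def using i by measurable
  have rem_int: "integrable M rem"
    by (rule Bochner_Integration.integrable_bound[OF Uint]) (auto intro!: AE_I2 order_trans[OF remU abs_ge_self])
  have "cmod (CLINT \<omega>|M. rem \<omega>) \<le> expectation U"
    by (rule order_trans[OF integral_norm_bound integral_mono[OF integrable_norm[OF rem_int] Uint remU]])
  also have "\<dots> = s^2 * (2 * expectation (\<lambda>\<omega>. \<bar>\<eta> i \<omega>\<bar>^3 * G i \<omega>^3)
      + 2 * h * expectation (\<lambda>\<omega>. \<bar>\<eta> i \<omega>\<bar>^2 * G i \<omega>^2) + 4 * expectation (\<lambda>\<omega>. \<bar>\<eta> i \<omega>\<bar>^1 * G i \<omega>^3))"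
    unfolding U_def using G3_moment(1)[OF i, of 3] G2_moment(1)[OF i, of 2] G3_moment(1)[OF i, of 1] by simp
  also have "\<dots> \<le> s^2 * (2 * (12 * \<kappa>^2 * (\<rho> * h)) + 2 * h * (4 * \<kappa> * h) + 4 * (12 * \<kappa>^2 * (\<rho> * h)))"
    unfolding h_def
    by (intro mult_left_mono add_mono G3_moment(2)[OF i] G2_moment(2)[OF i]) (use leverage_nonneg[OF i] in auto)
  also have "\<dots> = s^2 * (72 * \<kappa>^2 * (\<rho> * h) + 8 * (\<kappa> * h^2))" by (simp add: power2_eq_square)
  also have "\<dots> \<le> s^2 * (72 * \<kappa>^2 * (\<rho> * h) + 8 * (\<kappa>^2 * (\<rho> * h)))"
    using h \<kappa>1 \<rho> by (intro mult_left_mono add_left_mono mult_mono) (auto simp: power2_eq_square)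
  also have "\<dots> = s^2 * (80 * \<kappa>^2 * (\<rho> * h))" by (simp add: algebra_simps)
  finally have remb: "cmod (CLINT \<omega>|M. rem \<omega>) \<le> s^2 * (80 * \<kappa>^2 * (\<rho> * h))" .
  have "\<kappa> \<le> \<kappa>^2" using \<kappa>1 by (simp add: power2_eq_square)
  hence "7 * \<kappa> * (\<rho> * h) \<le> 80 * \<kappa>^2 * (\<rho> * h)" using \<rho> h \<kappa>1 by (intro mult_right_mono) auto
  hence "cmod (CLINT \<omega>|M. main \<omega>) \<le> \<bar>s\<bar> * (80 * \<kappa>^2 * (\<rho> * h))"
    using mainb by (meson abs_ge_zero mult_left_mono order_trans)
  moreover have "(CLINT \<omega>|M. main \<omega> + rem \<omega>) = (CLINT \<omega>|M. main \<omega>) + (CLINT \<omega>|M. rem \<omega>)"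
    by (rule Bochner_Integration.integral_add[OF main_int rem_int])
  ultimately show ?thesis unfolding dec using remb norm_triangle_ineq[of "CLINT \<omega>|M. main \<omega>" "CLINT \<omega>|M. rem \<omega>"]
    by (simp add: h_def[symmetric] algebra_simps)
qed

end

text \<open>
  The derivative of \<open>exp (u\<^sup>2/2) \<phi> u\<close> is \<open>exp (u\<^sup>2/2)\<close> times the defect of the differential
  equation, and \<open>exp (u\<^sup>2/2)\<close> is largest at \<open>\<bar>u\<bar> = \<bar>t\<bar>\<close>, so the mean value theorem bounds the
  change of \<open>exp (u\<^sup>2/2) \<phi> u\<close> between \<open>0\<close> and \<open>t\<close>.
\<close>

lemma gaussian_ode_bound:
  fixes \<phi> :: "real \<Rightarrow> complex"
  assumes der: "\<And>u. (\<phi> has_vector_derivative \<phi>' u) (at u)"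
    and bound: "\<And>u. \<bar>u\<bar> \<le> \<bar>t\<bar> \<Longrightarrow> cmod (\<phi>' u + u * \<phi> u) \<le> E"
    and zero: "\<phi> 0 = 1"
  shows "cmod (\<phi> t - of_real (exp (- (t^2) / 2))) \<le> \<bar>t\<bar> * E"
proof -
  define g where "g u = exp (u^2 / 2) *\<^sub>R \<phi> u" for u
  have g: "(g has_derivative (\<lambda>h. h *\<^sub>R (exp (u^2 / 2) *\<^sub>R (\<phi>' u + u * \<phi> u)))) (at u)" for u
  proof -
    have "(g has_vector_derivative (exp (u^2/2) *\<^sub>R \<phi>' u + (exp (u^2/2) * u) *\<^sub>R \<phi> u)) (at u)"
      unfolding g_def[abs_def]
      by (rule has_vector_derivative_scaleR[OF _ der]) (auto intro!: derivative_eq_intros)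
    thus ?thesis unfolding has_vector_derivative_def
      by (rule has_derivative_eq_rhs) (auto simp: fun_eq_iff scaleR_conv_of_real algebra_simps)
  qed
  have E0: "0 \<le> E" using bound[of 0] order_trans[OF norm_ge_zero] by fastforce
  have on: "onorm (\<lambda>h::real. h *\<^sub>R v) \<le> c" if "norm v \<le> c" "0 \<le> c" for v :: complex and c
  proof (rule onorm_bound)
    show "norm (x *\<^sub>R v) \<le> c * norm x" for x :: real
      using mult_left_mono[OF that(1), of "\<bar>x\<bar>"] by (simp add: mult.commute)
  qed fact
  have "norm (g t - g 0) \<le> exp (t^2 / 2) * E * norm (t - 0)"
  proof (rule differentiable_bound[where S = "{-\<bar>t\<bar>..\<bar>t\<bar>}" and f' = "\<lambda>u h. h *\<^sub>R (exp (u^2 / 2) *\<^sub>R (\<phi>' u + u * \<phi> u))"])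
    show "convex {-\<bar>t\<bar>..\<bar>t\<bar>}" by simp
    fix u assume u: "u \<in> {-\<bar>t\<bar>..\<bar>t\<bar>}"
    show "(g has_derivative (\<lambda>h. h *\<^sub>R (exp (u^2 / 2) *\<^sub>R (\<phi>' u + u * \<phi> u)))) (at u within {-\<bar>t\<bar>..\<bar>t\<bar>})"
      by (rule has_derivative_at_withinI[OF g])
    have ut: "\<bar>u\<bar> \<le> \<bar>t\<bar>" using u by auto
    hence "u^2 \<le> t^2" by (simp add: abs_le_square_iff)
    hence "norm (exp (u^2 / 2) *\<^sub>R (\<phi>' u + u * \<phi> u)) \<le> exp (t^2 / 2) * E"
      unfolding norm_scaleR using bound[OF ut] E0 by (intro mult_mono) auto
    thus "onorm (\<lambda>h. h *\<^sub>R (exp (u^2 / 2) *\<^sub>R (\<phi>' u + u * \<phi> u))) \<le> exp (t^2 / 2) * E"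
      by (rule on) (use E0 in simp)
  qed auto
  hence le: "norm (g t - 1) \<le> exp (t^2 / 2) * (\<bar>t\<bar> * E)" by (simp add: g_def zero mult_ac)
  have "\<phi> t - of_real (exp (- (t^2) / 2)) = exp (- (t^2) / 2) *\<^sub>R (g t - 1)"
    by (simp add: g_def scaleR_diff_right of_real_def flip: exp_add)
  hence "cmod (\<phi> t - of_real (exp (- (t^2) / 2))) = exp (- (t^2) / 2) * norm (g t - 1)" by simp
  also have "\<dots> \<le> exp (- (t^2) / 2) * (exp (t^2 / 2) * (\<bar>t\<bar> * E))" by (intro mult_left_mono le) auto
  also have "\<dots> = \<bar>t\<bar> * E" by (simp add: mult.assoc[symmetric] flip: exp_add)
  finally show ?thesis .
qed

text \<open>
  With a second moment, the error of the difference quotient is at most \<open>(t - u)\<^sup>2 E Q\<^sup>2\<close> by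
  Taylor's formula, which avoids an appeal to dominated convergence.
\<close>

lemma (in prob_space) char_has_vector_derivative:
  fixes Q :: "'a \<Rightarrow> real"
  assumes [measurable]: "Q \<in> borel_measurable M" and Q2: "integrable M (\<lambda>\<omega>. (Q \<omega>)^2)"
  shows "((\<lambda>t. CLINT \<omega>|M. iexp (t * Q \<omega>)) has_vector_derivative (CLINT \<omega>|M. iexp (u * Q \<omega>) * (\<i> * Q \<omega>))) (at u)"
proof -
  have Q1: "integrable M Q" by (rule square_integrable_imp_integrable) (use Q2 in auto)
  define C where "C = expectation (\<lambda>\<omega>. (Q \<omega>)^2)"
  define D where "D = (CLINT \<omega>|M. iexp (u * Q \<omega>) * (\<i> * Q \<omega>))"
  have i1: "integrable M (\<lambda>\<omega>. iexp (t * Q \<omega>))" for t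
    by (rule integrable_const_bound[where B=1]) auto
  have i2: "integrable M (\<lambda>\<omega>. iexp (u * Q \<omega>) * (\<i> * Q \<omega>))"
    by (rule Bochner_Integration.integrable_bound[OF Q1]) (auto simp: norm_mult)
  have est: "cmod ((CLINT \<omega>|M. iexp (t * Q \<omega>)) - (CLINT \<omega>|M. iexp (u * Q \<omega>)) - (t - u) *\<^sub>R D) \<le> (t - u)^2 * C" for t
  proof -
    have "(CLINT \<omega>|M. iexp (t * Q \<omega>)) - (CLINT \<omega>|M. iexp (u * Q \<omega>)) - (t - u) *\<^sub>R D
       = (CLINT \<omega>|M. iexp (t * Q \<omega>) - iexp (u * Q \<omega>) - (t - u) *\<^sub>R (iexp (u * Q \<omega>) * (\<i> * Q \<omega>)))"
      unfolding D_def using i1 i2 by simp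
    also have "cmod \<dots> \<le> expectation (\<lambda>\<omega>. (t - u)^2 * (Q \<omega>)^2)"
    proof (rule order_trans[OF integral_norm_bound integral_mono])
      show "integrable M (\<lambda>\<omega>. cmod (iexp (t * Q \<omega>) - iexp (u * Q \<omega>) - (t - u) *\<^sub>R (iexp (u * Q \<omega>) * (\<i> * Q \<omega>))))"
        using i1 i2 by (intro integrable_norm Bochner_Integration.integrable_diff integrable_scaleR_right) auto
      show "integrable M (\<lambda>\<omega>. (t - u)^2 * (Q \<omega>)^2)" using Q2 by simp
      fix \<omega>
      have "iexp (t * Q \<omega>) - iexp (u * Q \<omega>) - (t - u) *\<^sub>R (iexp (u * Q \<omega>) * (\<i> * Q \<omega>))
        = iexp (u * Q \<omega>) * (iexp ((t - u) * Q \<omega>) - 1 - \<i> * of_real ((t - u) * Q \<omega>))"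
      proof -
        have "iexp (t * Q \<omega>) = iexp (u * Q \<omega>) * iexp ((t - u) * Q \<omega>)"
          unfolding exp_add[symmetric] by (simp add: algebra_simps)
        thus ?thesis by (simp add: algebra_simps scaleR_conv_of_real)
      qed
      hence "cmod (iexp (t * Q \<omega>) - iexp (u * Q \<omega>) - (t - u) *\<^sub>R (iexp (u * Q \<omega>) * (\<i> * Q \<omega>)))
         = cmod (iexp ((t - u) * Q \<omega>) - 1 - \<i> * of_real ((t - u) * Q \<omega>))" by (simp only: norm_mult norm_exp_i_times mult_1)
      also have "\<dots> \<le> ((t - u) * Q \<omega>)^2 / 2" by (rule iexp_taylor2)
      also have "\<dots> \<le> (t - u)^2 * (Q \<omega>)^2" by (simp add: power_mult_distrib)
      finally show "cmod (iexp (t * Q \<omega>) - iexp (u * Q \<omega>) - (t - u) *\<^sub>R (iexp (u * Q \<omega>) * (\<i> * Q \<omega>))) \<le> (t - u)^2 * (Q \<omega>)^2" .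
    qed
    also have "\<dots> = (t - u)^2 * C" by (simp add: C_def)
    finally show ?thesis .
  qed
  have C0: "C \<ge> 0" unfolding C_def by simp
  show ?thesis unfolding has_vector_derivative_def D_def[symmetric] has_derivative_within_alt
  proof (intro conjI allI impI)
    show "bounded_linear (\<lambda>h. h *\<^sub>R D)" by (rule bounded_linear_scaleR_left)
    fix e :: real assume e: "e > 0"
    show "\<exists>\<delta>>0. \<forall>y\<in>UNIV. norm (y - u) < \<delta> \<longrightarrow>
         norm ((CLINT \<omega>|M. iexp (y * Q \<omega>)) - (CLINT \<omega>|M. iexp (u * Q \<omega>)) - (y - u) *\<^sub>R D) \<le> e * norm (y - u)"
    proof (intro exI[of _ "e / (C + 1)"] conjI ballI impI)
      show "e / (C + 1) > 0" using e C0 by simp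
      fix y assume y: "norm (y - u) < e / (C + 1)"
      have "(y - u)^2 * C = norm (y - u) * C * norm (y - u)" by (simp add: power2_eq_square)
      also have "\<dots> \<le> e * norm (y - u)"
      proof (intro mult_right_mono)
        have "norm (y - u) * C \<le> norm (y - u) * (C + 1)" by (intro mult_left_mono) auto
        also have "\<dots> \<le> e" using y C0 by (simp add: pos_less_divide_eq)
        finally show "norm (y - u) * C \<le> e" .
      qed simp
      finally show "norm ((CLINT \<omega>|M. iexp (y * Q \<omega>)) - (CLINT \<omega>|M. iexp (u * Q \<omega>)) - (y - u) *\<^sub>R D) \<le> e * norm (y - u)"
        using est[of y] by linarith
    qed
  qed
qed

context leverage_form
begin

lemma L_moments:
  assumes i: "i \<in> I"
  shows "integrable M (\<lambda>\<omega>. (L i \<omega>)^4)" "integrable M (\<lambda>\<omega>. (L i \<omega>)^2)" "expectation (\<lambda>\<omega>. (L i \<omega>)^2) = P i i"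
proof -
  note lm = linear_form_moments[of I "P i", folded L_def]
  show i4: "integrable M (\<lambda>\<omega>. (L i \<omega>)^4)" using lm by simp
  show "integrable M (\<lambda>\<omega>. (L i \<omega>)^2)"
    by (rule Bochner_Integration.integrable_bound[of M "\<lambda>\<omega>. 1 + (L i \<omega>)^4"])
       (use i4 i abs_power_le_one_plus[of 2 4] in \<open>auto simp: power_even_abs intro!: AE_I2\<close>)
  show "expectation (\<lambda>\<omega>. (L i \<omega>)^2) = P i i" using lm leverage_eq[OF i] by simp
qed

lemma T_moments: "integrable M (\<lambda>\<omega>. (T \<omega>)^2)" "integrable M T" "expectation T = d"
proof -
  show "integrable M (\<lambda>\<omega>. (T \<omega>)^2)"
  proof (rule Bochner_Integration.integrable_bound)
    show "integrable M (\<lambda>\<omega>. (\<Sum>i\<in>I. (L i \<omega>)^4) * real (card I))"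
      by (intro integrable_mult_left Bochner_Integration.integrable_sum L_moments)
    show "AE \<omega> in M. norm ((T \<omega>)^2) \<le> norm ((\<Sum>i\<in>I. (L i \<omega>)^4) * real (card I))"
    proof (rule AE_I2)
      fix \<omega>
      have "(T \<omega>)^2 \<le> (\<Sum>i\<in>I. ((L i \<omega>)^2)^2) * real (card I)"
        unfolding T_eq_sum_L_sq by (rule sum_squared_le_sum_of_squares)
      thus "norm ((T \<omega>)^2) \<le> norm ((\<Sum>i\<in>I. (L i \<omega>)^4) * real (card I))"
        by (simp add: sum_nonneg)
    qed
  qed measurable
  show "integrable M T" unfolding T_eq_sum_L_sq[abs_def]
    by (intro Bochner_Integration.integrable_sum L_moments)
  show "expectation T = d" unfolding T_eq_sum_L_sq[abs_def] d_def
    by (simp add: Bochner_Integration.integral_sum L_moments)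
qed

text \<open>
  Summation of \<open>stein_step\<close>: by the two representations of \<open>T\<close> the terms \<open>\<eta> i L i\<close> and \<open>(L i)\<^sup>2\<close>
  both add up to \<open>T\<close>, which leaves an identity for the characteristic function of \<open>T\<close> alone.
\<close>

lemma stein_sum:
  "cmod (CLINT \<omega>|M. iexp (s * T \<omega>) * (of_real (T \<omega> - d) - 2 * (\<i> * s) * of_real (T \<omega>)))
     \<le> 80 * \<kappa>^2 * (\<rho> * d) * (\<bar>s\<bar> + s^2)"
proof -
  let ?f = "\<lambda>i \<omega>. iexp (s * T \<omega>) * (of_real (\<eta> i \<omega> * L i \<omega> - P i i) - 2 * (\<i> * s) * of_real ((L i \<omega>)^2))"
  have int: "integrable M (?f i)" if i: "i \<in> I" for i
  proof (rule Bochner_Integration.integrable_bound)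
    show "integrable M (\<lambda>\<omega>. (\<bar>\<eta> i \<omega>\<bar>^2 + (L i \<omega>)^2 + \<bar>P i i\<bar>) + 2 * \<bar>s\<bar> * (L i \<omega>)^2)"
      using integrable_abs_power[OF i, of 2] L_moments[OF i] by simp
    show "AE \<omega> in M. norm (?f i \<omega>) \<le> norm ((\<bar>\<eta> i \<omega>\<bar>^2 + (L i \<omega>)^2 + \<bar>P i i\<bar>) + 2 * \<bar>s\<bar> * (L i \<omega>)^2)"
    proof (rule AE_I2)
      fix \<omega>
      have ab: "\<bar>a * b\<bar> \<le> a^2 + b^2" for a b :: real
        using sum_squares_bound[of "\<bar>a\<bar>" "\<bar>b\<bar>"] zero_le_power2[of a] zero_le_power2[of b]
        unfolding abs_mult power2_abs by linarith
      have "norm (?f i \<omega>) \<le> \<bar>\<eta> i \<omega> * L i \<omega> - P i i\<bar> + 2 * \<bar>s\<bar> * (L i \<omega>)^2"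
        unfolding norm_mult[of "iexp _"] norm_exp_i_times mult_1
        by (rule order_trans[OF norm_triangle_ineq4], unfold norm_of_real) (simp add: norm_mult norm_power)
      also have "\<dots> \<le> (\<eta> i \<omega>)^2 + (L i \<omega>)^2 + \<bar>P i i\<bar> + 2 * \<bar>s\<bar> * (L i \<omega>)^2"
        using ab[of "\<eta> i \<omega>" "L i \<omega>"] by linarith
      finally show "norm (?f i \<omega>) \<le> norm ((\<bar>\<eta> i \<omega>\<bar>^2 + (L i \<omega>)^2 + \<bar>P i i\<bar>) + 2 * \<bar>s\<bar> * (L i \<omega>)^2)" by simp
    qed
  qed (use i in measurable)
  have "iexp (s * T \<omega>) * (of_real (T \<omega> - d) - 2 * (\<i> * s) * of_real (T \<omega>)) = (\<Sum>i\<in>I. ?f i \<omega>)" for \<omega>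
  proof -
    have "complex_of_real (T \<omega> - d) = (\<Sum>i\<in>I. of_real (\<eta> i \<omega> * L i \<omega> - P i i))"
      unfolding T_eq_sum_L d_def sum_subtractf[symmetric] by simp
    moreover have "complex_of_real (T \<omega>) = (\<Sum>i\<in>I. of_real ((L i \<omega>)^2))"
      unfolding T_eq_sum_L_sq by simp
    ultimately show ?thesis by (simp only: sum_distrib_left sum_subtractf[symmetric])
  qed
  hence "cmod (CLINT \<omega>|M. iexp (s * T \<omega>) * (of_real (T \<omega> - d) - 2 * (\<i> * s) * of_real (T \<omega>)))
     = cmod (\<Sum>i\<in>I. CLINT \<omega>|M. ?f i \<omega>)"
    using int by (simp only: Bochner_Integration.integral_sum)
  also have "\<dots> \<le> (\<Sum>i\<in>I. 80 * \<kappa>^2 * (\<rho> * P i i) * (\<bar>s\<bar> + s^2))"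
    by (rule sum_norm_le[OF stein_step])
  also have "\<dots> = 80 * \<kappa>^2 * (\<rho> * d) * (\<bar>s\<bar> + s^2)"
    by (simp add: d_def sum_distrib_left sum_distrib_right)
  finally show ?thesis .
qed

text \<open>
  With \<open>s = u / sqrt(2d)\<close> the identity \<open>stein_sum\<close> reads \<open>U = 2is (U + d \<phi>) + O(\<delta>)\<close>, where
  \<open>U = E e\<^sup>i\<^sup>u\<^sup>Q (T - d)\<close> is a multiple of the derivative \<open>\<phi>'\<close>. The factor \<open>\<bar>1 - 2is\<bar>\<close> is at
  least \<open>1\<close>, so this first bounds \<open>U\<close>, and then shows that \<open>\<phi>' + u \<phi>\<close> is small. The bound is
  uniform for \<open>\<bar>u\<bar> \<le> \<bar>t\<bar>\<close>, also when \<open>t\<close> varies with the sample size.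
\<close>

theorem char_quadratic_form_bound:
  assumes d1: "d \<ge> 1"
  shows "cmod ((CLINT \<omega>|M. iexp (t * ((T \<omega> - d) / sqrt (2 * d)))) - of_real (exp (- (t^2) / 2)))
     \<le> \<bar>t\<bar> * (2 * t^2 / sqrt (2 * d) + (1 + 2 * \<bar>t\<bar>) * (80 * \<kappa>^2 * \<rho> * (\<bar>t\<bar> + t^2)))"
proof -
  define r where "r = sqrt (2 * d)"
  have r: "r \<ge> 1" "r^2 = 2 * d" using d1 by (simp_all add: r_def)
  define Q where "Q \<omega> = (T \<omega> - d) / r" for \<omega>
  have [measurable]: "Q \<in> borel_measurable M" unfolding Q_def[abs_def] by measurable
  have Q2: "integrable M (\<lambda>\<omega>. (Q \<omega>)^2)"
    unfolding Q_def power_divide power2_diff using T_moments(1,2) by simp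
  define \<phi> where "\<phi> u = (CLINT \<omega>|M. iexp (u * Q \<omega>))" for u
  define \<phi>' where "\<phi>' u = (CLINT \<omega>|M. iexp (u * Q \<omega>) * (\<i> * Q \<omega>))" for u
  define E where "E = 2 * t^2 / r + (1 + 2 * \<bar>t\<bar>) * (80 * \<kappa>^2 * \<rho> * (\<bar>t\<bar> + t^2))"
  have "cmod (\<phi> t - of_real (exp (- (t^2) / 2))) \<le> \<bar>t\<bar> * E"
  proof (rule gaussian_ode_bound)
    show "(\<phi> has_vector_derivative \<phi>' u) (at u)" for u
      unfolding \<phi>_def[abs_def] \<phi>'_def by (rule char_has_vector_derivative) (use Q2 in auto)
    show "\<phi> 0 = 1" by (simp add: \<phi>_def prob_space)
    fix u assume ut: "\<bar>u\<bar> \<le> \<bar>t\<bar>"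
    define s where "s = u / r"
    define \<delta> where "\<delta> = 80 * \<kappa>^2 * (\<rho> * d) * (\<bar>s\<bar> + s^2)"
    \<comment> \<open>The phase by which the characteristic functions of T and of T - d differ.\<close>
    define c where "c = iexp (- s * d)"
    define S where "S = (CLINT \<omega>|M. iexp (s * T \<omega>) * (of_real (T \<omega> - d) - 2 * (\<i> * s) * of_real (T \<omega>)))"
    define U where "U = (CLINT \<omega>|M. iexp (u * Q \<omega>) * of_real (T \<omega> - d))"
    have c1: "cmod c = 1" unfolding c_def by (rule norm_exp_i_times)
    have S: "cmod S \<le> \<delta>" unfolding S_def \<delta>_def by (rule stein_sum)
    have phase: "c * iexp (s * T \<omega>) = iexp (u * Q \<omega>)" for \<omega>
      unfolding c_def exp_add[symmetric] Q_def s_def by (simp add: diff_divide_distrib algebra_simps)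
    have iU: "integrable M (\<lambda>\<omega>. iexp (u * Q \<omega>) * of_real (T \<omega> - d))"
      by (rule Bochner_Integration.integrable_bound[of M "\<lambda>\<omega>. T \<omega> - d"]) (use T_moments in \<open>auto simp: norm_mult simp del: of_real_diff\<close>)
    have i\<phi>: "integrable M (\<lambda>\<omega>. iexp (u * Q \<omega>))"
      by (rule integrable_const_bound[where B=1]) auto
    have "c * S = (CLINT \<omega>|M. iexp (u * Q \<omega>) * of_real (T \<omega> - d) - 2 * (\<i> * s) * (iexp (u * Q \<omega>) * of_real (T \<omega> - d) + of_real d * iexp (u * Q \<omega>)))"
      unfolding S_def integral_mult_right_zero[symmetric] phase[symmetric]
      by (intro Bochner_Integration.integral_cong refl) (simp add: algebra_simps)
    also have "\<dots> = U - 2 * (\<i> * s) * (U + of_real d * \<phi> u)"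
      unfolding U_def \<phi>_def using iU i\<phi>
      by (simp del: of_real_diff)
    finally have cS: "c * S = U - 2 * (\<i> * s) * (U + of_real d * \<phi> u)" .
    have \<phi>U: "\<phi>' u = \<i> / r * U"
      unfolding \<phi>'_def U_def integral_mult_right_zero[symmetric] Q_def
      by (intro Bochner_Integration.integral_cong refl) (simp add: field_simps)
    have sr: "s * r = u" "s * d * 2 = u * r" using r by (simp_all add: s_def field_simps power2_eq_square)
    have dec: "\<phi>' u + u * \<phi> u = \<i> / r * (c * S + 2 * (\<i> * s) * U)"
    proof -
      have "\<i> / r * (2 * (\<i> * s) * (of_real d * \<phi> u)) = - of_real (s * d * 2 / r) * \<phi> u"
        by (simp add: field_simps)
      also have "s * d * 2 / r = u" using sr r by simp
      finally have "\<i> / r * (2 * (\<i> * s) * (of_real d * \<phi> u)) = - u * \<phi> u" by simp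
      thus ?thesis unfolding cS \<phi>U by (simp add: algebra_simps)
    qed
    have \<phi>1: "cmod (\<phi> u) \<le> 1" unfolding \<phi>_def
      by (rule order_trans[OF integral_norm_bound]) (simp add: prob_space)
    have Ub: "cmod U \<le> 2 * \<bar>s\<bar> * d + \<delta>"
    proof -
      have "1 \<le> cmod (1 - 2 * (\<i> * s))"
        using abs_Re_le_cmod[of "1 - 2 * (\<i> * s)"] by simp
      hence "cmod U \<le> cmod (1 - 2 * (\<i> * s)) * cmod U" by (simp add: mult_le_cancel_right1)
      also have "\<dots> = cmod ((1 - 2 * (\<i> * s)) * U)" by (simp add: norm_mult)
      also have "(1 - 2 * (\<i> * s)) * U = 2 * (\<i> * s) * (of_real d * \<phi> u) + c * S"
        unfolding cS by (simp add: algebra_simps)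
      also have "cmod \<dots> \<le> 2 * \<bar>s\<bar> * (d * cmod (\<phi> u)) + cmod S"
        using d1 by (intro order_trans[OF norm_triangle_ineq]) (simp add: norm_mult c1)
      also have "\<dots> \<le> 2 * \<bar>s\<bar> * (d * 1) + \<delta>" using S \<phi>1 d1 by (intro add_mono mult_left_mono) auto
      finally show ?thesis by simp
    qed
    have su: "\<bar>s\<bar> \<le> \<bar>u\<bar>" unfolding s_def using r by (simp add: abs_div divide_le_eq mult_le_cancel_left1)
    have \<delta>0: "\<delta> \<ge> 0" unfolding \<delta>_def using \<rho> d1 by simp
    have \<delta>r: "\<delta> / r \<le> 80 * \<kappa>^2 * \<rho> * (\<bar>t\<bar> + t^2)"
    proof -
      have "d * \<bar>s\<bar> / r = \<bar>u\<bar> / 2" using r d1 by (simp add: s_def abs_div field_simps power2_eq_square)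
      moreover have "d * s^2 / r = \<bar>u\<bar> * \<bar>s\<bar> / 2"
        using r d1 by (simp add: s_def abs_div field_simps power2_eq_square abs_mult_self_eq)
      moreover have "\<bar>u\<bar> * \<bar>s\<bar> \<le> u^2" using mult_left_mono[OF su, of "\<bar>u\<bar>"] by (simp add: power2_eq_square)
      moreover have "u^2 \<le> t^2" using ut by (simp add: abs_le_square_iff)
      ultimately have "d * \<bar>s\<bar> / r + d * s^2 / r \<le> \<bar>t\<bar> + t^2" using ut zero_le_power2[of t] by linarith
      hence "80 * \<kappa>^2 * \<rho> * (d * \<bar>s\<bar> / r + d * s^2 / r) \<le> 80 * \<kappa>^2 * \<rho> * (\<bar>t\<bar> + t^2)"
        using \<rho> by (intro mult_left_mono) auto
      moreover have "\<delta> / r = 80 * \<kappa>^2 * \<rho> * (d * \<bar>s\<bar> / r + d * s^2 / r)"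
        unfolding \<delta>_def by (simp add: add_divide_distrib algebra_simps)
      ultimately show ?thesis by simp
    qed
    have "cmod (\<phi>' u + u * \<phi> u) = cmod (c * S + 2 * (\<i> * s) * U) / r"
      unfolding dec using r by (simp add: norm_mult norm_divide)
    also have "\<dots> \<le> (\<delta> + 2 * \<bar>s\<bar> * (2 * \<bar>s\<bar> * d + \<delta>)) / r"
    proof (rule divide_right_mono)
      have "cmod (c * S + 2 * (\<i> * s) * U) \<le> cmod S + 2 * \<bar>s\<bar> * cmod U"
        by (intro order_trans[OF norm_triangle_ineq]) (simp add: norm_mult c1)
      also have "\<dots> \<le> \<delta> + 2 * \<bar>s\<bar> * (2 * \<bar>s\<bar> * d + \<delta>)" using S Ub by (intro add_mono mult_left_mono) auto
      finally show "cmod (c * S + 2 * (\<i> * s) * U) \<le> \<delta> + 2 * \<bar>s\<bar> * (2 * \<bar>s\<bar> * d + \<delta>)" .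
    qed (use r in simp)
    also have "\<dots> = 2 * (u^2 / r) + (1 + 2 * \<bar>s\<bar>) * (\<delta> / r)"
    proof -
      have "4 * (s^2 * d) = 2 * u^2" using sr r d1 by (simp add: s_def power_divide field_simps power2_eq_square)
      hence "\<delta> + 2 * \<bar>s\<bar> * (2 * \<bar>s\<bar> * d + \<delta>) = 2 * u^2 + (1 + 2 * \<bar>s\<bar>) * \<delta>"
        by (simp add: algebra_simps power2_eq_square)
      thus ?thesis by (simp add: add_divide_distrib)
    qed
    also have "\<dots> \<le> 2 * (t^2 / r) + (1 + 2 * \<bar>t\<bar>) * (80 * \<kappa>^2 * \<rho> * (\<bar>t\<bar> + t^2))"
      using ut su r \<delta>r \<delta>0 \<rho>
      by (intro add_mono mult_mono mult_left_mono divide_right_mono) (auto simp: abs_le_square_iff)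
    finally show "cmod (\<phi>' u + u * \<phi> u) \<le> E" by (simp add: E_def)
  qed
  thus ?thesis by (simp add: \<phi>_def Q_def r_def E_def)
qed

end

section \<open>Bounds in probability\<close>

lemma (in prob_space) markov_bound:
  assumes "integrable M u" "\<And>\<omega>. 0 \<le> u \<omega>" "expectation u \<le> e" "0 < c"
  shows "prob {\<omega>\<in>space M. c < u \<omega>} \<le> e / c"
proof -
  have [measurable]: "u \<in> borel_measurable M" using assms(1) by auto
  have "prob {\<omega>\<in>space M. c < u \<omega>} \<le> prob {\<omega>\<in>space M. c \<le> u \<omega>}"
    by (intro finite_measure_mono) auto
  also have "\<dots> \<le> expectation u / c"
    using integral_Markov_inequality_measure[OF assms(1), of "space M" c] assms by simp
  also have "\<dots> \<le> e / c" using assms by (intro divide_right_mono) auto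
  finally show ?thesis .
qed

text \<open>
  A quantitative form of Slutsky's theorem: the exponentials differ by at most \<open>\<bar>t\<bar> \<delta>\<close> where the
  variables are \<open>\<delta>\<close>-close, and by at most \<open>2\<close> elsewhere.
\<close>

lemma (in prob_space) char_close:
  fixes X Y :: "'a \<Rightarrow> real"
  assumes [measurable]: "X \<in> borel_measurable M" "Y \<in> borel_measurable M" and \<delta>: "\<delta> \<ge> 0"
  shows "cmod ((CLINT \<omega>|M. iexp (t * Y \<omega>)) - (CLINT \<omega>|M. iexp (t * X \<omega>)))
     \<le> \<bar>t\<bar> * \<delta> + 2 * prob {\<omega>\<in>space M. \<delta> < \<bar>Y \<omega> - X \<omega>\<bar>}"
proof -
  let ?S = "{\<omega>\<in>space M. \<delta> < \<bar>Y \<omega> - X \<omega>\<bar>}"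
  have S: "?S \<in> sets M" by measurable
  have int: "integrable M (\<lambda>\<omega>. iexp (t * Z \<omega>))" if [measurable]: "Z \<in> borel_measurable M" for Z
    by (rule integrable_const_bound[where B=1]) auto
  have "(CLINT \<omega>|M. iexp (t * Y \<omega>)) - (CLINT \<omega>|M. iexp (t * X \<omega>)) = (CLINT \<omega>|M. iexp (t * Y \<omega>) - iexp (t * X \<omega>))"
    using int by simp
  also have "cmod \<dots> \<le> expectation (\<lambda>\<omega>. \<bar>t\<bar> * \<delta> + 2 * indicator ?S \<omega>)"
  proof (rule order_trans[OF integral_norm_bound integral_mono])
    show "integrable M (\<lambda>\<omega>. cmod (iexp (t * Y \<omega>) - iexp (t * X \<omega>)))"
      using int by (intro integrable_norm Bochner_Integration.integrable_diff) auto
    show "integrable M (\<lambda>\<omega>. \<bar>t\<bar> * \<delta> + 2 * indicator ?S \<omega>)"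
      using S by (intro Bochner_Integration.integrable_add integrable_mult_right integrable_const integrable_real_indicator) (auto simp: emeasure_eq_measure)
    fix \<omega> assume \<omega>: "\<omega> \<in> space M"
    show "cmod (iexp (t * Y \<omega>) - iexp (t * X \<omega>)) \<le> \<bar>t\<bar> * \<delta> + 2 * indicator ?S \<omega>"
    proof (cases "\<omega> \<in> ?S")
      case True
      have "cmod (iexp (t * Y \<omega>) - iexp (t * X \<omega>)) \<le> cmod (iexp (t * Y \<omega>)) + cmod (iexp (t * X \<omega>))"
        by (rule norm_triangle_ineq4)
      also have "\<dots> = 2" by (simp only: norm_exp_i_times)
      finally show ?thesis using True \<delta> by (simp add: add_increasing)
    next
      case False
      hence le: "\<bar>Y \<omega> - X \<omega>\<bar> \<le> \<delta>" using \<omega> by auto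
      have "iexp (t * Y \<omega>) - iexp (t * X \<omega>) = iexp (t * X \<omega>) * (iexp (t * (Y \<omega> - X \<omega>)) - 1)"
        by (simp add: algebra_simps flip: exp_add)
      hence "cmod (iexp (t * Y \<omega>) - iexp (t * X \<omega>)) = cmod (iexp (t * (Y \<omega> - X \<omega>)) - 1)"
        by (simp only: norm_mult norm_exp_i_times mult_1)
      also have "\<dots> \<le> \<bar>t * (Y \<omega> - X \<omega>)\<bar>" by (rule iexp_taylor1)
      also have "\<dots> \<le> \<bar>t\<bar> * \<delta>" unfolding abs_mult by (intro mult_left_mono le) auto
      finally show ?thesis using False by simp
    qed
  qed
  also have "\<dots> = \<bar>t\<bar> * \<delta> + 2 * prob ?S"
  proof -
    have "integrable M (indicator ?S :: 'a \<Rightarrow> real)" using S by (intro integrable_real_indicator) (auto simp: emeasure_eq_measure)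
    thus ?thesis using S by (simp add: prob_space)
  qed
  finally show ?thesis .
qed

context standardized_errors
begin

text \<open>
  The variables \<open>(\<eta> i)\<^sup>2 - 1\<close> are centered and uncorrelated. Entries of the deviation of the
  sample covariance from its mean have the form treated here.
\<close>

lemma centered_squares_second_moment:
  "integrable M (\<lambda>\<omega>. (\<Sum>i\<in>I. b i * ((\<eta> i \<omega>)^2 - 1))^2)"
  "expectation (\<lambda>\<omega>. (\<Sum>i\<in>I. b i * ((\<eta> i \<omega>)^2 - 1))^2) \<le> \<kappa> * (\<Sum>i\<in>I. (b i)^2)"
proof -
  define z where "z i \<omega> = (\<eta> i \<omega>)^2 - 1" for i \<omega>
  have zi: "integrable M (z i)" "expectation (z i) = 0" if "i \<in> I" for i
    unfolding z_def[abs_def] using integrable_power[OF that, of 2] var1[OF that] by (simp_all add: prob_space)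
  have zz: "integrable M (\<lambda>\<omega>. z i \<omega> * z i \<omega>)" "expectation (\<lambda>\<omega>. z i \<omega> * z i \<omega>) \<le> \<kappa>" if i: "i \<in> I" for i
  proof -
    have e: "z i \<omega> * z i \<omega> = \<eta> i \<omega>^4 - 2 * \<eta> i \<omega>^2 + 1" for \<omega>
      by (simp add: z_def power4_eq_xxxx power2_eq_square algebra_simps)
    show "integrable M (\<lambda>\<omega>. z i \<omega> * z i \<omega>)" unfolding e
      using integrable_power[OF i, of 4] integrable_power[OF i, of 2] by simp
    have "expectation (\<lambda>\<omega>. z i \<omega> * z i \<omega>) = expectation (\<lambda>\<omega>. \<eta> i \<omega>^4) - 1" unfolding e
      using integrable_power[OF i, of 4] integrable_power[OF i, of 2] var1[OF i] by (simp add: prob_space)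
    thus "expectation (\<lambda>\<omega>. z i \<omega> * z i \<omega>) \<le> \<kappa>" using abs_expectation_power_le[OF i, of 4] by simp
  qed
  have zij: "integrable M (\<lambda>\<omega>. z i \<omega> * z j \<omega>) \<and> expectation (\<lambda>\<omega>. z i \<omega> * z j \<omega>) = 0"
    if ij: "i \<in> I" "j \<in> I" "i \<noteq> j" for i j
  proof -
    have iv: "indep_var borel (z j) borel (z i)"
      using indep_of_the_others[of i "{j}" "\<lambda>x. (x j)^2 - 1" borel "\<lambda>x. x^2 - 1" borel] ij
      by (simp add: z_def[abs_def])
    show ?thesis using indep_var_integrable[OF iv zi(1) zi(1)] indep_var_lebesgue_integral[OF iv zi(1) zi(1)] ij zi(2)
      by (simp add: mult.commute)
  qed
  have ii: "integrable M (\<lambda>\<omega>. z i \<omega> * z j \<omega>)" if "i \<in> I" "j \<in> I" for i j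
    using zz(1) zij that by (cases "i = j") auto
  have eq: "(\<Sum>i\<in>I. b i * ((\<eta> i \<omega>)^2 - 1))^2 = (\<Sum>i\<in>I. \<Sum>j\<in>I. b i * b j * (z i \<omega> * z j \<omega>))" for \<omega>
    unfolding power2_eq_square[of "sum _ _"] sum_product z_def by (intro sum.cong refl) (simp add: algebra_simps)
  show "integrable M (\<lambda>\<omega>. (\<Sum>i\<in>I. b i * ((\<eta> i \<omega>)^2 - 1))^2)"
    unfolding eq by (intro Bochner_Integration.integrable_sum integrable_mult_right ii)
  have "expectation (\<lambda>\<omega>. (\<Sum>i\<in>I. b i * ((\<eta> i \<omega>)^2 - 1))^2) = (\<Sum>i\<in>I. \<Sum>j\<in>I. b i * b j * expectation (\<lambda>\<omega>. z i \<omega> * z j \<omega>))"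
  proof -
    have "expectation (\<lambda>\<omega>. \<Sum>i\<in>I. \<Sum>j\<in>I. b i * b j * (z i \<omega> * z j \<omega>)) = (\<Sum>i\<in>I. expectation (\<lambda>\<omega>. \<Sum>j\<in>I. b i * b j * (z i \<omega> * z j \<omega>)))"
      by (intro Bochner_Integration.integral_sum Bochner_Integration.integrable_sum integrable_mult_right ii)
    also have "\<dots> = (\<Sum>i\<in>I. \<Sum>j\<in>I. expectation (\<lambda>\<omega>. b i * b j * (z i \<omega> * z j \<omega>)))"
      by (intro sum.cong refl Bochner_Integration.integral_sum integrable_mult_right ii)
    finally show ?thesis unfolding eq by (simp only: integral_mult_right_zero)
  qed
  also have "\<dots> = (\<Sum>i\<in>I. b i * b i * expectation (\<lambda>\<omega>. z i \<omega> * z i \<omega>))"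
  proof (rule sum.cong[OF refl])
    fix i assume i: "i \<in> I"
    have "(\<Sum>j\<in>I. b i * b j * expectation (\<lambda>\<omega>. z i \<omega> * z j \<omega>)) = (\<Sum>j\<in>I. if j = i then b i * b i * expectation (\<lambda>\<omega>. z i \<omega> * z i \<omega>) else 0)"
      using zij i by (intro sum.cong refl) auto
    thus "(\<Sum>j\<in>I. b i * b j * expectation (\<lambda>\<omega>. z i \<omega> * z j \<omega>)) = b i * b i * expectation (\<lambda>\<omega>. z i \<omega> * z i \<omega>)"
      using fin i by simp
  qed
  also have "\<dots> \<le> (\<Sum>i\<in>I. b i * b i * \<kappa>)" using zz(2) by (intro sum_mono mult_left_mono) auto
  also have "\<dots> = \<kappa> * (\<Sum>i\<in>I. (b i)^2)" by (simp add: sum_distrib_left power2_eq_square mult_ac)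
  finally show "expectation (\<lambda>\<omega>. (\<Sum>i\<in>I. b i * ((\<eta> i \<omega>)^2 - 1))^2) \<le> \<kappa> * (\<Sum>i\<in>I. (b i)^2)" .
qed

end

context leverage_form
begin

lemma cubic_sum_moment:
  "integrable M (\<lambda>\<omega>. \<Sum>i\<in>I. \<bar>\<eta> i \<omega> * L i \<omega>\<bar>^3)"
  "expectation (\<lambda>\<omega>. \<Sum>i\<in>I. \<bar>\<eta> i \<omega> * L i \<omega>\<bar>^3) \<le> 12 * \<kappa>^2 * (\<rho> * d)"
proof -
  have le: "\<bar>\<eta> i \<omega> * L i \<omega>\<bar>^3 \<le> \<bar>\<eta> i \<omega>\<bar>^3 * G i \<omega>^3" if i: "i \<in> I" for i \<omega>
    unfolding abs_mult power_mult_distrib using abs_L_le[OF i] by (intro mult_left_mono power_mono) auto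
  have int: "integrable M (\<lambda>\<omega>. \<bar>\<eta> i \<omega> * L i \<omega>\<bar>^3)" if i: "i \<in> I" for i
    by (rule Bochner_Integration.integrable_bound[OF G3_moment(1)[OF i, of 3]])
       (use i le[OF i] in \<open>auto intro!: AE_I2 order_trans[OF le[OF i] abs_ge_self]\<close>)
  thus "integrable M (\<lambda>\<omega>. \<Sum>i\<in>I. \<bar>\<eta> i \<omega> * L i \<omega>\<bar>^3)" by (intro Bochner_Integration.integrable_sum)
  have "expectation (\<lambda>\<omega>. \<Sum>i\<in>I. \<bar>\<eta> i \<omega> * L i \<omega>\<bar>^3) = (\<Sum>i\<in>I. expectation (\<lambda>\<omega>. \<bar>\<eta> i \<omega> * L i \<omega>\<bar>^3))"
    using int by (intro Bochner_Integration.integral_sum)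
  also have "\<dots> \<le> (\<Sum>i\<in>I. 12 * \<kappa>^2 * (\<rho> * P i i))"
  proof (rule sum_mono)
    fix i assume i: "i \<in> I"
    have "expectation (\<lambda>\<omega>. \<bar>\<eta> i \<omega> * L i \<omega>\<bar>^3) \<le> expectation (\<lambda>\<omega>. \<bar>\<eta> i \<omega>\<bar>^3 * G i \<omega>^3)"
      by (intro integral_mono int[OF i] G3_moment(1)[OF i] le[OF i]) auto
    thus "expectation (\<lambda>\<omega>. \<bar>\<eta> i \<omega> * L i \<omega>\<bar>^3) \<le> 12 * \<kappa>^2 * (\<rho> * P i i)"
      using G3_moment(2)[OF i, of 3] by simp
  qed
  also have "\<dots> = 12 * \<kappa>^2 * (\<rho> * d)" by (simp add: d_def sum_distrib_left)
  finally show "expectation (\<lambda>\<omega>. \<Sum>i\<in>I. \<bar>\<eta> i \<omega> * L i \<omega>\<bar>^3) \<le> 12 * \<kappa>^2 * (\<rho> * d)" .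
qed

lemma quartic_sum_moment:
  "integrable M (\<lambda>\<omega>. \<Sum>i\<in>I. (\<eta> i \<omega> * L i \<omega>)^4)"
  "expectation (\<lambda>\<omega>. \<Sum>i\<in>I. (\<eta> i \<omega> * L i \<omega>)^4) \<le> 32 * \<kappa>^2 * (\<rho>^2 * d)"
proof -
  have le: "(\<eta> i \<omega> * L i \<omega>)^4 \<le> \<bar>\<eta> i \<omega>\<bar>^4 * G i \<omega>^4" if i: "i \<in> I" for i \<omega>
  proof -
    have "(\<eta> i \<omega> * L i \<omega>)^4 = \<bar>\<eta> i \<omega>\<bar>^4 * \<bar>L i \<omega>\<bar>^4" by (simp add: power_mult_distrib)
    also have "\<dots> \<le> \<bar>\<eta> i \<omega>\<bar>^4 * G i \<omega>^4" using abs_L_le[OF i] by (intro mult_left_mono power_mono) auto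
    finally show ?thesis .
  qed
  have int: "integrable M (\<lambda>\<omega>. (\<eta> i \<omega> * L i \<omega>)^4)" if i: "i \<in> I" for i
    by (rule Bochner_Integration.integrable_bound[OF G4_moment(1)[OF i, of 4]])
       (use i le[OF i] in \<open>auto intro!: AE_I2 order_trans[OF le[OF i] abs_ge_self]\<close>)
  thus "integrable M (\<lambda>\<omega>. \<Sum>i\<in>I. (\<eta> i \<omega> * L i \<omega>)^4)" by (intro Bochner_Integration.integrable_sum)
  have "expectation (\<lambda>\<omega>. \<Sum>i\<in>I. (\<eta> i \<omega> * L i \<omega>)^4) = (\<Sum>i\<in>I. expectation (\<lambda>\<omega>. (\<eta> i \<omega> * L i \<omega>)^4))"
    using int by (intro Bochner_Integration.integral_sum)
  also have "\<dots> \<le> (\<Sum>i\<in>I. 32 * \<kappa>^2 * (\<rho>^2 * P i i))"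
  proof (rule sum_mono)
    fix i assume i: "i \<in> I"
    have "expectation (\<lambda>\<omega>. (\<eta> i \<omega> * L i \<omega>)^4) \<le> expectation (\<lambda>\<omega>. \<bar>\<eta> i \<omega>\<bar>^4 * G i \<omega>^4)"
      by (intro integral_mono int[OF i] G4_moment(1)[OF i] le[OF i]) auto
    thus "expectation (\<lambda>\<omega>. (\<eta> i \<omega> * L i \<omega>)^4) \<le> 32 * \<kappa>^2 * (\<rho>^2 * P i i)"
      using G4_moment(2)[OF i, of 4] by simp
  qed
  also have "\<dots> = 32 * \<kappa>^2 * (\<rho>^2 * d)" by (simp add: d_def sum_distrib_left)
  finally show "expectation (\<lambda>\<omega>. \<Sum>i\<in>I. (\<eta> i \<omega> * L i \<omega>)^4) \<le> 32 * \<kappa>^2 * (\<rho>^2 * d)" .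
qed

text \<open>
  Collects everything that is needed from the sample at once: each sum exceeds \<open>H\<close> times (a
  bound for) its mean with probability \<open>O(1/H)\<close> by Markov's inequality, with constants \<open>1\<close>, \<open>\<kappa>\<close>,
  \<open>12 \<kappa>\<^sup>2\<close>, \<open>32 \<kappa>\<^sup>2\<close>, \<open>1\<close>. The maximum of the errors is bounded through their eighth moments.
\<close>

lemma bad_event_bound:
  fixes b :: "nat \<Rightarrow> nat \<Rightarrow> nat \<Rightarrow> real" and w :: "nat \<Rightarrow> real"
  assumes d: "d > 0" and H: "H > 0" and t: "t > 0"
    and F: "F > 0" "(\<Sum>r<p. \<Sum>s<p. \<Sum>i\<in>I. (b r s i)^2) \<le> F"
    and w: "\<And>i. i \<in> I \<Longrightarrow> 0 \<le> w i" "w0 > 0" "(\<Sum>i\<in>I. w i) \<le> w0"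
  shows "prob {\<omega>\<in>space M. \<not> (T \<omega> \<le> H * d \<and> (\<Sum>r<p. \<Sum>s<p. (\<Sum>i\<in>I. b r s i * ((\<eta> i \<omega>)^2 - 1))^2) \<le> H * F
     \<and> (\<Sum>i\<in>I. \<bar>\<eta> i \<omega> * L i \<omega>\<bar>^3) \<le> H * (\<rho> * d) \<and> (\<Sum>i\<in>I. (\<eta> i \<omega> * L i \<omega>)^4) \<le> H * (\<rho>^2 * d)
     \<and> (\<Sum>i\<in>I. w i * (\<eta> i \<omega>)^2) \<le> H * w0 \<and> (\<forall>i\<in>I. (\<eta> i \<omega>)^2 \<le> t))}
     \<le> (2 + \<kappa> + 44 * \<kappa>^2) / H + card I * \<kappa> / t^4"
proof -
  define FF where "FF \<omega> = (\<Sum>r<p. \<Sum>s<p. (\<Sum>i\<in>I. b r s i * ((\<eta> i \<omega>)^2 - 1))^2)" for \<omega>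
  define Y3 where "Y3 \<omega> = (\<Sum>i\<in>I. \<bar>\<eta> i \<omega> * L i \<omega>\<bar>^3)" for \<omega>
  define Y4 where "Y4 \<omega> = (\<Sum>i\<in>I. (\<eta> i \<omega> * L i \<omega>)^4)" for \<omega>
  define Y2 where "Y2 \<omega> = (\<Sum>i\<in>I. w i * (\<eta> i \<omega>)^2)" for \<omega>
  have FFi: "integrable M FF" unfolding FF_def[abs_def]
    by (intro Bochner_Integration.integrable_sum centered_squares_second_moment)
  have FFe: "expectation FF \<le> \<kappa> * F"
  proof -
    have "expectation FF = (\<Sum>r<p. \<Sum>s<p. expectation (\<lambda>\<omega>. (\<Sum>i\<in>I. b r s i * ((\<eta> i \<omega>)^2 - 1))^2))"
      unfolding FF_def by (subst Bochner_Integration.integral_sum | simp add: centered_squares_second_moment)+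
    also have "\<dots> \<le> (\<Sum>r<p. \<Sum>s<p. \<kappa> * (\<Sum>i\<in>I. (b r s i)^2))"
      by (intro sum_mono centered_squares_second_moment)
    also have "\<dots> = \<kappa> * (\<Sum>r<p. \<Sum>s<p. \<Sum>i\<in>I. (b r s i)^2)" by (simp add: sum_distrib_left)
    also have "\<dots> \<le> \<kappa> * F" using F \<kappa>1 by (intro mult_left_mono) auto
    finally show ?thesis .
  qed
  have Y2i: "integrable M Y2" unfolding Y2_def[abs_def]
    by (intro Bochner_Integration.integrable_sum integrable_mult_right integrable_power) auto
  have Y2e: "expectation Y2 \<le> w0" unfolding Y2_def
    using w by (subst Bochner_Integration.integral_sum) (simp_all add: integrable_power var1)
  note [measurable] = borel_measurable_integrable[OF FFi] borel_measurable_integrable[OF Y2i]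
  have [measurable]: "Y3 \<in> borel_measurable M" "Y4 \<in> borel_measurable M"
    unfolding Y3_def[abs_def] Y4_def[abs_def]
    using cubic_sum_moment(1) quartic_sum_moment(1) by (auto dest: borel_measurable_integrable)
  define S where "S j = (if j = 0 then {\<omega>\<in>space M. H * d < T \<omega>} else if j = 1 then {\<omega>\<in>space M. H * F < FF \<omega>}
     else if j = 2 then {\<omega>\<in>space M. H * (\<rho> * d) < Y3 \<omega>} else if j = 3 then {\<omega>\<in>space M. H * (\<rho>^2 * d) < Y4 \<omega>}
     else {\<omega>\<in>space M. H * w0 < Y2 \<omega>})" for j :: nat
  define R where "R = (\<Union>i\<in>I. {\<omega>\<in>space M. t < (\<eta> i \<omega>)^2})"
  have Sm: "S j \<in> sets M" for j unfolding S_def by simp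
  have Rm: "{\<omega>\<in>space M. t < (\<eta> i \<omega>)^2} \<in> sets M" if "i \<in> I" for i using that by measurable
  have "prob {\<omega>\<in>space M. \<not> (T \<omega> \<le> H * d \<and> FF \<omega> \<le> H * F \<and> Y3 \<omega> \<le> H * (\<rho> * d) \<and> Y4 \<omega> \<le> H * (\<rho>^2 * d)
     \<and> Y2 \<omega> \<le> H * w0 \<and> (\<forall>i\<in>I. (\<eta> i \<omega>)^2 \<le> t))} \<le> prob ((\<Union>j\<in>{0,1,2,3,4}. S j) \<union> R)"
    using Sm Rm fin by (intro finite_measure_mono sets.Un sets.finite_UN) (auto simp: S_def R_def not_le)
  also have "\<dots> \<le> prob (\<Union>j\<in>{0,1,2,3,4}. S j) + prob R"
    using Sm Rm fin unfolding R_def by (intro measure_Un_le sets.finite_UN) auto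
  also have "prob (\<Union>j\<in>{0,1,2,3,4}. S j) \<le> (\<Sum>j\<in>{0,1,2,3,4}. prob (S j))"
    using Sm by (intro measure_UNION_le) auto
  also have "prob R \<le> (\<Sum>i\<in>I. prob {\<omega>\<in>space M. t < (\<eta> i \<omega>)^2})"
    unfolding R_def using Rm fin by (intro measure_UNION_le) auto
  also have "\<dots> \<le> (\<Sum>i\<in>I. \<kappa> / t^4)"
  proof (rule sum_mono)
    fix i assume i: "i \<in> I"
    have "prob {\<omega>\<in>space M. t < (\<eta> i \<omega>)^2} \<le> prob {\<omega>\<in>space M. t^4 < \<bar>\<eta> i \<omega>\<bar>^8}"
    proof (intro finite_measure_mono subsetI)
      fix \<omega> assume "\<omega> \<in> {\<omega>\<in>space M. t < (\<eta> i \<omega>)^2}"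
      hence "\<omega> \<in> space M" "t^4 < ((\<eta> i \<omega>)^2)^4"
        using t power_strict_mono[of t "(\<eta> i \<omega>)^2" 4] by simp_all
      thus "\<omega> \<in> {\<omega>\<in>space M. t^4 < \<bar>\<eta> i \<omega>\<bar>^8}" by (simp add: power_mult[symmetric] power_even_abs)
    qed (use i in measurable)
    also have "\<dots> \<le> \<kappa> / t^4"
      using int8[OF i] expectation_abs_power_le[OF i, of 8] t by (intro markov_bound) auto
    finally show "prob {\<omega>\<in>space M. t < (\<eta> i \<omega>)^2} \<le> \<kappa> / t^4" .
  qed
  also have "(\<Sum>j\<in>{0,1,2,3,4}. prob (S j)) \<le> 1 / H + \<kappa> / H + 12 * \<kappa>^2 / H + 32 * \<kappa>^2 / H + 1 / H"
  proof -
    have "prob (S 0) \<le> 1 / H"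
      using markov_bound[OF T_moments(2) T_nonneg, of d "H * d"] T_moments(3) H d by (simp add: S_def)
    moreover have "prob (S 1) \<le> \<kappa> / H"
      using markov_bound[OF FFi _ FFe, of "H * F"] H F(1) by (simp add: S_def FF_def sum_nonneg)
    moreover have "prob (S 2) \<le> 12 * \<kappa>^2 / H"
      using markov_bound[OF cubic_sum_moment(1)[folded Y3_def] _ cubic_sum_moment(2)[folded Y3_def], of "H * (\<rho> * d)"] H d \<rho>
      by (simp add: S_def Y3_def sum_nonneg)
    moreover have "prob (S 3) \<le> 32 * \<kappa>^2 / H"
      using markov_bound[OF quartic_sum_moment(1)[folded Y4_def] _ quartic_sum_moment(2)[folded Y4_def], of "H * (\<rho>^2 * d)"] H d \<rho>
      by (simp add: S_def Y4_def sum_nonneg)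
    moreover have "prob (S 4) \<le> 1 / H"
      using markov_bound[OF Y2i _ Y2e, of "H * w0"] H w by (simp add: S_def Y2_def sum_nonneg)
    ultimately show ?thesis by simp
  qed
  finally show ?thesis unfolding FF_def Y3_def Y4_def Y2_def
    by (simp add: add_divide_distrib)
qed

end

section \<open>The log-likelihood ratio as a concave function of the multiplier\<close>

lemma ln_one_plus_le_quadratic:
  fixes u :: real
  assumes "\<bar>u\<bar> \<le> 1/2"
  shows "ln (1 + u) \<le> u - u^2 / 4"
proof -
  define f where "f u = u - u^2 / 4 - ln (1 + u)" for u :: real
  have der: "(f has_real_derivative (u * (1 - u) / (2 * (1 + u)))) (at u)" if "\<bar>u\<bar> \<le> 1/2" for u
  proof -
    have "(f has_real_derivative (1 - 2 * u / 4 - 1 / (1 + u))) (at u)"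
      unfolding f_def[abs_def] using that by (auto intro!: derivative_eq_intros)
    moreover have "1 - 2 * u / 4 - 1 / (1 + u) = u * (1 - u) / (2 * (1 + u))"
      using that by (simp add: field_simps)
    ultimately show ?thesis by simp
  qed
  have "0 \<le> f u"
  proof (cases "0 \<le> u")
    case True
    have "f 0 \<le> f u"
    proof (rule DERIV_nonneg_imp_nondecreasing[OF True])
      fix x assume "0 \<le> x" "x \<le> u"
      thus "\<exists>y. (f has_real_derivative y) (at x) \<and> 0 \<le> y"
        using assms by (intro exI[of _ "x * (1 - x) / (2 * (1 + x))"] conjI der) auto
    qed
    thus ?thesis by (simp add: f_def)
  next
    case False
    have "f u \<ge> f 0"
    proof (rule DERIV_nonpos_imp_nonincreasing[of u 0])
      fix x assume "u \<le> x" "x \<le> 0"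
      thus "\<exists>y. (f has_real_derivative y) (at x) \<and> y \<le> 0"
        using assms by (intro exI[of _ "x * (1 - x) / (2 * (1 + x))"] conjI der)
          (auto simp: divide_nonpos_pos mult_nonpos_nonneg)
    qed (use False in simp)
    thus ?thesis by (simp add: f_def)
  qed
  thus ?thesis by (simp add: f_def)
qed

text \<open>
  Apply \<open>ln (1 + u) \<le> u - u\<^sup>2/4\<close> to \<open>u = (y - x) / (1 + x)\<close>; as \<open>1 + x \<le> 3/2\<close>, the square
  \<open>u\<^sup>2/4\<close> is at least \<open>(y - x)\<^sup>2/9\<close>.
\<close>

lemma ln_one_plus_strongly_concave:
  fixes x y :: real
  assumes x: "\<bar>x\<bar> \<le> 1/2" and y: "\<bar>y - x\<bar> \<le> 1/4"
  shows "ln (1 + y) \<le> ln (1 + x) + (y - x) / (1 + x) - (y - x)^2 / 9"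
proof -
  define u where "u = (y - x) / (1 + x)"
  have p: "1 + x \<ge> 1/2" using x by auto
  have "\<bar>u\<bar> \<le> (1/4) / (1/2)" unfolding u_def abs_divide
    using p y by (intro frac_le) auto
  hence u: "\<bar>u\<bar> \<le> 1/2" by simp
  have "1 + y = (1 + x) * (1 + u)" unfolding u_def using p by (simp add: field_simps)
  hence "ln (1 + y) = ln (1 + x) + ln (1 + u)" using p u by (simp add: ln_mult)
  also have "ln (1 + u) \<le> u - u^2 / 4" by (rule ln_one_plus_le_quadratic[OF u])
  also have "(y - x)^2 / (9/4) \<le> u^2"
  proof -
    have "(1 + x)^2 \<le> (3/2)^2" using x p by (intro power_mono) auto
    thus ?thesis unfolding u_def power_divide using p
      by (intro divide_left_mono) (auto simp: power2_eq_square)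
  qed
  hence "u - u^2 / 4 \<le> (y - x) / (1 + x) - (y - x)^2 / 9" by (simp add: u_def)
  finally show ?thesis by simp
qed

lemma ln_one_plus_cubic_error:
  fixes x :: real
  assumes "\<bar>x\<bar> \<le> 1/2"
  shows "\<bar>ln (1 + x) - x + x^2 / 2\<bar> \<le> \<bar>x\<bar>^3"
proof -
  define f where "f x = ln (1 + x) - x + x^2 / 2" for x :: real
  have der: "(f has_real_derivative (x^2 / (1 + x))) (at x)" if "\<bar>x\<bar> \<le> 1/2" for x
  proof -
    have "(f has_real_derivative (1 / (1 + x) - 1 + 2 * x / 2)) (at x)"
      unfolding f_def[abs_def] using that by (auto intro!: derivative_eq_intros)
    moreover have "1 / (1 + x) - 1 + 2 * x / 2 = x^2 / (1 + x)"
      using that by (simp add: field_simps power2_eq_square)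
    ultimately show ?thesis by simp
  qed
  have der3: "((\<lambda>x. f x - x^3) has_real_derivative (x^2 / (1 + x) - 3 * x^2)) (at x)" if "\<bar>x\<bar> \<le> 1/2" for x
    using der[OF that] by (auto intro!: derivative_eq_intros)
  have sgn: "x^2 / (1 + x) - 3 * x^2 \<le> 0" "0 \<le> x^2 / (1 + x)" if "\<bar>x\<bar> \<le> 1/2" for x :: real
  proof -
    have "1 / (1 + x) \<le> 2" using that by (auto simp: field_simps)
    hence "x^2 * (1 / (1 + x)) \<le> x^2 * 3" by (intro mult_left_mono) auto
    thus "x^2 / (1 + x) - 3 * x^2 \<le> 0" by simp
    show "0 \<le> x^2 / (1 + x)" using that by auto
  qed
  have mono: "f a \<le> f b" "f b - b^3 \<le> f a - a^3" if "a \<le> b" "- 1/2 \<le> a" "b \<le> 1/2" for a b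
  proof -
    show "f a \<le> f b"
      by (rule DERIV_nonneg_imp_nondecreasing[OF that(1)]) (use der sgn that in force)
    show "f b - b^3 \<le> f a - a^3"
      by (rule DERIV_nonpos_imp_nonincreasing[OF that(1), of "\<lambda>x. f x - x^3"]) (use der3 sgn that in force)
  qed
  have f0: "f 0 = 0" by (simp add: f_def)
  have "\<bar>f x\<bar> \<le> \<bar>x\<bar>^3"
  proof (cases "0 \<le> x")
    case True
    thus ?thesis using mono[of 0 x] f0 assms by auto
  next
    case False
    hence "\<bar>x\<bar>^3 = - (x^3)" by (simp add: power3_eq_cube)
    thus ?thesis using mono[of x 0] f0 assms False by auto
  qed
  thus ?thesis by (simp add: f_def)
qed

text \<open>
  Multipliers and observations are functions on \<open>nat\<close> of which only the first \<open>p\<close> values count.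
  This gives the multipliers a topology in which \<open>box_fun\<close> is compact; \<open>I\<close> indexes the
  observations \<open>m i\<close>, which carry the sign of their group.
\<close>

definition ip :: "nat \<Rightarrow> (nat \<Rightarrow> real) \<Rightarrow> (nat \<Rightarrow> real) \<Rightarrow> real" where
  "ip p u v = (\<Sum>s<p. u s * v s)"

definition el_feasible :: "nat \<Rightarrow> nat set \<Rightarrow> (nat \<Rightarrow> nat \<Rightarrow> real) \<Rightarrow> (nat \<Rightarrow> real) \<Rightarrow> bool" where
  "el_feasible p I m l \<longleftrightarrow> (\<forall>i\<in>I. 0 < 1 + ip p l (m i))"

definition el_log :: "nat \<Rightarrow> nat set \<Rightarrow> (nat \<Rightarrow> nat \<Rightarrow> real) \<Rightarrow> (nat \<Rightarrow> real) \<Rightarrow> real" where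
  "el_log p I m l = (\<Sum>i\<in>I. ln (1 + ip p l (m i)))"

definition el_grad :: "nat \<Rightarrow> nat set \<Rightarrow> (nat \<Rightarrow> nat \<Rightarrow> real) \<Rightarrow> (nat \<Rightarrow> real) \<Rightarrow> nat \<Rightarrow> real" where
  "el_grad p I m l s = (\<Sum>i\<in>I. m i s / (1 + ip p l (m i)))"

lemma ip_add: "ip p (\<lambda>s. u s + v s) w = ip p u w + ip p v w"
  by (simp add: ip_def sum.distrib algebra_simps)

lemma ip_diff: "ip p (\<lambda>s. u s - v s) w = ip p u w - ip p v w"
  by (simp add: ip_def sum_subtractf algebra_simps)

lemma ip_nonneg: "0 \<le> ip p u u" by (simp add: ip_def sum_nonneg)

lemma ip_Cauchy_Schwarz: "(ip p u v)^2 \<le> ip p u u * ip p v v"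
  using Cauchy_Schwarz_ineq_sum[of u v "{..<p}"] by (simp add: ip_def power2_eq_square)

lemma ip_grad: "ip p u (el_grad p I m l) = (\<Sum>i\<in>I. ip p u (m i) / (1 + ip p l (m i)))"
  unfolding ip_def[of p u] el_grad_def sum_distrib_left
  by (subst sum.swap) (simp add: ip_def sum_divide_distrib)

text \<open>
  Concavity in the form \<open>ln t \<le> t - 1\<close>, applied to \<open>t = (1 + \<mu>\<^sup>t m i) / (1 + l\<^sup>t m i)\<close>. In
  particular all multipliers give the statistic the same value.
\<close>

lemma stationary_point_is_maximum:
  assumes l: "el_feasible p I m l" "\<And>s. s < p \<Longrightarrow> el_grad p I m l s = 0" and \<mu>: "el_feasible p I m \<mu>"
  shows "el_log p I m \<mu> \<le> el_log p I m l"
proof -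
  have "el_log p I m \<mu> - el_log p I m l \<le> (\<Sum>i\<in>I. ip p (\<lambda>s. \<mu> s - l s) (m i) / (1 + ip p l (m i)))"
    unfolding el_log_def sum_subtractf[symmetric]
  proof (rule sum_mono)
    fix i assume "i \<in> I"
    hence pos: "0 < 1 + ip p l (m i)" "0 < 1 + ip p \<mu> (m i)" using l \<mu> by (auto simp: el_feasible_def)
    have "ln (1 + ip p \<mu> (m i)) - ln (1 + ip p l (m i)) = ln ((1 + ip p \<mu> (m i)) / (1 + ip p l (m i)))"
      using pos by (simp add: ln_div)
    also have "\<dots> \<le> (1 + ip p \<mu> (m i)) / (1 + ip p l (m i)) - 1"
      using pos by (intro ln_le_minus_one) simp
    also have "\<dots> = ip p (\<lambda>s. \<mu> s - l s) (m i) / (1 + ip p l (m i))"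
      using pos by (simp add: ip_diff field_simps)
    finally show "ln (1 + ip p \<mu> (m i)) - ln (1 + ip p l (m i)) \<le> ip p (\<lambda>s. \<mu> s - l s) (m i) / (1 + ip p l (m i))" .
  qed
  also have "\<dots> = ip p (\<lambda>s. \<mu> s - l s) (el_grad p I m l)" by (simp add: ip_grad)
  also have "\<dots> = 0" using l(2) by (simp add: ip_def)
  finally show ?thesis by simp
qed

lemma local_maximum_is_stationary:
  assumes fin: "finite I" and l: "el_feasible p I m l" and s: "s < p" and r: "r > 0"
    and max: "\<And>t. \<bar>t\<bar> < r \<Longrightarrow> el_log p I m (l(s := l s + t)) \<le> el_log p I m l"
  shows "el_grad p I m l s = 0"
proof -
  have ipu: "ip p (l(s := l s + t)) v = ip p l v + t * v s" for t v
  proof -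
    have "ip p (l(s := l s + t)) v = (\<Sum>r<p. l r * v r + (if r = s then t * v r else 0))"
      unfolding ip_def by (intro sum.cong) (auto simp: algebra_simps)
    also have "\<dots> = ip p l v + t * v s" using s by (simp add: sum.distrib ip_def)
    finally show ?thesis .
  qed
  let ?f = "\<lambda>t. \<Sum>i\<in>I. ln (1 + (ip p l (m i) + t * m i s))"
  have "(?f has_real_derivative el_grad p I m l s) (at 0)"
    unfolding el_grad_def
  proof (rule DERIV_sum)
    fix i assume "i \<in> I"
    hence pos: "0 < 1 + ip p l (m i)" using l by (auto simp: el_feasible_def)
    thus "((\<lambda>t. ln (1 + (ip p l (m i) + t * m i s))) has_real_derivative m i s / (1 + ip p l (m i))) (at 0)"
      by (auto intro!: derivative_eq_intros)
  qed
  moreover have "\<forall>t. \<bar>0 - t\<bar> < r \<longrightarrow> ?f t \<le> ?f 0"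
    using max unfolding el_log_def ipu by simp
  ultimately show ?thesis using DERIV_local_max[of ?f _ 0 r] r by blast
qed

text \<open>
  The operator norm is at most the Frobenius norm, whose square has a computable expectation.
\<close>

lemma Frobenius_bilinear:
  assumes F: "(\<Sum>r<p. \<Sum>s<p. (E r s)^2) \<le> D^2" and D: "D \<ge> 0"
  shows "ip p (\<lambda>r. \<Sum>s<p. E r s * v s) (\<lambda>r. \<Sum>s<p. E r s * v s) \<le> D^2 * ip p v v"
    and "\<bar>\<Sum>r<p. \<Sum>s<p. v r * E r s * v s\<bar> \<le> D * ip p v v"
proof -
  have "ip p (\<lambda>r. \<Sum>s<p. E r s * v s) (\<lambda>r. \<Sum>s<p. E r s * v s) = (\<Sum>r<p. (\<Sum>s<p. E r s * v s)^2)"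
    by (simp add: ip_def power2_eq_square)
  also have "\<dots> \<le> (\<Sum>r<p. (\<Sum>s<p. (E r s)^2) * (\<Sum>s<p. (v s)^2))"
    by (intro sum_mono Cauchy_Schwarz_ineq_sum)
  also have "\<dots> = (\<Sum>r<p. \<Sum>s<p. (E r s)^2) * ip p v v"
    by (simp add: sum_distrib_right[symmetric] ip_def power2_eq_square)
  also have "\<dots> \<le> D^2 * ip p v v" using F ip_nonneg by (intro mult_right_mono)
  finally show 1: "ip p (\<lambda>r. \<Sum>s<p. E r s * v s) (\<lambda>r. \<Sum>s<p. E r s * v s) \<le> D^2 * ip p v v" .
  have "(\<Sum>r<p. \<Sum>s<p. v r * E r s * v s) = ip p v (\<lambda>r. \<Sum>s<p. E r s * v s)"
    by (simp add: ip_def sum_distrib_left mult.assoc)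
  hence "(\<Sum>r<p. \<Sum>s<p. v r * E r s * v s)^2 \<le> ip p v v * (D^2 * ip p v v)"
    using order_trans[OF ip_Cauchy_Schwarz mult_left_mono[OF 1 ip_nonneg]] by metis
  also have "\<dots> = (D * ip p v v)^2" by (simp add: power2_eq_square)
  finally show "\<bar>\<Sum>r<p. \<Sum>s<p. v r * E r s * v s\<bar> \<le> D * ip p v v"
    using D ip_nonneg[of p v] abs_le_square_iff[of _ "D * ip p v v"] by (simp add: abs_mult)
qed

text \<open>
  On the ball of radius \<open>r = 1/(4R)\<close> about \<open>l0\<close> all arguments of the logarithm stay in the range
  of \<open>ln_one_plus_strongly_concave\<close>, so the function lies below a paraboloid with gradient \<open>g\<close>
  and quadratic coefficient \<open>-a\<close>, where \<open>a = nc/9\<close>. A maximizer over the ball exists by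
  compactness. On the boundary the paraboloid is below the value at the center as soon as
  \<open>\<bar>g\<bar> < a r = nc/(36R)\<close>; hence the maximizer is an interior point and therefore stationary. The
  maximum of the paraboloid exceeds the value at the center by at most \<open>\<bar>g\<bar>\<^sup>2/(4a)\<close>.
\<close>

lemma multiplier_near_point:
  assumes fin: "finite I" and n: "n > 0" and c: "c > 0" and R: "R > 0"
    and x: "\<And>i. i \<in> I \<Longrightarrow> \<bar>ip p l0 (m i)\<bar> \<le> 1/2"
    and mR: "\<And>i. i \<in> I \<Longrightarrow> ip p (m i) (m i) \<le> R^2"
    and low: "\<And>v. n * c * ip p v v \<le> (\<Sum>i\<in>I. (ip p v (m i))^2)"
    and g: "ip p (el_grad p I m l0) (el_grad p I m l0) \<le> \<Gamma>"
    and small: "\<Gamma> < (n * c / (36 * R))^2"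
  shows "\<exists>l. el_feasible p I m l \<and> (\<forall>s<p. el_grad p I m l s = 0) \<and>
     el_log p I m l0 \<le> el_log p I m l \<and> el_log p I m l \<le> el_log p I m l0 + 9 * \<Gamma> / (4 * n * c)"
proof -
  define r where "r = 1 / (4 * R)"
  define a where "a = n * c / 9"
  have r0: "r > 0" and a0: "a > 0" using R n c by (simp_all add: r_def a_def)
  have \<Gamma>0: "\<Gamma> \<ge> 0" using g ip_nonneg order_trans by blast
  define F where "F \<delta> = el_log p I m (\<lambda>s. l0 s + \<delta> s)" for \<delta>
  let ?g = "el_grad p I m l0"
  have ipb: "\<bar>ip p \<delta> (m i)\<bar> \<le> 1/4" if i: "i \<in> I" and \<delta>: "ip p \<delta> \<delta> \<le> r^2" for \<delta> i
  proof -
    have "(ip p \<delta> (m i))^2 \<le> ip p \<delta> \<delta> * ip p (m i) (m i)" by (rule ip_Cauchy_Schwarz)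
    also have "\<dots> \<le> r^2 * R^2" using \<delta> mR[OF i] ip_nonneg by (intro mult_mono) auto
    also have "\<dots> = (1/4)^2" using R by (simp add: r_def power_divide power_mult_distrib)
    finally have "\<bar>ip p \<delta> (m i)\<bar> \<le> \<bar>1/4\<bar>" by (simp only: abs_le_square_iff)
    thus ?thesis by simp
  qed
  have feas: "el_feasible p I m (\<lambda>s. l0 s + \<delta> s)" if "ip p \<delta> \<delta> \<le> r^2" for \<delta>
    unfolding el_feasible_def
  proof
    fix i assume i: "i \<in> I"
    show "0 < 1 + ip p (\<lambda>s. l0 s + \<delta> s) (m i)" using ipb[OF i that] x[OF i] unfolding ip_add by linarith
  qed
  have quad: "F \<delta> \<le> el_log p I m l0 + ip p \<delta> ?g - a * ip p \<delta> \<delta>" if \<delta>: "ip p \<delta> \<delta> \<le> r^2" for \<delta>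
  proof -
    have "F \<delta> \<le> (\<Sum>i\<in>I. ln (1 + ip p l0 (m i)) + ip p \<delta> (m i) / (1 + ip p l0 (m i)) - (ip p \<delta> (m i))^2 / 9)"
      unfolding F_def el_log_def
    proof (rule sum_mono)
      fix i assume i: "i \<in> I"
      show "ln (1 + ip p (\<lambda>s. l0 s + \<delta> s) (m i)) \<le> ln (1 + ip p l0 (m i)) + ip p \<delta> (m i) / (1 + ip p l0 (m i)) - (ip p \<delta> (m i))^2 / 9"
        using ln_one_plus_strongly_concave[OF x[OF i], of "ip p (\<lambda>s. l0 s + \<delta> s) (m i)"] ipb[OF i \<delta>]
        by (simp add: ip_add)
    qed
    also have "\<dots> = el_log p I m l0 + ip p \<delta> ?g - (\<Sum>i\<in>I. (ip p \<delta> (m i))^2) / 9"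
      by (simp add: sum.distrib sum_subtractf el_log_def ip_grad sum_divide_distrib)
    also have "\<dots> \<le> el_log p I m l0 + ip p \<delta> ?g - a * ip p \<delta> \<delta>"
      using low[of \<delta>] by (simp add: a_def)
    finally show ?thesis .
  qed
  define K where "K = box_fun p r \<inter> {\<delta>. ip p \<delta> \<delta> \<le> r^2}"
  have "closed {\<delta>. ip p \<delta> \<delta> \<le> r^2}" unfolding ip_def
    by (intro closed_Collect_le continuous_intros)
  hence cK: "compact K" unfolding K_def by (intro compact_Int_closed compact_box_fun)
  have K0: "(\<lambda>_. 0) \<in> K" using r0 by (simp add: K_def in_box_fun ip_def)
  have contF: "continuous_on K F"
    unfolding F_def el_log_def
  proof (intro continuous_on_sum continuous_on_ln)
    fix i assume i: "i \<in> I"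
    show "continuous_on K (\<lambda>x. 1 + ip p (\<lambda>s. l0 s + x s) (m i))"
      unfolding ip_def by (intro continuous_intros)
    show "\<forall>x\<in>K. 1 + ip p (\<lambda>s. l0 s + x s) (m i) \<noteq> 0"
    proof
      fix \<delta> assume "\<delta> \<in> K"
      hence "0 < 1 + ip p (\<lambda>s. l0 s + \<delta> s) (m i)" using feas[of \<delta>] i by (auto simp: K_def el_feasible_def)
      thus "1 + ip p (\<lambda>s. l0 s + \<delta> s) (m i) \<noteq> 0" by simp
    qed
  qed
  obtain \<delta> where \<delta>K: "\<delta> \<in> K" and \<delta>max: "\<And>y. y \<in> K \<Longrightarrow> F y \<le> F \<delta>"
    using continuous_attains_sup[OF cK _ contF] K0 by blast
  have \<delta>r: "ip p \<delta> \<delta> \<le> r^2" using \<delta>K by (simp add: K_def)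
  have F0: "F (\<lambda>_. 0) = el_log p I m l0" by (simp add: F_def)
  have ge: "el_log p I m l0 \<le> F \<delta>" using \<delta>max[OF K0] F0 by simp
  have gb: "(ip p \<delta> ?g)^2 \<le> ip p \<delta> \<delta> * \<Gamma>"
    by (rule order_trans[OF ip_Cauchy_Schwarz mult_left_mono[OF g ip_nonneg]])
  have interior: "ip p \<delta> \<delta> < r^2"
  proof (rule ccontr)
    assume "\<not> ip p \<delta> \<delta> < r^2"
    hence e: "ip p \<delta> \<delta> = r^2" using \<delta>r by simp
    have "(ip p \<delta> ?g)^2 \<le> r^2 * \<Gamma>" using gb e by simp
    also have "\<dots> < r^2 * (n * c / (36 * R))^2" using r0 small by simp
    also have "\<dots> = (a * r^2)^2" using R by (simp add: a_def r_def power2_eq_square field_simps)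
    finally have "ip p \<delta> ?g < a * r^2" by (rule power2_less_imp_less) (use a0 in simp)
    thus False using quad[OF \<delta>r] ge e by simp
  qed
  define l where "l = (\<lambda>s. l0 s + \<delta> s)"
  have lfeas: "el_feasible p I m l" unfolding l_def by (rule feas[OF \<delta>r])
  have stat: "el_grad p I m l s = 0" if s: "s < p" for s
  proof -
    have "isCont (\<lambda>t. ip p (\<delta>(s := \<delta> s + t)) (\<delta>(s := \<delta> s + t))) 0"
    proof -
      have "(\<lambda>t. ip p (\<delta>(s := \<delta> s + t)) (\<delta>(s := \<delta> s + t))) = (\<lambda>t. \<Sum>u<p. (\<delta> u + t * (if u = s then 1 else 0))^2)"
        unfolding ip_def power2_eq_square by (intro ext sum.cong refl) auto
      moreover have "isCont (\<lambda>t. \<Sum>u<p. (\<delta> u + t * (if u = s then 1 else 0))^2) 0"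
        by (intro continuous_intros)
      ultimately show ?thesis by simp
    qed
    hence "eventually (\<lambda>t. ip p (\<delta>(s := \<delta> s + t)) (\<delta>(s := \<delta> s + t)) < r^2) (at 0)"
      using interior by (intro order_tendstoD(2)) (auto simp: isCont_def)
    then obtain e where e: "e > 0" "\<And>t. t \<noteq> 0 \<Longrightarrow> \<bar>t\<bar> < e \<Longrightarrow> ip p (\<delta>(s := \<delta> s + t)) (\<delta>(s := \<delta> s + t)) < r^2"
      unfolding eventually_at by (auto simp: dist_real_def)
    show ?thesis
    proof (rule local_maximum_is_stationary[OF fin lfeas s e(1)])
      fix t :: real assume t: "\<bar>t\<bar> < e"
      have lt: "ip p (\<delta>(s := \<delta> s + t)) (\<delta>(s := \<delta> s + t)) < r^2"
        using e(2)[OF _ t] interior by (cases "t = 0") auto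
      have "\<delta>(s := \<delta> s + t) \<in> K" unfolding K_def Int_iff in_box_fun mem_Collect_eq
      proof (intro conjI allI impI)
        fix u assume "u < p"
        hence "((\<delta>(s := \<delta> s + t)) u)^2 \<le> r^2"
          using coord_sq_le_sum_sq[of u p "\<delta>(s := \<delta> s + t)"] lt unfolding ip_def power2_eq_square by linarith
        thus "\<bar>(\<delta>(s := \<delta> s + t)) u\<bar> \<le> r" using r0 abs_le_square_iff[of "(\<delta>(s := \<delta> s + t)) u" r] by simp
      next
        fix u assume "p \<le> u" thus "(\<delta>(s := \<delta> s + t)) u = 0" using \<delta>K s by (auto simp: K_def in_box_fun)
      qed (use lt in simp)
      hence "F (\<delta>(s := \<delta> s + t)) \<le> F \<delta>" by (rule \<delta>max)
      moreover have "(\<lambda>u. l0 u + (\<delta>(s := \<delta> s + t)) u) = l(s := l s + t)" by (auto simp: l_def)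
      ultimately show "el_log p I m (l(s := l s + t)) \<le> el_log p I m l" by (simp add: F_def l_def)
    qed
  qed
  \<comment> \<open>Completing the square in q = |\<delta>| maximizes the bound q sqrt \<Gamma> - a q^2.\<close>
  have upper: "F \<delta> \<le> el_log p I m l0 + 9 * \<Gamma> / (4 * n * c)"
  proof -
    define q where "q = sqrt (ip p \<delta> \<delta>)"
    have q: "q \<ge> 0" "q^2 = ip p \<delta> \<delta>" using ip_nonneg by (simp_all add: q_def)
    have "(ip p \<delta> ?g)^2 \<le> (q * sqrt \<Gamma>)^2" using gb \<Gamma>0 q by (simp add: power_mult_distrib)
    hence "\<bar>ip p \<delta> ?g\<bar> \<le> \<bar>q * sqrt \<Gamma>\<bar>" by (simp only: abs_le_square_iff)
    hence b1: "ip p \<delta> ?g \<le> q * sqrt \<Gamma>" using q \<Gamma>0 by (simp add: abs_mult)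
    have "0 \<le> (2 * a * q - sqrt \<Gamma>)^2 / (4 * a)" using a0 by simp
    also have "\<dots> = a * q^2 - q * sqrt \<Gamma> + \<Gamma> / (4 * a)"
      using a0 \<Gamma>0 by (simp add: power2_diff field_simps) (simp add: power2_eq_square)
    finally have "q * sqrt \<Gamma> - a * q^2 \<le> \<Gamma> / (4 * a)" by simp
    moreover have "\<Gamma> / (4 * a) = 9 * \<Gamma> / (4 * n * c)" by (simp add: a_def)
    ultimately show ?thesis using quad[OF \<delta>r, folded q(2)] b1 by linarith
  qed
  show ?thesis using lfeas stat ge upper unfolding F_def l_def[symmetric] by blast
qed

section \<open>Quadratic approximation of the maximal log-likelihood ratio\<close>

text \<open>
  A deterministic expansion about \<open>l0\<close>, the solution of \<open>V l0 = (\<Sum> m i) / n\<close>. Twice the value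
  there is \<open>2T - \<Sum> (x i)\<^sup>2\<close> up to cubic terms, and \<open>\<Sum> (x i)\<^sup>2\<close> is \<open>n l0\<^sup>t V l0 = T\<close> up to the
  deviation (of Frobenius norm at most \<open>D\<close>) of the sample covariance from \<open>V\<close>. The gradient at
  \<open>l0\<close> consists of the deviation applied to \<open>l0\<close> and of a quadratic term, which gives the bound
  \<open>\<Gamma>\<close> for its square; \<open>multiplier_near_point\<close> then converts \<open>\<Gamma>\<close> into the last error term.
\<close>

theorem el_quadratic_approximation:
  fixes m :: "nat \<Rightarrow> nat \<Rightarrow> real" and V :: "nat \<Rightarrow> nat \<Rightarrow> real" and n :: real
  assumes fin: "finite I" and n: "n > 0" and C0: "C0 > 0" and R: "R > 0"
    and V_low: "\<And>v. C0 * ip p v v \<le> (\<Sum>r<p. \<Sum>s<p. v r * V r s * v s)"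
    and l0: "\<And>r. r < p \<Longrightarrow> n * (\<Sum>s<p. V r s * l0 s) = (\<Sum>i\<in>I. m i r)"
    and D: "(\<Sum>r<p. \<Sum>s<p. ((\<Sum>i\<in>I. m i r * m i s) / n - V r s)^2) \<le> D^2" "0 \<le> D" "D \<le> C0 / 2"
    and mR: "\<And>i. i \<in> I \<Longrightarrow> ip p (m i) (m i) \<le> R^2"
  defines "x \<equiv> \<lambda>i. ip p l0 (m i)"
  defines "T \<equiv> \<Sum>i\<in>I. x i"
  defines "X3 \<equiv> \<Sum>i\<in>I. \<bar>x i\<bar>^3" and "X4 \<equiv> \<Sum>i\<in>I. (x i)^4" and "M2 \<equiv> \<Sum>i\<in>I. ip p (m i) (m i)"
  defines "\<Gamma> \<equiv> 2 * n * D^2 * T / C0 + 8 * X4 * M2"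
  assumes TR: "4 * T * R^2 \<le> n * C0" and small: "\<Gamma> < (n * (C0 / 2) / (36 * R))^2"
  shows "\<exists>l. el_feasible p I m l \<and> (\<forall>s<p. el_grad p I m l s = 0) \<and>
    \<bar>2 * el_log p I m l - T\<bar> \<le> D * T / C0 + 2 * X3 + 9 * \<Gamma> / (n * C0)"
proof -
  have xi: "ip p l0 (m i) = x i" for i by (simp add: x_def)
  define S where "S r s = (\<Sum>i\<in>I. m i r * m i s) / n" for r s
  define E where "E r s = S r s - V r s" for r s
  have F: "(\<Sum>r<p. \<Sum>s<p. (E r s)^2) \<le> D^2" using D(1) by (simp add: E_def S_def)
  have Sq: "(\<Sum>i\<in>I. (ip p v (m i))^2) = n * (\<Sum>r<p. \<Sum>s<p. v r * S r s * v s)" for v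
  proof -
    have "(\<Sum>i\<in>I. (ip p v (m i))^2) = (\<Sum>i\<in>I. \<Sum>r<p. \<Sum>s<p. v r * (m i r * m i s) * v s)"
      unfolding ip_def power2_eq_square sum_product by (intro sum.cong refl) (simp add: algebra_simps)
    also have "\<dots> = (\<Sum>r<p. \<Sum>i\<in>I. \<Sum>s<p. v r * (m i r * m i s) * v s)" by (rule sum.swap)
    also have "\<dots> = (\<Sum>r<p. \<Sum>s<p. \<Sum>i\<in>I. v r * (m i r * m i s) * v s)"
      by (intro sum.cong refl sum.swap)
    also have "\<dots> = n * (\<Sum>r<p. \<Sum>s<p. v r * S r s * v s)"
      unfolding S_def sum_distrib_left using n
      by (intro sum.cong refl) (simp add: sum_distrib_left sum_distrib_right sum_divide_distrib algebra_simps)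
    finally show ?thesis .
  qed
  have SE: "(\<Sum>r<p. \<Sum>s<p. v r * S r s * v s) = (\<Sum>r<p. \<Sum>s<p. v r * V r s * v s) + (\<Sum>r<p. \<Sum>s<p. v r * E r s * v s)" for v
    by (simp add: E_def sum.distrib[symmetric] algebra_simps)
  note Eb = Frobenius_bilinear[OF F D(2)]
  have low: "n * (C0 / 2) * ip p v v \<le> (\<Sum>i\<in>I. (ip p v (m i))^2)" for v
  proof -
    have "D * ip p v v \<le> C0 / 2 * ip p v v" using D(3) ip_nonneg by (intro mult_right_mono)
    hence "C0 / 2 * ip p v v \<le> (\<Sum>r<p. \<Sum>s<p. v r * S r s * v s)"
      unfolding SE using V_low[of v] Eb(2)[of v] by linarith
    thus ?thesis unfolding Sq using n by (simp add: mult.assoc)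
  qed
  have TV: "T = n * (\<Sum>r<p. \<Sum>s<p. l0 r * V r s * l0 s)"
  proof -
    have "T = (\<Sum>r<p. l0 r * (\<Sum>i\<in>I. m i r))"
      unfolding T_def x_def ip_def sum_distrib_left by (rule sum.swap)
    also have "\<dots> = (\<Sum>r<p. l0 r * (n * (\<Sum>s<p. V r s * l0 s)))" by (intro sum.cong refl) (simp add: l0)
    finally show ?thesis by (simp add: sum_distrib_left algebra_simps)
  qed
  have l0T: "n * C0 * ip p l0 l0 \<le> T" unfolding TV using V_low[of l0] n by (simp add: mult.assoc)
  have T0: "T \<ge> 0" using l0T ip_nonneg[of p l0] n C0 by (meson mult_nonneg_nonneg order_trans less_imp_le)
  have l0b: "ip p l0 l0 \<le> T / (n * C0)" using l0T n C0 by (simp add: field_simps)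
  have x12: "\<bar>x i\<bar> \<le> 1/2" if i: "i \<in> I" for i
  proof -
    have "(x i)^2 \<le> ip p l0 l0 * ip p (m i) (m i)" unfolding x_def by (rule ip_Cauchy_Schwarz)
    also have "\<dots> \<le> T / (n * C0) * R^2" using l0b mR[OF i] ip_nonneg n C0 T0 by (intro mult_mono) auto
    also have "\<dots> \<le> (1/2)^2" using TR n C0 by (simp add: field_simps power2_eq_square)
    finally have "\<bar>x i\<bar> \<le> \<bar>1/2\<bar>" by (simp only: abs_le_square_iff)
    thus ?thesis by simp
  qed
  \<comment> \<open>By 1/(1+x) = 1 - x + x^2/(1+x) the gradient is the sum of the m i minus n S l0, plus a term
    w that is quadratic in x; the sum of the m i is n V l0, so only n (S - V) l0 is left of the
    first two.\<close>
  define q where "q i = (x i)^2 / (1 + x i)" for i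
  define w where "w r = (\<Sum>i\<in>I. m i r * q i)" for r
  have grad: "el_grad p I m l0 r = - (n * (\<Sum>s<p. E r s * l0 s)) + w r" if r: "r < p" for r
  proof -
    have "el_grad p I m l0 r = (\<Sum>i\<in>I. m i r - m i r * x i + m i r * q i)"
      unfolding el_grad_def xi
    proof (intro sum.cong refl)
      fix i assume "i \<in> I"
      hence "1 + x i \<noteq> 0" using x12[of i] by auto
      thus "m i r / (1 + x i) = m i r - m i r * x i + m i r * q i"
        unfolding q_def by (simp add: field_simps power2_eq_square)
    qed
    also have "\<dots> = (\<Sum>i\<in>I. m i r) - (\<Sum>i\<in>I. m i r * x i) + w r"
      by (simp add: sum.distrib sum_subtractf w_def)
    also have "(\<Sum>i\<in>I. m i r * x i) = n * (\<Sum>s<p. S r s * l0 s)"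
    proof -
      have "(\<Sum>i\<in>I. m i r * x i) = (\<Sum>s<p. \<Sum>i\<in>I. m i r * (l0 s * m i s))"
        unfolding x_def ip_def sum_distrib_left by (rule sum.swap)
      also have "\<dots> = n * (\<Sum>s<p. S r s * l0 s)"
        unfolding S_def sum_distrib_left using n
        by (intro sum.cong refl) (simp add: sum_distrib_left sum_distrib_right sum_divide_distrib algebra_simps)
      finally show ?thesis .
    qed
    also have "(\<Sum>i\<in>I. m i r) = n * (\<Sum>s<p. V r s * l0 s)" by (rule l0[OF r, symmetric])
    finally show ?thesis by (simp add: E_def sum_subtractf algebra_simps)
  qed
  have X4: "X4 \<ge> 0" and M2: "M2 \<ge> 0" and X3: "X3 \<ge> 0"
    unfolding X4_def M2_def X3_def using ip_nonneg by (auto intro!: sum_nonneg)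
  have gb: "ip p (el_grad p I m l0) (el_grad p I m l0) \<le> \<Gamma>"
  proof -
    have "ip p (el_grad p I m l0) (el_grad p I m l0) = (\<Sum>r<p. (- (n * (\<Sum>s<p. E r s * l0 s)) + w r)^2)"
      unfolding ip_def power2_eq_square by (intro sum.cong refl) (simp add: grad)
    also have "\<dots> \<le> (\<Sum>r<p. 2 * (n^2 * (\<Sum>s<p. E r s * l0 s)^2) + 2 * (w r)^2)"
    proof (rule sum_mono)
      fix r
      have "(- a + b)^2 \<le> 2 * a^2 + 2 * b^2" for a b :: real
        using zero_le_power2[of "a + b"] by (simp add: power2_eq_square algebra_simps)
      from this[of "n * (\<Sum>s<p. E r s * l0 s)" "w r"]
      show "(- (n * (\<Sum>s<p. E r s * l0 s)) + w r)^2 \<le> 2 * (n^2 * (\<Sum>s<p. E r s * l0 s)^2) + 2 * (w r)^2"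
        by (simp only: power_mult_distrib)
    qed
    also have "\<dots> = 2 * n^2 * ip p (\<lambda>r. \<Sum>s<p. E r s * l0 s) (\<lambda>r. \<Sum>s<p. E r s * l0 s) + 2 * (\<Sum>r<p. (w r)^2)"
      by (simp add: sum.distrib sum_distrib_left ip_def power2_eq_square mult.assoc)
    also have "\<dots> \<le> 2 * n^2 * (D^2 * ip p l0 l0) + 2 * (4 * X4 * M2)"
    proof (intro add_mono mult_left_mono Eb(1))
      have "(\<Sum>r<p. (w r)^2) \<le> (\<Sum>r<p. (\<Sum>i\<in>I. (m i r)^2) * (\<Sum>i\<in>I. (q i)^2))"
        unfolding w_def by (intro sum_mono Cauchy_Schwarz_ineq_sum)
      also have "\<dots> = (\<Sum>r<p. \<Sum>i\<in>I. (m i r)^2) * (\<Sum>i\<in>I. (q i)^2)" by (simp add: sum_distrib_right)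
      also have "(\<Sum>r<p. \<Sum>i\<in>I. (m i r)^2) = M2"
        unfolding M2_def ip_def power2_eq_square by (rule sum.swap)
      also have "M2 * (\<Sum>i\<in>I. (q i)^2) \<le> M2 * (4 * X4)"
        unfolding X4_def sum_distrib_left[of 4]
      proof (intro mult_left_mono sum_mono M2)
        fix i assume i: "i \<in> I"
        have "1/2 \<le> 1 + x i" using x12[OF i] by auto
        hence "1 / (1 + x i) \<le> 2" "0 \<le> 1 / (1 + x i)" by (auto simp: field_simps)
        hence "q i \<le> 2 * (x i)^2" "0 \<le> q i"
          unfolding q_def using mult_left_mono[of "1 / (1 + x i)" 2 "(x i)^2"] by (auto simp: mult.commute)
        hence "(q i)^2 \<le> (2 * (x i)^2)^2" by (intro power_mono)
        thus "(q i)^2 \<le> 4 * (x i)^4" by (simp add: power_mult_distrib)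
      qed
      finally show "(\<Sum>r<p. (w r)^2) \<le> 4 * X4 * M2" by (simp add: mult_ac)
    qed (use n in auto)
    also have "\<dots> \<le> \<Gamma>"
    proof -
      have "2 * n^2 * (D^2 * ip p l0 l0) \<le> 2 * n^2 * (D^2 * (T / (n * C0)))"
        using l0b by (intro mult_left_mono) auto
      also have "\<dots> = 2 * n * D^2 * T / C0" using n by (simp add: power2_eq_square)
      finally show ?thesis by (simp add: \<Gamma>_def)
    qed
    finally show ?thesis .
  qed
  have "\<exists>l. el_feasible p I m l \<and> (\<forall>s<p. el_grad p I m l s = 0) \<and>
     el_log p I m l0 \<le> el_log p I m l \<and> el_log p I m l \<le> el_log p I m l0 + 9 * \<Gamma> / (4 * n * (C0 / 2))"
    by (rule multiplier_near_point[OF fin n _ R x12[unfolded x_def] mR low gb small]) (use C0 in auto)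
  then obtain l where l: "el_feasible p I m l" "\<forall>s<p. el_grad p I m l s = 0"
     "el_log p I m l0 \<le> el_log p I m l" "el_log p I m l \<le> el_log p I m l0 + 9 * \<Gamma> / (4 * n * (C0 / 2))" by blast
  have X2: "(\<Sum>i\<in>I. (x i)^2) = T + n * (\<Sum>r<p. \<Sum>s<p. l0 r * E r s * l0 s)"
    unfolding x_def Sq SE TV by (simp add: algebra_simps)
  have "\<bar>2 * el_log p I m l0 - (2 * T - (\<Sum>i\<in>I. (x i)^2))\<bar> = \<bar>\<Sum>i\<in>I. 2 * (ln (1 + x i) - x i + (x i)^2 / 2)\<bar>"
    by (simp add: el_log_def T_def x_def sum_subtractf sum.distrib sum_distrib_left sum_divide_distrib algebra_simps)
  also have "\<dots> \<le> (\<Sum>i\<in>I. \<bar>2 * (ln (1 + x i) - x i + (x i)^2 / 2)\<bar>)" by (rule sum_abs)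
  also have "\<dots> \<le> (\<Sum>i\<in>I. 2 * \<bar>x i\<bar>^3)"
    using ln_one_plus_cubic_error[OF x12] unfolding abs_mult by (intro sum_mono) simp
  also have "\<dots> = 2 * X3" by (simp add: X3_def sum_distrib_left)
  finally have a1: "\<bar>2 * el_log p I m l0 - (2 * T - (\<Sum>i\<in>I. (x i)^2))\<bar> \<le> 2 * X3" .
  have "\<bar>n * (\<Sum>r<p. \<Sum>s<p. l0 r * E r s * l0 s)\<bar> \<le> n * (D * ip p l0 l0)"
    using Eb(2)[of l0] n by (simp add: abs_mult)
  also have "\<dots> \<le> n * (D * (T / (n * C0)))" using l0b n D by (intro mult_left_mono) auto
  also have "\<dots> = D * T / C0" using n by simp
  finally have a2: "\<bar>n * (\<Sum>r<p. \<Sum>s<p. l0 r * E r s * l0 s)\<bar> \<le> D * T / C0" .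
  have a3: "2 * (9 * \<Gamma> / (4 * n * (C0 / 2))) = 9 * \<Gamma> / (n * C0)" by simp
  have "\<bar>2 * el_log p I m l - T\<bar> \<le> D * T / C0 + 2 * X3 + 9 * \<Gamma> / (n * C0)"
  proof -
    have "\<bar>2 * h - T\<bar> \<le> d + 2 * X3 + K"
      if "\<bar>2 * g - (2 * T - s)\<bar> \<le> 2 * X3" "\<bar>e\<bar> \<le> d" "s = T + e" "g \<le> h" "h \<le> g + k" "2 * k = K"
      for g s e d h k K :: real
      using that by linarith
    from this[OF a1 a2 X2 l(3,4) a3] show ?thesis .
  qed
  thus ?thesis using l by blast
qed

section \<open>Measurability of the maximal log-likelihood ratio\<close>

lemma tendsto_ip:
  assumes "\<And>s. s < p \<Longrightarrow> (\<lambda>j. u j s) \<longlonglongrightarrow> l s"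
  shows "(\<lambda>j. ip p (u j) v) \<longlonglongrightarrow> ip p l v"
  unfolding ip_def using assms by (intro tendsto_sum tendsto_mult tendsto_const) auto

lemma tendsto_el_grad:
  assumes u: "\<And>s. s < p \<Longrightarrow> (\<lambda>j. u j s) \<longlonglongrightarrow> l s" and l: "el_feasible p I m l"
  shows "(\<lambda>j. el_grad p I m (u j) s) \<longlonglongrightarrow> el_grad p I m l s"
  unfolding el_grad_def
proof (intro tendsto_sum tendsto_divide tendsto_add tendsto_const tendsto_ip[OF u])
  show "1 + ip p l (m i) \<noteq> 0" if "i \<in> I" for i using l that by (auto simp: el_feasible_def)
qed

lemma tendsto_el_log:
  assumes u: "\<And>s. s < p \<Longrightarrow> (\<lambda>j. u j s) \<longlonglongrightarrow> l s" and l: "el_feasible p I m l"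
  shows "(\<lambda>j. el_log p I m (u j)) \<longlonglongrightarrow> el_log p I m l"
  unfolding el_log_def
proof (intro tendsto_sum tendsto_ln tendsto_add tendsto_const tendsto_ip[OF u])
  show "1 + ip p l (m i) \<noteq> 0" if "i \<in> I" for i using l that by (auto simp: el_feasible_def)
qed

definition rational_grid :: "nat \<Rightarrow> (nat \<Rightarrow> real) set" where
  "rational_grid p = (\<lambda>f s. if s < p then f s else 0) ` (PiE {..<p} (\<lambda>_. \<rat>))"

lemma countable_rational_grid: "countable (rational_grid p)"
  unfolding rational_grid_def by (rule countable_image, rule countable_PiE) (simp_all add: countable_rat)

lemma rational_grid_zero: "l \<in> rational_grid p \<Longrightarrow> s \<ge> p \<Longrightarrow> l s = 0"
  unfolding rational_grid_def by (erule imageE) simp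

lemma rational_grid_dense:
  obtains u where "\<And>j. u j \<in> rational_grid p" "\<And>s. s < p \<Longrightarrow> (\<lambda>j. u j s) \<longlonglongrightarrow> l s"
proof -
  have "\<exists>q\<in>\<rat>. l s < q \<and> q < l s + 1 / real (Suc j)" for s j
    using Rats_dense_in_real[of "l s" "l s + 1 / real (Suc j)"] by simp
  hence ex: "\<exists>q. q \<in> \<rat> \<and> l s < q \<and> q < l s + 1 / real (Suc j)" for s j by blast
  define q where "q s j = (SOME q. q \<in> \<rat> \<and> l s < q \<and> q < l s + 1 / real (Suc j))" for s j
  have q: "q s j \<in> \<rat>" "l s < q s j" "q s j < l s + 1 / real (Suc j)" for s j
    using someI_ex[OF ex[of s j]] unfolding q_def by blast+
  define u where "u j s = (if s < p then q s j else 0)" for j s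
  have "u j \<in> rational_grid p" for j
    unfolding rational_grid_def u_def[abs_def] using q(1)
    by (intro image_eqI[of _ _ "\<lambda>s\<in>{..<p}. q s j"]) (auto simp: fun_eq_iff)
  moreover have "(\<lambda>j. u j s) \<longlonglongrightarrow> l s" if "s < p" for s
  proof (rule tendsto_sandwich[of "\<lambda>_. l s" _ _ "\<lambda>j. l s + 1 / real (Suc j)"])
    show "(\<lambda>j. l s + 1 / real (Suc j)) \<longlonglongrightarrow> l s"
      using tendsto_add[OF tendsto_const LIMSEQ_Suc[OF lim_1_over_n]] by simp
  qed (use that q(2,3) in \<open>auto simp: u_def less_imp_le\<close>)
  ultimately show ?thesis by (rule that)
qed

text \<open>
  The existence of a multiplier is an uncountable union of events. The feasible multipliers are
  exhausted by the compact sets on which the coordinates are at most \<open>N\<close> and the arguments of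
  the logarithm at least \<open>1/(N+1)\<close>. On such a set a stationary point exists if and only if there
  are points with arbitrarily small gradient, and these can be taken rational.
\<close>

lemma multiplier_exists_iff_rational:
  assumes fin: "finite I"
  shows "(\<exists>l. el_feasible p I m l \<and> (\<forall>s<p. el_grad p I m l s = 0)) \<longleftrightarrow>
    (\<exists>N::nat. \<forall>j::nat. \<exists>l\<in>rational_grid p. (\<forall>s\<in>{..<p}. \<bar>l s\<bar> \<le> real N) \<and>
       (\<forall>i\<in>I. 1 / real (Suc N) \<le> 1 + ip p l (m i)) \<and> (\<forall>s\<in>{..<p}. \<bar>el_grad p I m l s\<bar> \<le> 1 / real (Suc j)))"
  (is "?L \<longleftrightarrow> ?R")
proof
  assume ?L
  then obtain l where l: "el_feasible p I m l" "\<And>s. s < p \<Longrightarrow> el_grad p I m l s = 0" by blast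
  obtain u where u: "\<And>j. u j \<in> rational_grid p" "\<And>s. s < p \<Longrightarrow> (\<lambda>j. u j s) \<longlonglongrightarrow> l s"
    using rational_grid_dense[of p l] by blast
  have N1: "eventually (\<lambda>N::nat. \<bar>l s\<bar> < real N) sequentially" for s
    using filterlim_real_sequentially by (auto simp: filterlim_at_top_dense)
  have N2: "eventually (\<lambda>N::nat. 1 / real (Suc N) < 1 + ip p l (m i)) sequentially" if "i \<in> I" for i
    using order_tendstoD(2)[OF LIMSEQ_Suc[OF lim_1_over_n], of "1 + ip p l (m i)"] l(1) that
    by (auto simp: el_feasible_def)
  have "eventually (\<lambda>N::nat. (\<forall>s\<in>{..<p}. \<bar>l s\<bar> < real N) \<and> (\<forall>i\<in>I. 1 / real (Suc N) < 1 + ip p l (m i))) sequentially"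
    using N1 N2 fin by (intro eventually_conj eventually_ball_finite) auto
  then obtain N where N: "\<And>s. s < p \<Longrightarrow> \<bar>l s\<bar> < real N" "\<And>i. i \<in> I \<Longrightarrow> 1 / real (Suc N) < 1 + ip p l (m i)"
    by (auto simp: eventually_sequentially)
  have tip: "(\<lambda>k. 1 + ip p (u k) (m i)) \<longlonglongrightarrow> 1 + ip p l (m i)" for i
    by (intro tendsto_add tendsto_const tendsto_ip u(2))
  show ?R
  proof (intro exI[of _ N] allI)
    fix j :: nat
    have "eventually (\<lambda>k. (\<forall>s\<in>{..<p}. \<bar>u k s\<bar> < real N) \<and> (\<forall>i\<in>I. 1 / real (Suc N) < 1 + ip p (u k) (m i)) \<and>
        (\<forall>s\<in>{..<p}. \<bar>el_grad p I m (u k) s\<bar> < 1 / real (Suc j))) sequentially"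
    proof (intro eventually_conj eventually_ball_finite ballI fin finite_lessThan)
      fix s assume s: "s \<in> {..<p}"
      show "eventually (\<lambda>k. \<bar>u k s\<bar> < real N) sequentially"
        using order_tendstoD(2)[OF tendsto_rabs[OF u(2)], of s] N(1)[of s] s by auto
      show "eventually (\<lambda>k. \<bar>el_grad p I m (u k) s\<bar> < 1 / real (Suc j)) sequentially"
        using order_tendstoD(2)[OF tendsto_rabs[OF tendsto_el_grad[OF u(2) l(1)]], of s "1 / real (Suc j)"] l(2)[of s] s by auto
    next
      fix i assume i: "i \<in> I"
      show "eventually (\<lambda>k. 1 / real (Suc N) < 1 + ip p (u k) (m i)) sequentially"
        by (rule order_tendstoD(1)[OF tip N(2)[OF i]])
    qed
    then obtain k where "(\<forall>s\<in>{..<p}. \<bar>u k s\<bar> < real N) \<and> (\<forall>i\<in>I. 1 / real (Suc N) < 1 + ip p (u k) (m i)) \<and>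
        (\<forall>s\<in>{..<p}. \<bar>el_grad p I m (u k) s\<bar> < 1 / real (Suc j))" by (auto simp: eventually_sequentially)
    thus "\<exists>l\<in>rational_grid p. (\<forall>s\<in>{..<p}. \<bar>l s\<bar> \<le> real N) \<and>
       (\<forall>i\<in>I. 1 / real (Suc N) \<le> 1 + ip p l (m i)) \<and> (\<forall>s\<in>{..<p}. \<bar>el_grad p I m l s\<bar> \<le> 1 / real (Suc j))"
      using u(1)[of k] by (intro bexI[of _ "u k"]) (auto simp: less_imp_le)
  qed
next
  assume ?R
  then obtain N where N: "\<forall>j::nat. \<exists>l\<in>rational_grid p. (\<forall>s\<in>{..<p}. \<bar>l s\<bar> \<le> real N) \<and>
       (\<forall>i\<in>I. 1 / real (Suc N) \<le> 1 + ip p l (m i)) \<and> (\<forall>s\<in>{..<p}. \<bar>el_grad p I m l s\<bar> \<le> 1 / real (Suc j))" by blast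
  from choice[OF N[unfolded Bex_def]] obtain u where u0:
    "\<forall>j. u j \<in> rational_grid p \<and> (\<forall>s\<in>{..<p}. \<bar>u j s\<bar> \<le> real N) \<and>
       (\<forall>i\<in>I. 1 / real (Suc N) \<le> 1 + ip p (u j) (m i)) \<and> (\<forall>s\<in>{..<p}. \<bar>el_grad p I m (u j) s\<bar> \<le> 1 / real (Suc j))" by blast
  have u: "u j \<in> rational_grid p" "s < p \<Longrightarrow> \<bar>u j s\<bar> \<le> real N"
     "i \<in> I \<Longrightarrow> 1 / real (Suc N) \<le> 1 + ip p (u j) (m i)"
     "s < p \<Longrightarrow> \<bar>el_grad p I m (u j) s\<bar> \<le> 1 / real (Suc j)" for j s i
    using u0 by (blast, blast, blast, blast)
  have "seq_compact (box_fun p (real N))" by (rule compact_imp_seq_compact[OF compact_box_fun])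
  moreover have "\<forall>j. u j \<in> box_fun p (real N)"
    using u(2) rational_grid_zero[OF u(1)] by (auto simp: in_box_fun)
  ultimately obtain l r where r: "strict_mono r" and lim: "(u \<circ> r) \<longlonglongrightarrow> l"
    unfolding seq_compact_def by blast
  have ur: "(\<lambda>j. u (r j) s) \<longlonglongrightarrow> l s" for s
  proof -
    have "isCont (\<lambda>x::nat\<Rightarrow>real. x s) l"
      using continuous_on_product_coordinates[of s] continuous_on_eq_continuous_at[OF open_UNIV] by blast
    from isCont_tendsto_compose[OF this lim] show ?thesis by simp
  qed
  have feas: "el_feasible p I m l" unfolding el_feasible_def
  proof
    fix i assume i: "i \<in> I"
    have "1 / real (Suc N) \<le> 1 + ip p l (m i)"
      by (rule tendsto_lowerbound[OF tendsto_add[OF tendsto_const tendsto_ip[OF ur]]]) (use u(3)[OF i] in auto)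
    moreover have "0 < 1 / real (Suc N)" by simp
    ultimately show "0 < 1 + ip p l (m i)" by linarith
  qed
  moreover have "el_grad p I m l s = 0" if s: "s < p" for s
  proof (rule LIMSEQ_unique[OF tendsto_el_grad[OF ur feas]])
    have inv: "(\<lambda>j. 1 / real (Suc (r j))) \<longlonglongrightarrow> 0"
      using LIMSEQ_subseq_LIMSEQ[OF LIMSEQ_Suc[OF lim_1_over_n] r] by (simp add: o_def)
    show "(\<lambda>j. el_grad p I m (u (r j)) s) \<longlonglongrightarrow> 0"
      by (rule Lim_null_comparison[OF _ inv]) (use u(4)[OF s] in auto)
  qed
  ultimately show ?L by blast
qed

text \<open>
  The value at a stationary point is the supremum over all feasible points, and by continuity
  over the rational ones.
\<close>

lemma el_value_exceeds_iff_rational: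
  assumes l: "el_feasible p I m l" "\<And>s. s < p \<Longrightarrow> el_grad p I m l s = 0"
  shows "a < el_log p I m l \<longleftrightarrow> (\<exists>\<mu>\<in>rational_grid p. (\<forall>i\<in>I. 0 < 1 + ip p \<mu> (m i)) \<and> a < el_log p I m \<mu>)"
    (is "?L \<longleftrightarrow> ?R")
proof
  assume ?R
  then obtain \<mu> where \<mu>: "el_feasible p I m \<mu>" "a < el_log p I m \<mu>" unfolding el_feasible_def by blast
  have "el_log p I m \<mu> \<le> el_log p I m l" by (rule stationary_point_is_maximum[OF l \<mu>(1)])
  thus ?L using \<mu>(2) by linarith
next
  assume a: ?L
  obtain u where u: "\<And>j. u j \<in> rational_grid p" "\<And>s. s < p \<Longrightarrow> (\<lambda>j. u j s) \<longlonglongrightarrow> l s"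
    using rational_grid_dense[of p l] by blast
  show ?R
  proof (cases "finite I")
    case True
    have "eventually (\<lambda>k. (\<forall>i\<in>I. 0 < 1 + ip p (u k) (m i)) \<and> a < el_log p I m (u k)) sequentially"
    proof (intro eventually_conj eventually_ball_finite ballI True)
      show "eventually (\<lambda>k. a < el_log p I m (u k)) sequentially"
        by (rule order_tendstoD(1)[OF tendsto_el_log[OF u(2) l(1)] a])
      fix i assume i: "i \<in> I"
      show "eventually (\<lambda>k. 0 < 1 + ip p (u k) (m i)) sequentially"
      proof (rule order_tendstoD(1))
        show "(\<lambda>k. 1 + ip p (u k) (m i)) \<longlonglongrightarrow> 1 + ip p l (m i)"
          by (intro tendsto_add tendsto_const tendsto_ip u(2))
        show "0 < 1 + ip p l (m i)" using l(1) i by (simp add: el_feasible_def)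
      qed
    qed
    thus ?thesis using u(1) by (auto simp: eventually_sequentially)
  next
    case False
    hence "el_log p I m l = 0" by (simp add: el_log_def)
    moreover have "(\<lambda>_. 0) \<in> rational_grid p" unfolding rational_grid_def
      by (intro image_eqI[of _ _ "\<lambda>s\<in>{..<p}. 0"]) auto
    ultimately show ?thesis using a by (intro bexI[of _ "\<lambda>_. 0"]) (auto simp: ip_def el_log_def)
  qed
qed

text \<open>
  Both the set where a multiplier exists and the upper level sets on it are countable
  combinations of measurable sets by the two preceding lemmas.
\<close>

lemma el_statistic_measurable:
  fixes m :: "'a \<Rightarrow> nat \<Rightarrow> nat \<Rightarrow> real"
  assumes fin: "finite I" and m: "\<And>i s. i \<in> I \<Longrightarrow> s < p \<Longrightarrow> (\<lambda>\<omega>. m \<omega> i s) \<in> borel_measurable M"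
    and val: "\<And>\<omega> l. \<omega> \<in> space M \<Longrightarrow> el_feasible p I (m \<omega>) l \<Longrightarrow> (\<And>s. s < p \<Longrightarrow> el_grad p I (m \<omega>) l s = 0) \<Longrightarrow> f \<omega> = 2 * el_log p I (m \<omega>) l"
    and none: "\<And>\<omega>. \<omega> \<in> space M \<Longrightarrow> \<not> (\<exists>l. el_feasible p I (m \<omega>) l \<and> (\<forall>s<p. el_grad p I (m \<omega>) l s = 0)) \<Longrightarrow> f \<omega> = c"
  shows "f \<in> borel_measurable M"
proof -
  have [measurable]: "(\<lambda>\<omega>. ip p l (m \<omega> i)) \<in> borel_measurable M" if "i \<in> I" for i l
    unfolding ip_def using m[OF that] by (intro borel_measurable_sum borel_measurable_times) auto
  have [measurable]: "(\<lambda>\<omega>. el_grad p I (m \<omega>) l s) \<in> borel_measurable M" if "s < p" for s l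
    unfolding el_grad_def using m that by (intro borel_measurable_sum borel_measurable_divide borel_measurable_add) auto
  have [measurable]: "(\<lambda>\<omega>. el_log p I (m \<omega>) l) \<in> borel_measurable M" for l
    unfolding el_log_def by (intro borel_measurable_sum borel_measurable_ln borel_measurable_add) auto
  have at: "{\<omega>\<in>space M. b \<le> 1 + ip p l (m \<omega> i)} \<in> sets M" "{\<omega>\<in>space M. b < 1 + ip p l (m \<omega> i)} \<in> sets M"
    if "i \<in> I" for i b l using that by measurable
  have at': "{\<omega>\<in>space M. \<bar>el_grad p I (m \<omega>) l s\<bar> \<le> b} \<in> sets M" if "s \<in> {..<p}" for s l b
    using that[unfolded lessThan_iff] by measurable
  have at'': "{\<omega>\<in>space M. b < el_log p I (m \<omega>) l} \<in> sets M" for b l by measurable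
  define ex where "ex \<omega> \<longleftrightarrow> (\<exists>l. el_feasible p I (m \<omega>) l \<and> (\<forall>s<p. el_grad p I (m \<omega>) l s = 0))" for \<omega>
  have ex: "{\<omega>\<in>space M. ex \<omega>} \<in> sets M"
    unfolding ex_def multiplier_exists_iff_rational[OF fin]
    by (intro sets.sets_Collect_countable_Ex sets.sets_Collect_countable_All sets.sets_Collect_countable_Ex'
         sets.sets_Collect_conj sets.sets_Collect_finite_All countable_rational_grid fin finite_lessThan
         at at' sets.sets_Collect_const)
  show ?thesis
  proof (rule borel_measurableI_greater)
    fix a :: real
    define gt where "gt \<omega> \<longleftrightarrow> (\<exists>\<mu>\<in>rational_grid p. (\<forall>i\<in>I. 0 < 1 + ip p \<mu> (m \<omega> i)) \<and> a / 2 < el_log p I (m \<omega>) \<mu>)" for \<omega>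
    have gt: "{\<omega>\<in>space M. gt \<omega>} \<in> sets M" unfolding gt_def
      by (intro sets.sets_Collect_countable_Ex' sets.sets_Collect_conj sets.sets_Collect_finite_All countable_rational_grid fin at at'')
    have "{\<omega>\<in>space M. a < f \<omega>} = {\<omega>\<in>space M. (ex \<omega> \<and> gt \<omega>) \<or> (\<not> ex \<omega> \<and> a < c)}"
    proof (rule Collect_cong, rule conj_cong[OF refl])
      fix \<omega> assume \<omega>: "\<omega> \<in> space M"
      show "a < f \<omega> \<longleftrightarrow> (ex \<omega> \<and> gt \<omega>) \<or> (\<not> ex \<omega> \<and> a < c)"
      proof (cases "ex \<omega>")
        case True
        then obtain l where l: "el_feasible p I (m \<omega>) l" "\<And>s. s < p \<Longrightarrow> el_grad p I (m \<omega>) l s = 0"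
          unfolding ex_def by blast
        have "f \<omega> = 2 * el_log p I (m \<omega>) l" by (rule val[OF \<omega> l(1)]) (rule l(2))
        hence "a < f \<omega> \<longleftrightarrow> a / 2 < el_log p I (m \<omega>) l" by auto
        also have "\<dots> \<longleftrightarrow> gt \<omega>" unfolding gt_def by (rule el_value_exceeds_iff_rational[OF l])
        finally show ?thesis using True by simp
      next
        case False
        thus ?thesis using none[OF \<omega>] unfolding ex_def[symmetric] by simp
      qed
    qed
    also have "\<dots> \<in> sets M"
      by (intro sets.sets_Collect_disj sets.sets_Collect_conj sets.sets_Collect_neg ex gt sets.sets_Collect_const)
    finally show "{\<omega>\<in>space M. a < f \<omega>} \<in> sets M" .
  qed
qed

section \<open>Reduction to signed observations\<close>

text \<open>
  The sign of the second group absorbs the minus signs in the statistic \<open>EL\<close>, in its multiplier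
  equation and in \<open>psi\<close>, so that the two groups can be treated as one sample.
\<close>

definition group_weight :: "nat \<Rightarrow> nat \<Rightarrow> nat \<Rightarrow> real" where
  "group_weight n k i = (if i \<le> k then real n / real k else - (real n / real (n - k)))"

lemma scalar_prod_ip:
  "dim_vec v = p \<Longrightarrow> u \<bullet> v = ip p (\<lambda>s. u $ s) (\<lambda>s. v $ s)"
  by (simp add: scalar_prod_def ip_def lessThan_atLeast0)

lemma ip_scale_right: "ip p u (\<lambda>s. c * v s) = c * ip p u v"
  by (simp add: ip_def sum_distrib_left algebra_simps)

lemma EL_multiplier_iff:
  assumes k: "1 \<le> k" "k < n" and z: "\<And>i. i \<in> {1..n} \<Longrightarrow> z i \<in> carrier_vec p"
  defines "m \<equiv> \<lambda>i s. group_weight n k i * z i $ s"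
  shows "EL_multiplier n k p z l \<longleftrightarrow> l \<in> carrier_vec p \<and> el_feasible p {1..n} m (\<lambda>s. l $ s)
     \<and> (\<forall>s<p. el_grad p {1..n} m (\<lambda>s. l $ s) s = 0)"
    and "EL_at n k z l = 2 * el_log p {1..n} m (\<lambda>s. l $ s)"
proof -
  have split: "{1..n} = {1..k} \<union> {k+1..n}" "{1..k} \<inter> {k+1..n} = {}" using k by auto
  have ip1: "1 + real n / real k * (l \<bullet> z i) = 1 + ip p (\<lambda>s. l $ s) (m i)" if "i \<in> {1..k}" for i
    using z[of i] that k unfolding m_def ip_scale_right by (subst scalar_prod_ip[of _ p]) (auto simp: group_weight_def)
  have ip2: "1 - real n / real (n - k) * (l \<bullet> z i) = 1 + ip p (\<lambda>s. l $ s) (m i)" if "i \<in> {k+1..n}" for i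
    using z[of i] that k unfolding m_def ip_scale_right by (subst scalar_prod_ip[of _ p]) (auto simp: group_weight_def)
  have nk: "real (n - k) > 0" "real k > 0" "real n > 0" "real (n - k) = real n - real k" using k by auto
  have feas: "(\<forall>i\<in>{1..k}. 0 < 1 + real n / real k * (l \<bullet> z i)) \<and> (\<forall>j\<in>{k+1..n}. 0 < 1 - real n / real (n - k) * (l \<bullet> z j))
     \<longleftrightarrow> el_feasible p {1..n} m (\<lambda>s. l $ s)"
  proof -
    have "(\<forall>i\<in>{1..k}. 0 < 1 + real n / real k * (l \<bullet> z i)) \<longleftrightarrow> (\<forall>i\<in>{1..k}. 0 < 1 + ip p (\<lambda>s. l $ s) (m i))"
      by (rule ball_cong[OF refl]) (simp only: ip1)
    moreover have "(\<forall>i\<in>{k+1..n}. 0 < 1 - real n / real (n - k) * (l \<bullet> z i)) \<longleftrightarrow> (\<forall>i\<in>{k+1..n}. 0 < 1 + ip p (\<lambda>s. l $ s) (m i))"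
      by (rule ball_cong[OF refl]) (simp only: ip2)
    ultimately show ?thesis unfolding el_feasible_def split(1) ball_Un by (simp only:)
  qed
  have grad: "(\<Sum>i=1..k. z i $ s / (real k / real n + l \<bullet> z i)) - (\<Sum>j=k+1..n. z j $ s / (1 - real k / real n - l \<bullet> z j))
     = el_grad p {1..n} m (\<lambda>s. l $ s) s" for s
  proof -
    have "(\<Sum>i=1..k. z i $ s / (real k / real n + l \<bullet> z i)) = (\<Sum>i=1..k. m i s / (1 + ip p (\<lambda>s. l $ s) (m i)))"
    proof (rule sum.cong[OF refl])
      fix i assume i: "i \<in> {1..k}"
      have "real k / real n + l \<bullet> z i = (1 + real n / real k * (l \<bullet> z i)) * (real k / real n)"
        using nk by (simp add: field_simps)
      moreover have "m i s = real n / real k * z i $ s" using i by (simp add: m_def group_weight_def)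
      ultimately show "z i $ s / (real k / real n + l \<bullet> z i) = m i s / (1 + ip p (\<lambda>s. l $ s) (m i))"
        unfolding ip1[OF i] using nk by (simp add: mult_ac)
    qed
    moreover have "- (\<Sum>j=k+1..n. z j $ s / (1 - real k / real n - l \<bullet> z j)) = (\<Sum>j=k+1..n. m j s / (1 + ip p (\<lambda>s. l $ s) (m j)))"
      unfolding sum_negf[symmetric]
    proof (rule sum.cong[OF refl])
      fix i assume i: "i \<in> {k+1..n}"
      have "1 - real k / real n - l \<bullet> z i = (1 - real n / real (n - k) * (l \<bullet> z i)) * (real (n - k) / real n)"
        using nk by (simp add: field_simps)
      moreover have "m i s = - (real n / real (n - k)) * z i $ s" using i by (simp add: m_def group_weight_def)
      ultimately show "- (z i $ s / (1 - real k / real n - l \<bullet> z i)) = m i s / (1 + ip p (\<lambda>s. l $ s) (m i))"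
        unfolding ip2[OF i] using nk(1-3) by (simp add: mult_ac)
    qed
    ultimately show ?thesis
      unfolding el_grad_def split(1) by (subst sum.union_disjoint) auto
  qed
  show "EL_multiplier n k p z l \<longleftrightarrow> l \<in> carrier_vec p \<and> el_feasible p {1..n} m (\<lambda>s. l $ s)
     \<and> (\<forall>s<p. el_grad p {1..n} m (\<lambda>s. l $ s) s = 0)"
    unfolding EL_multiplier_def grad feas[symmetric] by blast
  have "(\<Sum>i=1..k. ln (1 + real n / real k * (l \<bullet> z i))) = (\<Sum>i=1..k. ln (1 + ip p (\<lambda>s. l $ s) (m i)))"
    by (rule sum.cong[OF refl]) (simp only: ip1)
  moreover have "(\<Sum>i=k+1..n. ln (1 - real n / real (n - k) * (l \<bullet> z i))) = (\<Sum>i=k+1..n. ln (1 + ip p (\<lambda>s. l $ s) (m i)))"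
    by (rule sum.cong[OF refl]) (simp only: ip2)
  moreover have "el_log p {1..n} m (\<lambda>s. l $ s) = (\<Sum>i=1..k. ln (1 + ip p (\<lambda>s. l $ s) (m i))) + (\<Sum>i=k+1..n. ln (1 + ip p (\<lambda>s. l $ s) (m i)))"
    unfolding el_log_def split(1) by (rule sum.union_disjoint) auto
  ultimately show "EL_at n k z l = 2 * el_log p {1..n} m (\<lambda>s. l $ s)" unfolding EL_at_def by simp
qed

text \<open>
  The choice operator in \<open>EL\<close> may pick any multiplier; all of them are maximizers and give the
  same value.
\<close>

lemma EL_eq_el_log:
  assumes k: "1 \<le> k" "k < n" and z: "\<And>i. i \<in> {1..n} \<Longrightarrow> z i \<in> carrier_vec p"
  defines "m \<equiv> \<lambda>i s. group_weight n k i * z i $ s"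
  shows "el_feasible p {1..n} m l \<Longrightarrow> (\<And>s. s < p \<Longrightarrow> el_grad p {1..n} m l s = 0) \<Longrightarrow> EL c n k p z = 2 * el_log p {1..n} m l"
    and "\<not> (\<exists>l. el_feasible p {1..n} m l \<and> (\<forall>s<p. el_grad p {1..n} m l s = 0)) \<Longrightarrow> EL c n k p z = c"
proof -
  have iff: "EL_multiplier n k p z l \<longleftrightarrow> l \<in> carrier_vec p \<and> el_feasible p {1..n} m (\<lambda>s. l $ s)
       \<and> (\<forall>s<p. el_grad p {1..n} m (\<lambda>s. l $ s) s = 0)"
    "EL_at n k z l = 2 * el_log p {1..n} m (\<lambda>s. l $ s)" for l
    unfolding m_def by (rule EL_multiplier_iff[OF k], rule z, assumption)+
  {
    assume l: "el_feasible p {1..n} m l" "\<And>s. s < p \<Longrightarrow> el_grad p {1..n} m l s = 0"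
    have ipv: "ip p (\<lambda>s. vec p l $ s) v = ip p l v" for v by (simp add: ip_def)
    have "EL_multiplier n k p z (vec p l)"
      unfolding iff using l unfolding el_feasible_def el_grad_def ipv by simp
    hence ex: "\<exists>l. EL_multiplier n k p z l" by blast
    define l' where "l' = (SOME l. EL_multiplier n k p z l)"
    have "EL_multiplier n k p z l'" unfolding l'_def by (rule someI_ex[OF ex])
    hence l': "el_feasible p {1..n} m (\<lambda>s. l' $ s)" "\<And>s. s < p \<Longrightarrow> el_grad p {1..n} m (\<lambda>s. l' $ s) s = 0"
      unfolding iff by auto
    have "el_log p {1..n} m (\<lambda>s. l' $ s) = el_log p {1..n} m l"
      by (intro antisym stationary_point_is_maximum l l')
    thus "EL c n k p z = 2 * el_log p {1..n} m l"
      unfolding EL_def using ex by (simp add: l'_def[symmetric] iff(2))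
  }
  assume "\<not> (\<exists>l. el_feasible p {1..n} m l \<and> (\<forall>s<p. el_grad p {1..n} m l s = 0))"
  hence "\<not> (\<exists>l. EL_multiplier n k p z l)" unfolding iff by blast
  thus "EL c n k p z = c" unfolding EL_def by (rule if_not_P)
qed

lemma EL_cong:
  assumes "\<And>i. i \<in> {1..n} \<Longrightarrow> z i = z' i" "k < n"
  shows "EL c n k p z = EL c n k p z'"
proof -
  have s1: "(\<Sum>i=1..k. f i (z i)) = (\<Sum>i=1..k. f i (z' i))" for f :: "nat \<Rightarrow> real Matrix.vec \<Rightarrow> real"
    using assms by (intro sum.cong) auto
  have s2: "(\<Sum>i=k+1..n. f i (z i)) = (\<Sum>i=k+1..n. f i (z' i))" for f :: "nat \<Rightarrow> real Matrix.vec \<Rightarrow> real"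
    using assms by (intro sum.cong) auto
  have b1: "(\<forall>i\<in>{1..k}. Q (z i)) = (\<forall>i\<in>{1..k}. Q (z' i))" for Q
    using assms by auto
  have b2: "(\<forall>i\<in>{k+1..n}. Q (z i)) = (\<forall>i\<in>{k+1..n}. Q (z' i))" for Q
    using assms by auto
  have "EL_multiplier n k p z = EL_multiplier n k p z'"
    unfolding EL_multiplier_def[abs_def]
    by (intro ext arg_cong2[where f="(\<and>)"] refl b1 b2 arg_cong[where f=All])
       (subst s1[of "\<lambda>_ v. v $ _ / (_ + _ \<bullet> v)"], subst s2[of "\<lambda>_ v. v $ _ / (_ - _ \<bullet> v)"], rule refl)
  moreover have "EL_at n k z = EL_at n k z'"
    unfolding EL_at_def[abs_def]
    by (intro ext arg_cong2[where f="(+)"] arg_cong2[where f="(*)"] refl s1 s2)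
  ultimately show ?thesis by (simp add: EL_def)
qed

section \<open>The projection of a two-phase design\<close>

locale two_phase_design =
  fixes n k p :: nat and s2 C0 :: real and X :: "nat \<Rightarrow> real Matrix.vec"
  assumes k: "1 \<le> k" "k < n" and p: "1 \<le> p" and s2: "0 < s2" and C0: "0 < C0"
    and X: "\<And>i. i \<in> {1..n} \<Longrightarrow> X i \<in> carrier_vec p"
    and eig: "C0 < eigval (Vn n k p s2 X) p"
begin

text \<open>
  \<open>x\<close>, \<open>V\<close> and \<open>W\<close> are the design, the normalized covariance matrix and its inverse as plain
  functions of the indices. \<open>a i j\<close> is \<open>X i\<^sup>t W X j\<close>, and \<open>P\<close> is the projection onto the span of
  the columns of the design scaled by \<open>c\<close>.
\<close>

definition c :: "nat \<Rightarrow> real" where "c = group_weight n k"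
definition x :: "nat \<Rightarrow> nat \<Rightarrow> real" where "x i s = X i $ s"
definition V :: "nat \<Rightarrow> nat \<Rightarrow> real" where "V r s = Vn n k p s2 X $$ (r, s)"
definition W :: "nat \<Rightarrow> nat \<Rightarrow> real" where "W r s = mat_inv (Vn n k p s2 X) $$ (r, s)"
definition a :: "nat \<Rightarrow> nat \<Rightarrow> real" where "a i j = ip p (x i) (\<lambda>r. ip p (W r) (x j))"
definition P :: "nat \<Rightarrow> nat \<Rightarrow> real" where "P i j = s2 * c i * c j * a i j / n"

lemma n_pos: "real n > 0" using k by simp

lemma sum_split: "(\<Sum>i\<in>{1..n}. f i) = (\<Sum>i=1..k. f i) + (\<Sum>i=k+1..n. f i)" for f :: "nat \<Rightarrow> real"
proof -
  have "{1..n} = {1..k} \<union> {k+1..n}" using k by auto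
  thus ?thesis by (simp add: sum.union_disjoint[symmetric] ivl_disj_int)
qed

lemma weight_theta:
  "i \<le> k \<Longrightarrow> c i = 1 / (real k / real n)" "k < i \<Longrightarrow> c i = - (1 / (1 - real k / real n))"
  using k by (auto simp: c_def group_weight_def field_simps of_nat_diff)

lemma Vi_entry: "i \<in> {1..n} \<Longrightarrow> r < p \<Longrightarrow> s < p \<Longrightarrow> Vi s2 X i $$ (r, s) = s2 * (x i r * x i s)"
  using X[of i] by (auto simp: Vi_def outer_def x_def)

lemma V_entry:
  assumes "r < p" "s < p"
  shows "V r s = (\<Sum>i\<in>{1..n}. s2 * (c i)^2 * x i r * x i s) / n"
proof -
  let ?\<theta> = "real k / real n"
  have "V r s = 1 / (real n * ?\<theta>^2) * (\<Sum>i=1..k. Vi s2 X i $$ (r, s)) + 1 / (real n * (1 - ?\<theta>)^2) * (\<Sum>i=k+1..n. Vi s2 X i $$ (r, s))"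
    unfolding V_def Vn_def Let_def using assms by simp
  also have "1 / (real n * ?\<theta>^2) * (\<Sum>i=1..k. Vi s2 X i $$ (r, s)) = (\<Sum>i=1..k. s2 * (c i)^2 * x i r * x i s) / n"
    unfolding sum_distrib_left sum_divide_distrib
  proof (rule sum.cong[OF refl])
    fix i assume i: "i \<in> {1..k}"
    hence "i \<in> {1..n}" "c i = 1 / ?\<theta>" using k weight_theta by auto
    thus "1 / (real n * ?\<theta>^2) * Vi s2 X i $$ (r, s) = s2 * (c i)^2 * x i r * x i s / n"
      using assms by (simp add: Vi_entry power_divide mult_ac)
  qed
  also have "1 / (real n * (1 - ?\<theta>)^2) * (\<Sum>i=k+1..n. Vi s2 X i $$ (r, s)) = (\<Sum>i=k+1..n. s2 * (c i)^2 * x i r * x i s) / n"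
    unfolding sum_distrib_left sum_divide_distrib
  proof (rule sum.cong[OF refl])
    fix i assume i: "i \<in> {k+1..n}"
    hence "i \<in> {1..n}" "c i = - (1 / (1 - ?\<theta>))" using k weight_theta by auto
    thus "1 / (real n * (1 - ?\<theta>)^2) * Vi s2 X i $$ (r, s) = s2 * (c i)^2 * x i r * x i s / n"
      using assms by (simp add: Vi_entry power_divide mult_ac)
  qed
  finally show ?thesis unfolding sum_split by (simp add: add_divide_distrib)
qed

lemma V_sym: "r < p \<Longrightarrow> s < p \<Longrightarrow> V r s = V s r"
  by (simp add: V_entry mult_ac)

lemma Vn_carrier: "Vn n k p s2 X \<in> carrier_mat p p"
  by (simp add: Vn_def Let_def)

lemma V_low: "C0 * ip p v v \<le> (\<Sum>r<p. \<Sum>s<p. v r * V r s * v s)"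
proof -
  have T: "transpose_mat (Vn n k p s2 X) = Vn n k p s2 X"
    using Vn_carrier V_sym by (intro eq_matI) (auto simp: V_def)
  have "C0 * ip p v v \<le> eigval (Vn n k p s2 X) p * ip p v v"
    using eig ip_nonneg by (intro mult_right_mono) auto
  also have "\<dots> \<le> (\<Sum>r<p. \<Sum>s<p. v r * V r s * v s)"
    using quadratic_form_bound_by_eigval[OF Vn_carrier T p, of v] by (simp add: ip_def power2_eq_square V_def)
  finally show ?thesis .
qed

text \<open>
  A nonzero kernel vector would contradict the lower bound \<open>V_low\<close>; this is what makes \<open>mat_inv\<close>
  a genuine inverse.
\<close>

lemma W_inverse: "mat_inv (Vn n k p s2 X) \<in> carrier_mat p p"
  "Vn n k p s2 X * mat_inv (Vn n k p s2 X) = 1\<^sub>m p" "mat_inv (Vn n k p s2 X) * Vn n k p s2 X = 1\<^sub>m p"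
proof -
  let ?V = "Vn n k p s2 X"
  have "det ?V \<noteq> 0"
  proof
    assume "det ?V = 0"
    then obtain v where v: "v \<in> carrier_vec p" "v \<noteq> 0\<^sub>v p" "?V *\<^sub>v v = 0\<^sub>v p"
      using det_0_iff_vec_prod_zero[OF Vn_carrier] by blast
    have row: "(\<Sum>s<p. V r s * v $ s) = 0" if "r < p" for r
      using arg_cong[OF v(3), of "\<lambda>u. u $ r"] that v(1) Vn_carrier
      by (simp add: scalar_prod_def lessThan_atLeast0 V_def)
    have "(\<Sum>r<p. \<Sum>s<p. v $ r * V r s * v $ s) = (\<Sum>r<p. v $ r * (\<Sum>s<p. V r s * v $ s))"
      by (simp add: sum_distrib_left mult.assoc)
    also have "\<dots> = 0" using row by simp
    finally have "C0 * ip p (\<lambda>s. v $ s) (\<lambda>s. v $ s) \<le> 0" using V_low[of "\<lambda>s. v $ s"] by simp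
    hence "ip p (\<lambda>s. v $ s) (\<lambda>s. v $ s) = 0" using C0 ip_nonneg[of p "\<lambda>s. v $ s"] by (simp add: mult_le_0_iff)
    hence "v $ s = 0" if "s < p" for s using that by (simp add: ip_def sum_nonneg_eq_0_iff)
    hence "v = 0\<^sub>v p" using v(1) by (intro eq_vecI) auto
    thus False using v(2) by simp
  qed
  hence "?V \<in> Units (ring_mat TYPE(real) p ())" by (rule det_non_zero_imp_unit[OF Vn_carrier])
  then obtain B where B: "mat_inverse ?V = Some B"
    using mat_inverse(1)[OF Vn_carrier, where b="()"] by (cases "mat_inverse ?V") auto
  show "mat_inv ?V \<in> carrier_mat p p" "?V * mat_inv ?V = 1\<^sub>m p" "mat_inv ?V * ?V = 1\<^sub>m p"
    using mat_inverse(2)[OF Vn_carrier B] by (simp_all add: mat_inv_def B)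
qed

lemma VW: "r < p \<Longrightarrow> s < p \<Longrightarrow> (\<Sum>u<p. V r u * W u s) = (if r = s then 1 else 0)"
  using arg_cong[OF W_inverse(2), of "\<lambda>A. A $$ (r, s)"] W_inverse(1) Vn_carrier
  by (simp add: scalar_prod_def V_def W_def lessThan_atLeast0)

lemma WV: "r < p \<Longrightarrow> s < p \<Longrightarrow> (\<Sum>u<p. W r u * V u s) = (if r = s then 1 else 0)"
  using arg_cong[OF W_inverse(3), of "\<lambda>A. A $$ (r, s)"] W_inverse(1) Vn_carrier
  by (simp add: scalar_prod_def V_def W_def lessThan_atLeast0)

lemma W_sym: assumes rs: "r < p" "s < p" shows "W r s = W s r"
proof -
  have "W r s = (\<Sum>u<p. if u = s then W r u else 0)" using rs by simp
  also have "\<dots> = (\<Sum>u<p. W r u * (\<Sum>v<p. V u v * W s v))"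
  proof (rule sum.cong[OF refl])
    fix u assume u: "u \<in> {..<p}"
    have "(if u = s then 1 else 0) = (\<Sum>v<p. W s v * V v u)" using u rs by (simp add: WV)
    also have "\<dots> = (\<Sum>v<p. V u v * W s v)" using u by (intro sum.cong refl) (simp add: V_sym)
    finally have "(\<Sum>v<p. V u v * W s v) = (if u = s then 1 else 0)" by simp
    thus "(if u = s then W r u else 0) = W r u * (\<Sum>v<p. V u v * W s v)" by simp
  qed
  also have "\<dots> = (\<Sum>u<p. \<Sum>v<p. W r u * V u v * W s v)" by (simp add: sum_distrib_left mult.assoc)
  also have "\<dots> = (\<Sum>v<p. \<Sum>u<p. W r u * V u v * W s v)" by (rule sum.swap)
  also have "\<dots> = (\<Sum>v<p. (\<Sum>u<p. W r u * V u v) * W s v)" by (simp add: sum_distrib_right)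
  also have "\<dots> = (\<Sum>v<p. (if r = v then 1 else 0) * W s v)" using rs by (intro sum.cong refl) (simp add: WV)
  also have "\<dots> = (\<Sum>v<p. if v = r then W s v else 0)" by (intro sum.cong refl) auto
  also have "\<dots> = W s r" using rs by simp
  finally show ?thesis .
qed

lemma V_times_W: "r < p \<Longrightarrow> (\<Sum>s<p. V r s * ip p (W s) y) = y r"
proof -
  assume r: "r < p"
  have "(\<Sum>s<p. V r s * ip p (W s) y) = (\<Sum>s<p. \<Sum>u<p. V r s * W s u * y u)"
    by (simp add: ip_def sum_distrib_left mult.assoc)
  also have "\<dots> = (\<Sum>u<p. \<Sum>s<p. V r s * W s u * y u)" by (rule sum.swap)
  also have "\<dots> = (\<Sum>u<p. (\<Sum>s<p. V r s * W s u) * y u)" by (simp add: sum_distrib_right)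
  also have "\<dots> = (\<Sum>u<p. if u = r then y u else 0)" using r by (intro sum.cong refl) (auto simp: VW)
  finally show ?thesis using r by simp
qed

lemma W_selfadjoint: "ip p u (\<lambda>r. ip p (W r) v) = ip p (\<lambda>r. ip p (W r) u) v"
proof -
  have "ip p u (\<lambda>r. ip p (W r) v) = (\<Sum>r<p. \<Sum>s<p. u r * (W r s * v s))"
    by (simp add: ip_def sum_distrib_left)
  also have "\<dots> = (\<Sum>s<p. \<Sum>r<p. u r * (W r s * v s))" by (rule sum.swap)
  also have "\<dots> = ip p (\<lambda>r. ip p (W r) u) v"
    unfolding ip_def sum_distrib_right
    by (intro sum.cong refl) (simp add: W_sym mult_ac)
  finally show ?thesis .
qed

lemma a_commute: "a i j = a j i"
  unfolding a_def W_selfadjoint[of "x i"] by (simp add: ip_def mult.commute)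

lemma V_form: "(\<Sum>l\<in>{1..n}. s2 * (c l)^2 * ip p u (x l) * ip p v (x l)) = n * (\<Sum>r<p. \<Sum>s<p. u r * V r s * v s)"
proof -
  have "(\<Sum>l\<in>{1..n}. s2 * (c l)^2 * ip p u (x l) * ip p v (x l)) = (\<Sum>l\<in>{1..n}. \<Sum>r<p. \<Sum>s<p. u r * (s2 * (c l)^2 * x l r * x l s) * v s)"
    unfolding ip_def by (simp add: sum_product sum_distrib_left sum_distrib_right mult_ac)
  also have "\<dots> = (\<Sum>r<p. \<Sum>l\<in>{1..n}. \<Sum>s<p. u r * (s2 * (c l)^2 * x l r * x l s) * v s)" by (rule sum.swap)
  also have "\<dots> = (\<Sum>r<p. \<Sum>s<p. \<Sum>l\<in>{1..n}. u r * (s2 * (c l)^2 * x l r * x l s) * v s)"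
    by (intro sum.cong refl sum.swap)
  also have "\<dots> = (\<Sum>r<p. \<Sum>s<p. n * (u r * V r s * v s))"
    using n_pos by (intro sum.cong refl) (simp add: V_entry sum_distrib_left sum_distrib_right sum_divide_distrib mult_ac)
  finally show ?thesis by (simp add: sum_distrib_left)
qed

lemma P_sym: "P i j = P j i" unfolding P_def a_commute[of i] by (simp add: mult_ac)

text \<open>
  Summation over \<open>l\<close> produces \<open>V\<close> between two copies of \<open>W\<close>.
\<close>

lemma P_idem: "(\<Sum>l\<in>{1..n}. P i l * P l j) = P i j"
proof -
  let ?u = "\<lambda>r. ip p (W r) (x i)" and ?v = "\<lambda>r. ip p (W r) (x j)"
  have "(\<Sum>l\<in>{1..n}. P i l * P l j) = s2 * c i * c j / n^2 * (\<Sum>l\<in>{1..n}. s2 * (c l)^2 * a i l * a l j)"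
    unfolding P_def sum_distrib_left by (intro sum.cong refl) (simp add: power2_eq_square)
  also have "(\<Sum>l\<in>{1..n}. s2 * (c l)^2 * a i l * a l j) = (\<Sum>l\<in>{1..n}. s2 * (c l)^2 * ip p ?u (x l) * ip p ?v (x l))"
    by (intro sum.cong refl) (simp add: a_def W_selfadjoint[of "x i"], simp add: ip_def mult_ac)
  also have "\<dots> = n * (\<Sum>r<p. \<Sum>s<p. ?u r * V r s * ?v s)" by (rule V_form)
  also have "(\<Sum>r<p. \<Sum>s<p. ?u r * V r s * ?v s) = (\<Sum>r<p. ?u r * (\<Sum>s<p. V r s * ?v s))"
    by (simp add: sum_distrib_left mult.assoc)
  also have "\<dots> = (\<Sum>r<p. ?u r * x j r)" by (intro sum.cong refl) (simp add: V_times_W)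
  also have "\<dots> = a i j" unfolding a_def W_selfadjoint[of "x i"] by (simp add: ip_def)
  finally show ?thesis unfolding P_def using n_pos by (simp add: power2_eq_square)
qed

text \<open>
  Summing the diagonal turns \<open>P\<close> into the trace of \<open>W V\<close>, the identity matrix of size \<open>p\<close>.
\<close>

lemma P_trace: "(\<Sum>i\<in>{1..n}. P i i) = p"
proof -
  have "(\<Sum>i\<in>{1..n}. P i i) = (\<Sum>i\<in>{1..n}. \<Sum>r<p. \<Sum>s<p. W r s * (s2 * (c i)^2 * x i r * x i s / n))"
    unfolding P_def a_def ip_def
    by (intro sum.cong refl) (simp add: sum_distrib_left sum_divide_distrib power2_eq_square mult_ac)
  also have "\<dots> = (\<Sum>r<p. \<Sum>i\<in>{1..n}. \<Sum>s<p. W r s * (s2 * (c i)^2 * x i r * x i s / n))" by (rule sum.swap)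
  also have "\<dots> = (\<Sum>r<p. \<Sum>s<p. \<Sum>i\<in>{1..n}. W r s * (s2 * (c i)^2 * x i r * x i s / n))"
    by (intro sum.cong refl sum.swap)
  also have "\<dots> = (\<Sum>r<p. \<Sum>s<p. W r s * V s r)"
  proof (intro sum.cong refl)
    fix r s assume "r \<in> {..<p}" "s \<in> {..<p}"
    hence "V s r = (\<Sum>i\<in>{1..n}. s2 * (c i)^2 * x i r * x i s / n)" by (simp add: V_entry sum_divide_distrib mult_ac)
    thus "(\<Sum>i\<in>{1..n}. W r s * (s2 * (c i)^2 * x i r * x i s / n)) = W r s * V s r" by (simp add: sum_distrib_left)
  qed
  also have "\<dots> = (\<Sum>r<p. 1)" by (intro sum.cong refl) (simp add: WV)
  finally show ?thesis by simp
qed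

lemma W_form_low: "C0 * ip p (\<lambda>r. ip p (W r) v) (\<lambda>r. ip p (W r) v) \<le> ip p v (\<lambda>r. ip p (W r) v)"
proof -
  let ?u = "\<lambda>r. ip p (W r) v"
  have "C0 * ip p ?u ?u \<le> (\<Sum>r<p. \<Sum>s<p. ?u r * V r s * ?u s)" by (rule V_low)
  also have "\<dots> = (\<Sum>r<p. ?u r * (\<Sum>s<p. V r s * ?u s))" by (simp add: sum_distrib_left mult.assoc)
  also have "\<dots> = (\<Sum>r<p. ?u r * v r)" by (intro sum.cong refl) (simp add: V_times_W)
  finally show ?thesis by (simp add: ip_def mult.commute)
qed

text \<open>
  With \<open>u = W x\<close> one has \<open>C0 \<bar>u\<bar>\<^sup>2 \<le> x\<^sup>t u\<close>; together with \<open>(x\<^sup>t u)\<^sup>2 \<le> \<bar>x\<bar>\<^sup>2 \<bar>u\<bar>\<^sup>2\<close> this bounds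
  \<open>x\<^sup>t W x\<close> without any spectral theory for \<open>W\<close>.
\<close>

lemma a_diag_bounds: "0 \<le> a i i" "a i i \<le> ip p (x i) (x i) / C0"
proof -
  let ?u = "\<lambda>r. ip p (W r) (x i)"
  have low: "C0 * ip p ?u ?u \<le> a i i" unfolding a_def by (rule W_form_low)
  thus a0: "0 \<le> a i i" using C0 ip_nonneg[of p ?u] by (meson mult_nonneg_nonneg order_trans less_imp_le)
  have "(a i i)^2 \<le> ip p (x i) (x i) * ip p ?u ?u" unfolding a_def by (rule ip_Cauchy_Schwarz)
  also have "\<dots> \<le> ip p (x i) (x i) * (a i i / C0)"
    using low C0 by (intro mult_left_mono ip_nonneg) (simp add: field_simps)
  finally have le: "a i i * a i i \<le> ip p (x i) (x i) / C0 * a i i" by (simp add: power2_eq_square mult_ac)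
  show "a i i \<le> ip p (x i) (x i) / C0"
  proof (cases "a i i = 0")
    case True thus ?thesis using C0 ip_nonneg by simp
  next
    case False
    hence "a i i > 0" using a0 by simp
    thus ?thesis using le by (rule mult_right_le_imp_le[rotated])
  qed
qed

lemma P_diag_le:
  assumes "\<bar>c i\<bar> \<le> Kc" "ip p (x i) (x i) \<le> Kx"
  shows "P i i \<le> s2 * Kc^2 * (Kx / C0) / n"
proof -
  have "(c i)^2 \<le> Kc^2" using assms(1) by (metis abs_ge_zero power2_abs power_mono)
  moreover have "a i i \<le> Kx / C0" using a_diag_bounds(2)[of i] assms(2) C0 by (meson divide_right_mono less_imp_le order_trans)
  ultimately have "s2 * (c i)^2 * a i i \<le> s2 * Kc^2 * (Kx / C0)"
    using s2 a_diag_bounds(1) by (intro mult_mono) auto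
  hence "s2 * (c i)^2 * a i i / n \<le> s2 * Kc^2 * (Kx / C0) / n" by (rule divide_right_mono) simp
  thus ?thesis unfolding P_def by (simp only: power2_eq_square mult.assoc)
qed

text \<open>
  The signed observations at an outcome \<open>e\<close> of the errors, their mean, which is \<open>psi\<close>, and the
  point \<open>W psi\<close> about which the log-likelihood ratio is expanded.
\<close>

definition m :: "(nat \<Rightarrow> real) \<Rightarrow> nat \<Rightarrow> nat \<Rightarrow> real" where "m e i s = c i * (e i * x i s)"
definition mbar :: "(nat \<Rightarrow> real) \<Rightarrow> nat \<Rightarrow> real" where "mbar e s = (\<Sum>i\<in>{1..n}. m e i s) / n"
definition l0 :: "(nat \<Rightarrow> real) \<Rightarrow> nat \<Rightarrow> real" where "l0 e s = ip p (W s) (mbar e)"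

lemma psi_entry: "s < p \<Longrightarrow> psi n k p (z0vec X e) $ s = mbar e s"
proof -
  assume s: "s < p"
  let ?\<theta> = "real k / real n"
  have z: "z0vec X e i $ s = e i * x i s" if "i \<in> {1..n}" for i
    using X[OF that] s by (simp add: z0vec_def x_def)
  have "psi n k p (z0vec X e) $ s = 1 / (real n * ?\<theta>) * (\<Sum>i=1..k. z0vec X e i $ s) - 1 / (real n * (1 - ?\<theta>)) * (\<Sum>i=k+1..n. z0vec X e i $ s)"
    unfolding psi_def Let_def using s by simp
  also have "1 / (real n * ?\<theta>) * (\<Sum>i=1..k. z0vec X e i $ s) = (\<Sum>i=1..k. m e i s) / n"
    unfolding sum_distrib_left sum_divide_distrib
    by (rule sum.cong[OF refl]) (use z k weight_theta in \<open>simp add: m_def\<close>)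
  also have "1 / (real n * (1 - ?\<theta>)) * (\<Sum>i=k+1..n. z0vec X e i $ s) = - ((\<Sum>i=k+1..n. m e i s) / n)"
    unfolding sum_distrib_left sum_divide_distrib sum_negf[symmetric]
    by (rule sum.cong[OF refl]) (use z k weight_theta in \<open>simp add: m_def\<close>)
  finally show ?thesis unfolding mbar_def sum_split by (simp add: add_divide_distrib)
qed

lemma V_times_l0: "r < p \<Longrightarrow> real n * (\<Sum>s<p. V r s * l0 e s) = (\<Sum>i\<in>{1..n}. m e i r)"
  unfolding l0_def V_times_W mbar_def using n_pos by simp

lemma ip_m: "ip p (m e i) (m e i) = (c i)^2 * (e i)^2 * ip p (x i) (x i)"
  by (simp add: ip_def m_def sum_distrib_left power2_eq_square mult_ac)

text \<open>
  The arguments of the logarithms at \<open>l0\<close> are one plus the summands \<open>\<eta> i L i\<close> of the quadratic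
  form. This links the expansion of the likelihood to the moments of the projection.
\<close>

lemma ip_l0_m:
  assumes \<sigma>: "\<sigma>^2 = s2"
  shows "ip p (l0 e) (m e i) = e i / \<sigma> * (\<Sum>l\<in>{1..n}. P i l * (e l / \<sigma>))"
proof -
  have \<sigma>0: "\<sigma> \<noteq> 0" using \<sigma> s2 by auto
  have "ip p (l0 e) (m e i) = c i * e i * ip p (x i) (\<lambda>r. ip p (W r) (mbar e))"
    by (simp add: ip_def[of p "l0 e"] ip_def[of p "x i"] m_def l0_def sum_distrib_left mult_ac)
  also have "ip p (x i) (\<lambda>r. ip p (W r) (mbar e)) = ip p (\<lambda>r. ip p (W r) (x i)) (mbar e)"
    by (rule W_selfadjoint)
  also have "\<dots> = (\<Sum>l\<in>{1..n}. c l * e l * ip p (\<lambda>r. ip p (W r) (x i)) (x l)) / n"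
  proof -
    have "ip p u (mbar e) = (\<Sum>l\<in>{1..n}. c l * e l * ip p u (x l)) / n" for u
    proof -
      have "ip p u (mbar e) = (\<Sum>s<p. \<Sum>l\<in>{1..n}. c l * e l * (u s * x l s)) / n"
        by (simp add: ip_def mbar_def m_def sum_distrib_left sum_divide_distrib mult_ac)
      also have "(\<Sum>s<p. \<Sum>l\<in>{1..n}. c l * e l * (u s * x l s)) = (\<Sum>l\<in>{1..n}. \<Sum>s<p. c l * e l * (u s * x l s))"
        by (rule sum.swap)
      finally show ?thesis by (simp add: ip_def sum_distrib_left)
    qed
    thus ?thesis .
  qed
  also have "(\<Sum>l\<in>{1..n}. c l * e l * ip p (\<lambda>r. ip p (W r) (x i)) (x l)) = (\<Sum>l\<in>{1..n}. c l * e l * a i l)"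
    by (simp add: a_def W_selfadjoint[of "x i"])
  finally have eq: "ip p (l0 e) (m e i) = c i * e i * ((\<Sum>l\<in>{1..n}. c l * e l * a i l) / n)" .
  have "e i / \<sigma> * (P i l * (e l / \<sigma>)) = c i * e i * (c l * e l * a i l / n)" for l
  proof -
    have "e i / \<sigma> * (P i l * (e l / \<sigma>)) = e i * e l * P i l / (\<sigma> * \<sigma>)" by simp
    also have "\<dots> = e i * e l * P i l / s2" unfolding \<sigma>[unfolded power2_eq_square] ..
    also have "\<dots> = c i * e i * (c l * e l * a i l / n)" unfolding P_def using s2 by simp
    finally show ?thesis .
  qed
  hence "e i / \<sigma> * (\<Sum>l\<in>{1..n}. P i l * (e l / \<sigma>)) = (\<Sum>l\<in>{1..n}. c i * e i * (c l * e l * a i l / n))"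
    unfolding sum_distrib_left by (intro sum.cong refl)
  also have "\<dots> = c i * e i * ((\<Sum>l\<in>{1..n}. c l * e l * a i l) / n)"
    unfolding sum_divide_distrib sum_distrib_left ..
  finally show ?thesis unfolding eq ..
qed

lemma psi_quadratic_form_eq:
  assumes \<sigma>: "\<sigma>^2 = s2"
  shows "real n * (psi n k p (z0vec X e) \<bullet> (mat_inv (Vn n k p s2 X) *\<^sub>v psi n k p (z0vec X e)))
     = (\<Sum>i\<in>{1..n}. \<Sum>l\<in>{1..n}. P i l * (e i / \<sigma>) * (e l / \<sigma>))"
proof -
  let ?\<psi> = "psi n k p (z0vec X e)"
  have dim: "dim_vec ?\<psi> = p" by (simp add: psi_def Let_def)
  have l0: "(mat_inv (Vn n k p s2 X) *\<^sub>v ?\<psi>) $ s = l0 e s" if s: "s < p" for s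
    using W_inverse(1) s dim psi_entry[of _ e]
    by (simp add: scalar_prod_def lessThan_atLeast0[symmetric] l0_def ip_def W_def)
  have "?\<psi> \<bullet> (mat_inv (Vn n k p s2 X) *\<^sub>v ?\<psi>) = (\<Sum>s<p. mbar e s * l0 e s)"
    using W_inverse(1) unfolding scalar_prod_def
    by (auto simp: lessThan_atLeast0[symmetric] psi_entry l0 simp del: index_mult_mat_vec intro!: sum.cong)
  hence "real n * (?\<psi> \<bullet> (mat_inv (Vn n k p s2 X) *\<^sub>v ?\<psi>)) = (\<Sum>s<p. (\<Sum>i\<in>{1..n}. m e i s) * l0 e s)"
    using n_pos by (simp add: mbar_def sum_distrib_left)
  also have "\<dots> = (\<Sum>s<p. \<Sum>i\<in>{1..n}. l0 e s * m e i s)" unfolding sum_distrib_right by (simp add: mult.commute)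
  also have "\<dots> = (\<Sum>i\<in>{1..n}. ip p (l0 e) (m e i))" unfolding ip_def by (rule sum.swap)
  also have "\<dots> = (\<Sum>i\<in>{1..n}. \<Sum>l\<in>{1..n}. P i l * (e i / \<sigma>) * (e l / \<sigma>))"
    unfolding ip_l0_m[OF \<sigma>] sum_distrib_left by (intro sum.cong refl) (simp add: mult_ac)
  finally show ?thesis .
qed

end

section \<open>The normalizing variance\<close>

lemma symmetric_double_sum:
  fixes f :: "nat \<Rightarrow> nat \<Rightarrow> real"
  assumes "\<And>i l. f i l = f l i"
  shows "(\<Sum>i=1..n. \<Sum>l=1..n. f i l) = 2 * (\<Sum>i=1..n. \<Sum>l=1..i-1. f i l) + (\<Sum>i=1..n. f i i)"
proof (induction n)
  case (Suc n)
  have "(\<Sum>i=1..Suc n. \<Sum>l=1..Suc n. f i l) = (\<Sum>i=1..n. \<Sum>l=1..n. f i l) + (\<Sum>i=1..n. f i (Suc n)) + (\<Sum>l=1..n. f (Suc n) l) + f (Suc n) (Suc n)"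
    by (simp add: sum.distrib)
  also have "(\<Sum>i=1..n. f i (Suc n)) = (\<Sum>l=1..n. f (Suc n) l)" using assms by (intro sum.cong) auto
  finally show ?case using Suc by simp
qed simp

context two_phase_design
begin

lemma Vi_carrier: "i \<in> {1..n} \<Longrightarrow> Vi s2 X i \<in> carrier_mat p p"
  using X[of i] by (simp add: Vi_def outer_def)

lemma W_Vi_entry:
  assumes i: "i \<in> {1..n}" and rs: "r < p" "s < p"
  shows "(mat_inv (Vn n k p s2 X) * Vi s2 X i) $$ (r, s) = s2 * (ip p (W r) (x i) * x i s)"
proof -
  have "(mat_inv (Vn n k p s2 X) * Vi s2 X i) $$ (r, s) = (\<Sum>u<p. W r u * Vi s2 X i $$ (u, s))"
    using rs W_inverse(1) Vi_carrier[OF i] by (simp add: scalar_prod_def W_def lessThan_atLeast0)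
  also have "\<dots> = (\<Sum>u<p. s2 * (W r u * x i u * x i s))"
    using rs i by (intro sum.cong refl) (simp add: Vi_entry)
  finally show ?thesis by (simp add: ip_def sum_distrib_left sum_distrib_right mult_ac)
qed

lemma trace_W_Vi: "i \<in> {1..n} \<Longrightarrow> mat_trace (mat_inv (Vn n k p s2 X) * Vi s2 X i) = s2 * a i i"
proof -
  assume i: "i \<in> {1..n}"
  have "mat_trace (mat_inv (Vn n k p s2 X) * Vi s2 X i) = (\<Sum>s<p. s2 * (ip p (W s) (x i) * x i s))"
    unfolding mat_trace_def using W_inverse(1) i by (simp add: W_Vi_entry)
  also have "\<dots> = s2 * ip p (\<lambda>r. ip p (W r) (x i)) (x i)" by (simp add: ip_def[of p _ "x i"] sum_distrib_left)
  finally show ?thesis unfolding a_def W_selfadjoint[of "x i"] .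
qed

lemma trace_W_Vi_W_Vl:
  assumes i: "i \<in> {1..n}" and l: "l \<in> {1..n}"
  shows "mat_trace (mat_inv (Vn n k p s2 X) * Vi s2 X i * mat_inv (Vn n k p s2 X) * Vi s2 X l) = s2^2 * (a i l)^2"
proof -
  let ?W = "mat_inv (Vn n k p s2 X)"
  have "?W * Vi s2 X i * ?W * Vi s2 X l = (?W * Vi s2 X i) * (?W * Vi s2 X l)"
    using W_inverse(1) Vi_carrier[OF i] Vi_carrier[OF l]
    by (intro assoc_mult_mat[of _ p p _ p _ p]) auto
  moreover have "mat_trace ((?W * Vi s2 X i) * (?W * Vi s2 X l)) = (\<Sum>s<p. \<Sum>u<p. (?W * Vi s2 X i) $$ (s, u) * (?W * Vi s2 X l) $$ (u, s))"
    unfolding mat_trace_def using W_inverse(1) Vi_carrier[OF i] Vi_carrier[OF l]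
    by (auto intro!: sum.cong simp: scalar_prod_def lessThan_atLeast0 simp del: assoc_mult_mat)
  moreover have "\<dots> = (\<Sum>s<p. \<Sum>u<p. s2^2 * ((x i u * ip p (W u) (x l)) * (ip p (W s) (x i) * x l s)))"
  proof (intro sum.cong refl)
    fix s u assume "s \<in> {..<p}" "u \<in> {..<p}"
    hence "(?W * Vi s2 X i) $$ (s, u) = s2 * (ip p (W s) (x i) * x i u)"
      "(?W * Vi s2 X l) $$ (u, s) = s2 * (ip p (W u) (x l) * x l s)"
      by (auto intro: W_Vi_entry i l)
    thus "(?W * Vi s2 X i) $$ (s, u) * (?W * Vi s2 X l) $$ (u, s)
        = s2^2 * ((x i u * ip p (W u) (x l)) * (ip p (W s) (x i) * x l s))"
      by (simp add: power2_eq_square)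
  qed
  moreover have "\<dots> = s2^2 * (ip p (x i) (\<lambda>r. ip p (W r) (x l)) * ip p (\<lambda>r. ip p (W r) (x i)) (x l))"
  proof -
    have "(\<Sum>s<p. \<Sum>u<p. K * (f u * g s)) = K * ((\<Sum>u<p. f u) * (\<Sum>s<p. g s))" for K and f g :: "nat \<Rightarrow> real"
      unfolding sum_product unfolding sum_distrib_left by (rule sum.swap)
    thus ?thesis by (simp only: ip_def[of p "x i" "\<lambda>r. ip p (W r) (x l)"] ip_def[of p "\<lambda>r. ip p (W r) (x i)" "x l"])
  qed
  ultimately show ?thesis
    by (simp add: a_def W_selfadjoint[of "x i", symmetric] power2_eq_square)
qed

lemma leverage_as_quadratic_form: "i \<in> {1..n} \<Longrightarrow> X i \<bullet> (mat_inv (Vn n k p s2 X) *\<^sub>v X i) = a i i"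
  using X[of i] W_inverse(1)
  by (auto simp: scalar_prod_def lessThan_atLeast0[symmetric] a_def ip_def W_def x_def intro!: sum.cong)

text \<open>
  In terms of \<open>P\<close> all three cases of \<open>sigma_sq\<close> become one, with an exception at \<open>i = k + 1\<close>.
  That observation belongs to the second group, but \<open>sigma_sq\<close> gives it the weight \<open>\<theta>\<^sup>-\<^sup>4\<close> of
  the first group; \<open>g\<close> is the ratio \<open>(1-\<theta>)\<^sup>2/\<theta>\<^sup>2\<close> of the squared weights of the groups.
\<close>

lemma sigma_sq_eq:
  assumes i: "i \<in> {1..n}"
  defines "g \<equiv> if i = k + 1 then ((1 - real k / n) / (real k / n))^2 else 1"
  shows "sigma_sq n k p s2 m4 X i = real n^2 * (4 * g * (\<Sum>l=1..i-1. (P i l)^2) + g^2 * (m4 / s2^2 - 1) * (P i i)^2)"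
proof -
  let ?\<theta> = "real k / real n"
  have \<theta>: "?\<theta> > 0" "1 - ?\<theta> > 0" using k by auto
  define D where "D = (a i i)^2 * (m4 - s2^2)"
  define Tr where "Tr l = s2^2 * (a i l)^2" for l
  have P2: "real n^2 * (P i l)^2 = (c i)^2 * (c l)^2 * Tr l" for l
    unfolding P_def Tr_def using n_pos by (simp add: power_divide power_mult_distrib mult_ac)
  have PD: "real n^2 * ((m4 / s2^2 - 1) * (P i i)^2) = (c i)^4 * D"
  proof -
    have "real n^2 * ((m4 / s2^2 - 1) * (P i i)^2) = (m4 / s2^2 - 1) * (real n^2 * (P i i)^2)" by simp
    also have "\<dots> = (m4 / s2^2 - 1) * ((c i)^2 * (c i)^2 * Tr i)" unfolding P2 ..
    also have "\<dots> = (c i)^4 * ((m4 / s2^2 - 1) * s2^2 * (a i i)^2)" by (simp add: Tr_def power4_eq_xxxx power2_eq_square)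
    also have "(m4 / s2^2 - 1) * s2^2 = m4 - s2^2" using s2 by (simp add: field_simps)
    finally show ?thesis by (simp add: D_def)
  qed
  have c1: "(c l)^2 = 1 / ?\<theta>^2" if "l \<le> k" for l using weight_theta(1)[OF that] by (simp add: power_divide)
  have c2: "(c l)^2 = 1 / (1 - ?\<theta>)^2" if "k < l" for l using weight_theta(2)[OF that] by (simp add: power_divide)
  have c4: "(c i)^4 = (c i)^2 * (c i)^2" by (simp add: power4_eq_xxxx power2_eq_square)
  have rhs: "real n^2 * (4 * g * (\<Sum>l=1..i-1. (P i l)^2) + g^2 * (m4 / s2^2 - 1) * (P i i)^2)
      = 4 * g * (c i)^2 * (\<Sum>l=1..i-1. (c l)^2 * Tr l) + g^2 * (c i)^4 * D"
  proof -
    have "real n^2 * (\<Sum>l=1..i-1. (P i l)^2) = (c i)^2 * (\<Sum>l=1..i-1. (c l)^2 * Tr l)"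
      unfolding sum_distrib_left P2 by (simp add: mult.assoc)
    moreover have "real n^2 * (4 * g * S + g^2 * K * Q) = 4 * g * (real n^2 * S) + g^2 * (real n^2 * (K * Q))" for S K Q
      by (simp add: algebra_simps)
    ultimately show ?thesis using PD by (simp only: mult.assoc)
  qed
  have tr: "(\<Sum>l\<in>S. mat_trace (mat_inv (Vn n k p s2 X) * Vi s2 X i * mat_inv (Vn n k p s2 X) * Vi s2 X l)) = (\<Sum>l\<in>S. Tr l)"
    if "S \<subseteq> {1..n}" for S
    using that trace_W_Vi_W_Vl[OF i] by (intro sum.cong) (auto simp: Tr_def)
  have Dm: "(X i \<bullet> (mat_inv (Vn n k p s2 X) *\<^sub>v X i))^2 * m4 - (mat_trace (mat_inv (Vn n k p s2 X) * Vi s2 X i))^2 = D"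
    unfolding leverage_as_quadratic_form[OF i] trace_W_Vi[OF i] D_def by (simp add: algebra_simps power_mult_distrib)
  have sub1: "{1..i-1} \<subseteq> {1..n}" and sub2: "{1..k} \<subseteq> {1..n}" and sub3: "{k+1..i-1} \<subseteq> {1..n}"
    using i k by auto
  consider "i = 1" | "1 < i" "i \<le> k" | "i = k + 1" | "k + 1 < i" using i by force
  thus ?thesis
  proof cases
    case 1
    hence g: "g = 1" and ik: "i \<le> k" using k by (auto simp: g_def)
    moreover have "sigma_sq n k p s2 m4 X i = D / ?\<theta>^4" unfolding sigma_sq_def Let_def Dm using 1 by simp
    ultimately show ?thesis unfolding rhs unfolding c4 c1[OF ik] g using 1 by (simp add: power4_eq_xxxx power2_eq_square mult_ac)
  next
    case 2
    have g: "g = 1" using 2 by (simp add: g_def)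
    have "sigma_sq n k p s2 m4 X i = 4 / ?\<theta>^4 * (\<Sum>l=1..i-1. Tr l) + D / ?\<theta>^4"
      unfolding sigma_sq_def Let_def Dm tr[OF sub1] using 2 by simp
    moreover have "(\<Sum>l=1..i-1. (c l)^2 * Tr l) = 1 / ?\<theta>^2 * (\<Sum>l=1..i-1. Tr l)"
      unfolding sum_distrib_left using 2 by (intro sum.cong refl) (subst c1; auto)
    ultimately show ?thesis unfolding rhs unfolding c4 g c1[OF 2(2)] by (simp add: power4_eq_xxxx power2_eq_square mult_ac)
  next
    case 3
    have g: "g = ((1 - ?\<theta>) / ?\<theta>)^2" using 3 by (simp add: g_def)
    have "sigma_sq n k p s2 m4 X i = 4 / ?\<theta>^4 * (\<Sum>l=1..i-1. Tr l) + D / ?\<theta>^4"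
      unfolding sigma_sq_def Let_def Dm tr[OF sub1] using 3 k by simp
    moreover have "(\<Sum>l=1..i-1. (c l)^2 * Tr l) = 1 / ?\<theta>^2 * (\<Sum>l=1..i-1. Tr l)"
      unfolding sum_distrib_left using 3 by (intro sum.cong refl) (subst c1; auto)
    moreover have "g * (c i)^2 = 1 / ?\<theta>^2"
    proof -
      have ci: "(c i)^2 = 1 / (1 - ?\<theta>)^2" using c2[of i] 3 by simp
      have "((1 - t) / t)^2 * (1 / (1 - t)^2) = 1 / t^2" if "0 < t" "0 < 1 - t" for t :: real
        using that by (simp add: power_divide)
      from this[OF \<theta>] show ?thesis unfolding g ci .
    qed
    moreover have "real n^2 * (4 * g * (\<Sum>l=1..i-1. (P i l)^2) + g^2 * (m4 / s2^2 - 1) * (P i i)^2)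
        = 4 * (g * (c i)^2) * (\<Sum>l=1..i-1. (c l)^2 * Tr l) + (g * (c i)^2) * (g * (c i)^2) * D"
      unfolding rhs unfolding c4 by (simp add: power2_eq_square)
    ultimately show ?thesis by (simp add: power4_eq_xxxx power2_eq_square mult_ac)
  next
    case 4
    have g: "g = 1" using 4 by (simp add: g_def)
    have sig: "sigma_sq n k p s2 m4 X i = 4 / (?\<theta>^2 * (1 - ?\<theta>)^2) * (\<Sum>l=1..k. Tr l) + 4 / (1 - ?\<theta>)^4 * (\<Sum>l=k+1..i-1. Tr l) + D / (1 - ?\<theta>)^4"
      unfolding sigma_sq_def Let_def Dm tr[OF sub2] tr[OF sub3] using 4 k by simp
    have sm: "(\<Sum>l=1..i-1. (c l)^2 * Tr l) = 1 / ?\<theta>^2 * (\<Sum>l=1..k. Tr l) + 1 / (1 - ?\<theta>)^2 * (\<Sum>l=k+1..i-1. Tr l)"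
    proof -
      have "{1..i-1} = {1..k} \<union> {k+1..i-1}" using 4 by auto
      hence "(\<Sum>l=1..i-1. (c l)^2 * Tr l) = (\<Sum>l=1..k. (c l)^2 * Tr l) + (\<Sum>l=k+1..i-1. (c l)^2 * Tr l)"
        by (simp add: sum.union_disjoint[symmetric] ivl_disj_int)
      also have "(\<Sum>l=1..k. (c l)^2 * Tr l) = 1 / ?\<theta>^2 * (\<Sum>l=1..k. Tr l)"
        unfolding sum_distrib_left by (intro sum.cong refl) (simp add: c1)
      also have "(\<Sum>l=k+1..i-1. (c l)^2 * Tr l) = 1 / (1 - ?\<theta>)^2 * (\<Sum>l=k+1..i-1. Tr l)"
        unfolding sum_distrib_left by (intro sum.cong refl) (simp add: c2)
      finally show ?thesis .
    qed
    have ci: "(c i)^2 = 1 / (1 - ?\<theta>)^2" using c2 4 by simp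
    have "4 / (A * B) * S + 4 / B' * S' + D / B' = 4 * 1 * (1 / B) * (1 / A * S + 1 / B * S') + 1^2 * (1 / B * (1 / B)) * D"
      if "B' = B * B" for A B B' S S' :: real
      using that by (simp add: algebra_simps)
    from this[of "(1 - ?\<theta>)^4" "(1 - ?\<theta>)^2" "?\<theta>^2"] show ?thesis
      unfolding rhs sig unfolding c4 sm ci g by (simp add: power4_eq_xxxx power2_eq_square)
  qed
qed

text \<open>
  Without the exceptional index the sum is \<open>2 \<Sum>\<^sub>i\<^sub>l (P i l)\<^sup>2\<close> plus a multiple of \<open>\<Sum> (P i i)\<^sup>2\<close>.
  The first is twice the trace, that is \<open>2p\<close>; the second is at most \<open>\<rho>\<^sup>2 p\<close>. The exceptional
  index changes the sum by \<open>O(\<rho>\<^sup>2)\<close>, because row \<open>k + 1\<close> of \<open>P\<close> has squared length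
  \<open>P (k+1) (k+1)\<close>.
\<close>

lemma Delta_squared_approx:
  assumes \<rho>: "\<And>i. i \<in> {1..n} \<Longrightarrow> P i i \<le> \<rho>2" "\<rho>2 \<le> 1" and m4: "0 \<le> m4"
  defines "g \<equiv> ((1 - real k / n) / (real k / n))^2" and "\<kappa>4 \<equiv> m4 / s2^2"
  shows "\<bar>(\<Sum>i=1..n. sigma_sq n k p s2 m4 X i) / real n^2 - 2 * real p\<bar> \<le> \<rho>2 * p * ((3 + \<kappa>4) + 4 * (1 + g) + (1 + g^2) * (1 + \<kappa>4))"
proof -
  have h2: "P i i = (\<Sum>l=1..n. (P i l)^2)" for i
    using P_idem[of i i] P_sym by (simp add: power2_eq_square)
  have h0: "0 \<le> P i i" for i unfolding h2[of i] by (simp add: sum_nonneg)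
  have k41: "k + 1 \<in> {1..n}" using k by simp
  have \<rho>0: "0 \<le> \<rho>2" using h0 \<rho>(1)[OF k41] order_trans by blast
  have \<kappa>4: "0 \<le> \<kappa>4" using m4 by (simp add: \<kappa>4_def)
  have hsq: "(P i i)^2 \<le> \<rho>2 * P i i" if "i \<in> {1..n}" for i
    using \<rho>(1)[OF that] h0[of i] by (simp add: power2_eq_square mult_right_mono)
  define S where "S i = 4 * (\<Sum>l=1..i-1. (P i l)^2) + (\<kappa>4 - 1) * (P i i)^2" for i
  have main: "(\<Sum>i=1..n. S i) = 2 * real p + (\<kappa>4 - 3) * (\<Sum>i=1..n. (P i i)^2)"
  proof -
    have "(\<Sum>i=1..n. \<Sum>l=1..n. (P i l)^2) = p" unfolding h2[symmetric] by (rule P_trace)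
    hence "real p = 2 * (\<Sum>i=1..n. \<Sum>l=1..i-1. (P i l)^2) + (\<Sum>i=1..n. (P i i)^2)"
      using symmetric_double_sum[of "\<lambda>i l. (P i l)^2" n] P_sym by simp
    moreover have "(\<Sum>i=1..n. S i) = 4 * (\<Sum>i=1..n. \<Sum>l=1..i-1. (P i l)^2) + (\<kappa>4 - 1) * (\<Sum>i=1..n. (P i i)^2)"
      by (simp add: S_def sum.distrib sum_distrib_left)
    ultimately show ?thesis by (simp add: algebra_simps)
  qed
  have sumh: "(\<Sum>i=1..n. (P i i)^2) \<le> \<rho>2 * p" "0 \<le> (\<Sum>i=1..n. (P i i)^2)"
  proof -
    have "(\<Sum>i=1..n. (P i i)^2) \<le> (\<Sum>i=1..n. \<rho>2 * P i i)" using hsq by (intro sum_mono)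
    also have "\<dots> = \<rho>2 * p" using P_trace by (simp add: sum_distrib_left[symmetric])
    finally show "(\<Sum>i=1..n. (P i i)^2) \<le> \<rho>2 * p" .
  qed (simp add: sum_nonneg)
  have b1: "\<bar>(\<Sum>i=1..n. S i) - 2 * real p\<bar> \<le> (3 + \<kappa>4) * (\<rho>2 * p)"
  proof -
    have "\<bar>(\<kappa>4 - 3) * (\<Sum>i=1..n. (P i i)^2)\<bar> \<le> (3 + \<kappa>4) * (\<rho>2 * p)"
      unfolding abs_mult using sumh \<kappa>4 by (intro mult_mono) auto
    thus ?thesis using main by simp
  qed
  define j where "j = k + 1"
  have jn: "j \<in> {1..n}" using k41 by (simp add: j_def)
  \<comment> \<open>The excess of the exceptional term over the regular one.\<close>
  define e where "e = 4 * (g - 1) * (\<Sum>l=1..j-1. (P j l)^2) + (g^2 - 1) * (\<kappa>4 - 1) * (P j j)^2"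
  have sg: "sigma_sq n k p s2 m4 X i / real n^2 = S i + (if i = j then e else 0)" if "i \<in> {1..n}" for i
  proof -
    define gi where "gi = (if i = j then g else 1)"
    have "sigma_sq n k p s2 m4 X i = real n^2 * (4 * gi * (\<Sum>l=1..i-1. (P i l)^2) + gi^2 * (\<kappa>4 - 1) * (P i i)^2)"
      using sigma_sq_eq[OF that, of m4] unfolding gi_def j_def g_def \<kappa>4_def .
    hence eq: "sigma_sq n k p s2 m4 X i / real n^2 = 4 * gi * (\<Sum>l=1..i-1. (P i l)^2) + gi^2 * (\<kappa>4 - 1) * (P i i)^2"
      using n_pos by simp
    show ?thesis
    proof (cases "i = j")
      case True
      hence "gi = g" by (simp add: gi_def)
      thus ?thesis unfolding eq S_def e_def using True by (simp add: algebra_simps)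
    next
      case False
      hence "gi = 1" by (simp add: gi_def)
      thus ?thesis unfolding eq S_def using False by simp
    qed
  qed
  have "(\<Sum>i=1..n. sigma_sq n k p s2 m4 X i) / real n^2 = (\<Sum>i=1..n. S i + (if i = j then e else 0))"
    unfolding sum_divide_distrib using sg by (intro sum.cong) auto
  also have "\<dots> = (\<Sum>i=1..n. S i) + e" using jn by (simp add: sum.distrib)
  finally have tot: "(\<Sum>i=1..n. sigma_sq n k p s2 m4 X i) / real n^2 = (\<Sum>i=1..n. S i) + e" .
  have eb: "\<bar>e\<bar> \<le> (4 * (1 + g) + (1 + g^2) * (1 + \<kappa>4)) * \<rho>2"
  proof -
    have g0: "g \<ge> 0" by (simp add: g_def)
    have "(\<Sum>l=1..j-1. (P j l)^2) \<le> (\<Sum>l=1..n. (P j l)^2)" using jn by (intro sum_mono2) auto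
    hence s: "(\<Sum>l=1..j-1. (P j l)^2) \<le> \<rho>2" "0 \<le> (\<Sum>l=1..j-1. (P j l)^2)"
      using h2[of j] \<rho>(1)[OF jn] by (auto intro: sum_nonneg)
    have q: "(P j j)^2 \<le> \<rho>2" using hsq[OF jn] \<rho>(1)[OF jn] \<rho>(2) \<rho>0 h0[of j]
      by (meson mult_left_le order_trans)
    have "\<bar>4 * (g - 1) * (\<Sum>l=1..j-1. (P j l)^2)\<bar> \<le> 4 * (1 + g) * \<rho>2"
      unfolding abs_mult using s g0 by (intro mult_mono) auto
    moreover have "\<bar>(g^2 - 1) * (\<kappa>4 - 1) * (P j j)^2\<bar> \<le> (1 + g^2) * (1 + \<kappa>4) * \<rho>2"
    proof -
      have "\<bar>g^2 - 1\<bar> \<le> 1 + g^2" by (auto simp: abs_le_iff)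
      thus ?thesis unfolding abs_mult using q \<kappa>4 by (intro mult_mono) auto
    qed
    ultimately show ?thesis unfolding e_def by (simp add: algebra_simps)
  qed
  also have "\<dots> \<le> (4 * (1 + g) + (1 + g^2) * (1 + \<kappa>4)) * (\<rho>2 * p)"
  proof (rule mult_left_mono)
    show "\<rho>2 \<le> \<rho>2 * real p" using p \<rho>0 by (simp add: mult_le_cancel_left1)
    show "0 \<le> 4 * (1 + g) + (1 + g^2) * (1 + \<kappa>4)" using \<kappa>4 by (simp add: g_def)
  qed
  finally have eb': "\<bar>e\<bar> \<le> (4 * (1 + g) + (1 + g^2) * (1 + \<kappa>4)) * (\<rho>2 * p)" .
  have "\<bar>(\<Sum>i=1..n. S i) + e - 2 * real p\<bar> \<le> (3 + \<kappa>4) * (\<rho>2 * p) + (4 * (1 + g) + (1 + g^2) * (1 + \<kappa>4)) * (\<rho>2 * p)"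
    using b1 eb' by linarith
  thus ?thesis unfolding tot by (simp add: algebra_simps)
qed

end

section \<open>The likelihood statistic and the quadratic form are close\<close>

locale two_phase_sample = two_phase_design n k p s2 C0 X + standardized_errors M "{1..n}" \<eta> \<kappa>
  for n k p :: nat and s2 C0 :: real and X :: "nat \<Rightarrow> real Matrix.vec" and M :: "'a measure" and \<eta> \<kappa> +
  fixes \<sigma> Kc Kx \<rho> :: real
  assumes \<sigma>: "0 < \<sigma>" "\<sigma>^2 = s2"
    and Kc: "0 < Kc" "\<And>i. i \<in> {1..n} \<Longrightarrow> \<bar>c i\<bar> \<le> Kc"
    and Kx: "0 < Kx" "\<And>i. i \<in> {1..n} \<Longrightarrow> ip p (x i) (x i) \<le> Kx * p"
    and \<rho>2: "\<rho>^2 = s2 * Kc^2 * Kx / C0 * (p / n)" and \<rho>01: "0 < \<rho>" "\<rho> \<le> 1"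
begin

lemma P_diag_le_\<rho>2: "i \<in> {1..n} \<Longrightarrow> P i i \<le> \<rho>^2"
  using P_diag_le[OF Kc(2) Kx(2), of i] unfolding \<rho>2 by (simp add: mult_ac)

sublocale leverage_form M "{1..n}" \<eta> \<kappa> P \<rho>
  by unfold_locales (use P_sym P_idem P_diag_le_\<rho>2 \<rho>01 in auto)

lemma d_eq: "d = p" unfolding d_def by (rule P_trace)

definition err :: "'a \<Rightarrow> nat \<Rightarrow> real" where "err \<omega> i = \<sigma> * \<eta> i \<omega>"

lemma quadratic_statistic: "real n * (psi n k p (z0vec X (err \<omega>)) \<bullet> (mat_inv (Vn n k p s2 X) *\<^sub>v psi n k p (z0vec X (err \<omega>)))) = T \<omega>"
  unfolding psi_quadratic_form_eq[OF \<sigma>(2)] T_def using \<sigma>(1) by (simp add: err_def)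

lemma multiplier_products: "ip p (l0 (err \<omega>)) (m (err \<omega>) i) = \<eta> i \<omega> * L i \<omega>"
  unfolding ip_l0_m[OF \<sigma>(2)] L_def using \<sigma>(1) by (simp add: err_def)

lemma EL_via_el_log:
  shows "el_feasible p {1..n} (m (err \<omega>)) l \<Longrightarrow> (\<And>s. s < p \<Longrightarrow> el_grad p {1..n} (m (err \<omega>)) l s = 0)
      \<Longrightarrow> EL c0 n k p (z0vec X (err \<omega>)) = 2 * el_log p {1..n} (m (err \<omega>)) l"
    and "\<not> (\<exists>l. el_feasible p {1..n} (m (err \<omega>)) l \<and> (\<forall>s<p. el_grad p {1..n} (m (err \<omega>)) l s = 0))
      \<Longrightarrow> EL c0 n k p (z0vec X (err \<omega>)) = c0"
proof -
  have z: "z0vec X (err \<omega>) i \<in> carrier_vec p" if "i \<in> {1..n}" for i using X[OF that] by (simp add: z0vec_def)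
  define m' where "m' = (\<lambda>i s. group_weight n k i * z0vec X (err \<omega>) i $ s)"
  have mm: "m' i s = m (err \<omega>) i s" if "i \<in> {1..n}" "s < p" for i s
    using X[OF that(1)] that(2) by (simp add: m'_def m_def c_def x_def z0vec_def)
  have ipm: "ip p l (m' i) = ip p l (m (err \<omega>) i)" if "i \<in> {1..n}" for i l
    unfolding ip_def using mm that by (intro sum.cong) auto
  have eqs: "el_feasible p {1..n} m' l = el_feasible p {1..n} (m (err \<omega>)) l"
    "s < p \<Longrightarrow> el_grad p {1..n} m' l s = el_grad p {1..n} (m (err \<omega>)) l s"
    "el_log p {1..n} m' l = el_log p {1..n} (m (err \<omega>)) l" for l s
  proof -
    show "el_feasible p {1..n} m' l = el_feasible p {1..n} (m (err \<omega>)) l"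
      unfolding el_feasible_def using ipm by (intro ball_cong) auto
    show "el_log p {1..n} m' l = el_log p {1..n} (m (err \<omega>)) l"
      unfolding el_log_def using ipm by (intro sum.cong) auto
    show "s < p \<Longrightarrow> el_grad p {1..n} m' l s = el_grad p {1..n} (m (err \<omega>)) l s"
      unfolding el_grad_def using ipm mm by (intro sum.cong) auto
  qed
  {
    assume l: "el_feasible p {1..n} (m (err \<omega>)) l" "\<And>s. s < p \<Longrightarrow> el_grad p {1..n} (m (err \<omega>)) l s = 0"
    have "EL c0 n k p (z0vec X (err \<omega>)) = 2 * el_log p {1..n} m' l"
      unfolding m'_def
    proof (rule EL_eq_el_log(1)[OF k])
      show "\<And>i. i \<in> {1..n} \<Longrightarrow> z0vec X (err \<omega>) i \<in> carrier_vec p" by (rule z)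
      show "el_feasible p {1..n} (\<lambda>i s. group_weight n k i * z0vec X (err \<omega>) i $ s) l"
        unfolding m'_def[symmetric] eqs by (rule l(1))
      show "el_grad p {1..n} (\<lambda>i s. group_weight n k i * z0vec X (err \<omega>) i $ s) l s = 0" if "s < p" for s
        unfolding m'_def[symmetric] eqs(2)[OF that] by (rule l(2)[OF that])
    qed
    thus "EL c0 n k p (z0vec X (err \<omega>)) = 2 * el_log p {1..n} (m (err \<omega>)) l" unfolding eqs(3) .
  }
  assume none: "\<not> (\<exists>l. el_feasible p {1..n} (m (err \<omega>)) l \<and> (\<forall>s<p. el_grad p {1..n} (m (err \<omega>)) l s = 0))"
  show "EL c0 n k p (z0vec X (err \<omega>)) = c0"
  proof (rule EL_eq_el_log(2)[OF k])
    show "\<And>i. i \<in> {1..n} \<Longrightarrow> z0vec X (err \<omega>) i \<in> carrier_vec p" by (rule z)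
    show "\<not> (\<exists>l. el_feasible p {1..n} (\<lambda>i s. group_weight n k i * z0vec X (err \<omega>) i $ s) l \<and>
        (\<forall>s<p. el_grad p {1..n} (\<lambda>i s. group_weight n k i * z0vec X (err \<omega>) i $ s) l s = 0))"
      unfolding m'_def[symmetric] eqs(1) using none eqs(2) by auto
  qed
qed

lemma EL_measurable [measurable]: "(\<lambda>\<omega>. EL c0 n k p (z0vec X (err \<omega>))) \<in> borel_measurable M"
proof (rule el_statistic_measurable[of "{1..n}" p "\<lambda>\<omega>. m (err \<omega>)"])
  show "(\<lambda>\<omega>. m (err \<omega>) i s) \<in> borel_measurable M" if "i \<in> {1..n}" for i s
    unfolding m_def err_def using rv[OF that] by measurable
  show "EL c0 n k p (z0vec X (err \<omega>)) = 2 * el_log p {1..n} (m (err \<omega>)) l"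
    if "el_feasible p {1..n} (m (err \<omega>)) l" "\<And>s. s < p \<Longrightarrow> el_grad p {1..n} (m (err \<omega>)) l s = 0" for \<omega> l
    by (rule EL_via_el_log(1)[OF that(1)]) (rule that(2))
  show "EL c0 n k p (z0vec X (err \<omega>)) = c0"
    if "\<not> (\<exists>l. el_feasible p {1..n} (m (err \<omega>)) l \<and> (\<forall>s<p. el_grad p {1..n} (m (err \<omega>)) l s = 0))" for \<omega>
    by (rule EL_via_el_log(2)[OF that])
qed simp

text \<open>
  On the event that none of the Markov bounds of \<open>bad_event_bound\<close> fails, the expansion
  \<open>el_quadratic_approximation\<close> applies. Its error terms are measured in \<open>y = p / n powr (1/3)\<close>,
  with \<open>t = n powr (1/3)\<close>, so that \<open>p = y t\<close>. They have order \<open>p\<^sup>2/sqrt n\<close> (covariance deviation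
  times \<open>T\<close>), \<open>p sqrt(p/n)\<close> (third moments) and \<open>p\<^sup>3/n\<close> (gradient), and the squared errors
  \<open>(\<eta> i)\<^sup>2\<close> are at most \<open>t\<close>, which bounds the length of the \<open>m i\<close> by \<open>R = sqrt (K p t)\<close>.
\<close>

theorem el_remainder:
  fixes H t y :: real
  defines "K \<equiv> s2 * Kc^2 * Kx"
  assumes H: "H \<ge> 1" and t: "t \<ge> 1" "t^3 = n" and y: "y = p / t"
    and c1: "sqrt H * K * y \<le> C0 / 2" and c2: "4 * H * K * y^2 \<le> C0" and c3: "51840 * H^2 * K^3 * y^4 < C0^3"
  shows "prob {\<omega>\<in>space M. (H * sqrt H * (K / C0) * (y * sqrt y) + 2 * H * sqrt (K / C0) * y + 90 * H^2 * (K / C0)^2 * (y^2 * sqrt y)) * sqrt p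
      < \<bar>EL c0 n k p (z0vec X (err \<omega>)) - T \<omega>\<bar>} \<le> (2 + \<kappa> + 44 * \<kappa>^2) / H + \<kappa> / t"
proof -
  define b where "b r s i = s2 * (c i)^2 * x i r * x i s / n" for r s i
  define w where "w i = (c i)^2 * s2 * ip p (x i) (x i)" for i
  define F where "F = K^2 * real p^2 / n"
  define w0 where "w0 = n * (K * p)"
  define R where "R = sqrt (K * p * t)"
  define D where "D = sqrt (H * F)"
  have K: "K > 0" unfolding K_def using s2 Kc Kx by simp
  have pp: "real p \<ge> 1" "real p > 0" using p by auto
  have t0: "t > 0" using t by simp
  have pyt: "real p = y * t" using y t0 by simp
  have y0: "y > 0" using y t0 pp by simp
  have n3: "real n = t^3" using t by simp
  have F0: "F > 0" unfolding F_def using K pp n_pos by simp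
  have w0: "w0 > 0" unfolding w0_def using K pp n_pos by simp
  have R: "R > 0" "R^2 = K * p * t" unfolding R_def using K pp t0 by simp_all
  have csq: "(c i)^2 \<le> Kc^2" if "i \<in> {1..n}" for i using Kc(2)[OF that] by (metis abs_ge_zero power2_abs power_mono)
  have wle: "w i \<le> K * p" "0 \<le> w i" if "i \<in> {1..n}" for i
  proof -
    have "(c i)^2 * s2 * ip p (x i) (x i) \<le> Kc^2 * s2 * (Kx * p)"
      using csq[OF that] Kx(2)[OF that] s2 ip_nonneg by (intro mult_mono) auto
    thus "w i \<le> K * p" unfolding w_def K_def by (simp add: mult_ac)
    show "0 \<le> w i" unfolding w_def using s2 ip_nonneg by simp
  qed
  have bF: "(\<Sum>r<p. \<Sum>s<p. \<Sum>i\<in>{1..n}. (b r s i)^2) \<le> F"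
  proof -
    have "(\<Sum>r<p. \<Sum>s<p. \<Sum>i\<in>{1..n}. (b r s i)^2) = (\<Sum>r<p. \<Sum>i\<in>{1..n}. \<Sum>s<p. (b r s i)^2)"
      by (intro sum.cong refl sum.swap)
    also have "\<dots> = (\<Sum>i\<in>{1..n}. \<Sum>r<p. \<Sum>s<p. (b r s i)^2)" by (rule sum.swap)
    also have "\<dots> = (\<Sum>i\<in>{1..n}. (w i / n)^2)"
    proof (rule sum.cong[OF refl])
      fix i
      have "(\<Sum>r<p. \<Sum>s<p. (b r s i)^2) = (\<Sum>r<p. \<Sum>s<p. (s2 * (c i)^2 / n)^2 * ((x i r * x i r) * (x i s * x i s)))"
        unfolding b_def by (intro sum.cong refl) (simp add: power2_eq_square mult_ac)
      also have "\<dots> = (s2 * (c i)^2 / n)^2 * (ip p (x i) (x i) * ip p (x i) (x i))"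
        unfolding ip_def sum_product unfolding sum_distrib_left ..
      finally show "(\<Sum>r<p. \<Sum>s<p. (b r s i)^2) = (w i / n)^2"
        unfolding w_def by (simp add: power2_eq_square mult_ac)
    qed
    also have "\<dots> \<le> (\<Sum>i\<in>{1..n}. (K * p / n)^2)"
      using wle n_pos by (intro sum_mono power_mono divide_right_mono) auto
    also have "\<dots> = F" using n_pos by (simp add: F_def power2_eq_square)
    finally show ?thesis .
  qed
  have ww: "(\<Sum>i\<in>{1..n}. w i) \<le> w0"
  proof -
    have "(\<Sum>i\<in>{1..n}. w i) \<le> (\<Sum>i\<in>{1..n}. K * p)" using wle by (intro sum_mono)
    thus ?thesis by (simp add: w0_def)
  qed
  define bound where "bound = (H * sqrt H * (K / C0) * (y * sqrt y) + 2 * H * sqrt (K / C0) * y + 90 * H^2 * (K / C0)^2 * (y^2 * sqrt y)) * sqrt p"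
  define good where "good \<omega> \<longleftrightarrow> T \<omega> \<le> H * d \<and> (\<Sum>r<p. \<Sum>s<p. (\<Sum>i\<in>{1..n}. b r s i * ((\<eta> i \<omega>)^2 - 1))^2) \<le> H * F
     \<and> (\<Sum>i\<in>{1..n}. \<bar>\<eta> i \<omega> * L i \<omega>\<bar>^3) \<le> H * (\<rho> * d) \<and> (\<Sum>i\<in>{1..n}. (\<eta> i \<omega> * L i \<omega>)^4) \<le> H * (\<rho>^2 * d)
     \<and> (\<Sum>i\<in>{1..n}. w i * (\<eta> i \<omega>)^2) \<le> H * w0 \<and> (\<forall>i\<in>{1..n}. (\<eta> i \<omega>)^2 \<le> t)" for \<omega>
  have st: "sqrt t \<ge> 1" using t by simp
  have sn: "sqrt (real n) = t * sqrt t"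
    unfolding n3 using t0 by (simp add: real_sqrt_mult power3_eq_cube)
  have sp: "sqrt (real p) = sqrt y * sqrt t" unfolding pyt by (simp add: real_sqrt_mult)
  have Deq: "D = sqrt H * K * (p / sqrt n)"
    unfolding D_def F_def using K pp H by (simp add: real_sqrt_mult real_sqrt_divide)
  have psn: "p / sqrt n = y / sqrt t" unfolding sn pyt using t0 by simp
  have yst: "y / sqrt t \<le> y" using st y0 by (simp add: divide_le_eq mult_le_cancel_left1)
  have Db: "D \<le> C0 / 2"
  proof -
    have "D \<le> sqrt H * K * y" unfolding Deq psn using yst H K by (intro mult_left_mono) auto
    thus ?thesis using c1 by simp
  qed
  have \<rho>eq: "\<rho> = sqrt (K / C0) * (sqrt p / sqrt n)"
  proof -
    have "\<rho> = sqrt (\<rho>^2)" using \<rho>01 by simp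
    also have "\<rho>^2 = K / C0 * (p / n)" unfolding \<rho>2 K_def ..
    finally show ?thesis by (simp add: real_sqrt_mult real_sqrt_divide)
  qed
  have \<rho>sq: "\<rho>^2 = K / C0 * (p / n)" unfolding \<rho>2 K_def ..
  have key: "\<bar>EL c0 n k p (z0vec X (err \<omega>)) - T \<omega>\<bar> \<le> bound" if g: "good \<omega>" for \<omega>
  proof -
    let ?m = "m (err \<omega>)"
    define X3 where "X3 = (\<Sum>i\<in>{1..n}. \<bar>ip p (l0 (err \<omega>)) (?m i)\<bar>^3)"
    define X4 where "X4 = (\<Sum>i\<in>{1..n}. (ip p (l0 (err \<omega>)) (?m i))^4)"
    define M2 where "M2 = (\<Sum>i\<in>{1..n}. ip p (?m i) (?m i))"
    define TT where "TT = (\<Sum>i\<in>{1..n}. ip p (l0 (err \<omega>)) (?m i))"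
    define \<Gamma> where "\<Gamma> = 2 * real n * D^2 * TT / C0 + 8 * X4 * M2"
    have TT: "TT = T \<omega>" unfolding TT_def multiplier_products T_eq_sum_L ..
    have ipm: "ip p (?m i) (?m i) = w i * (\<eta> i \<omega>)^2" for i
      unfolding ip_m w_def err_def by (simp add: power_mult_distrib \<sigma>(2) mult_ac)
    have bT: "TT \<le> H * p" "0 \<le> TT" using g T_nonneg unfolding TT good_def d_eq by auto
    have b3: "X3 \<le> H * (\<rho> * p)" using g unfolding X3_def good_def multiplier_products d_eq by auto
    have b4: "X4 \<le> H * (\<rho>^2 * p)" "0 \<le> X4" using g unfolding X4_def good_def multiplier_products d_eq
      by (auto intro!: sum_nonneg)
    have b2: "M2 \<le> H * w0" "0 \<le> M2" using g unfolding M2_def good_def ipm using wle by (auto intro!: sum_nonneg)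
    have D2: "D^2 = H * F" unfolding D_def using H F0 by simp
    \<comment> \<open>2 from the covariance deviation, 8 from the fourth moments.\<close>
    have \<Gamma>b: "\<Gamma> \<le> 10 * H^2 * K^2 * real p^3 / C0"
    proof -
      have "2 * real n * D^2 * TT / C0 \<le> 2 * real n * (H * F) * (H * p) / C0"
        unfolding D2 using bT H F0 C0 n_pos by (intro divide_right_mono mult_left_mono) auto
      also have "\<dots> = 2 * H^2 * K^2 * real p^3 / C0"
        unfolding F_def using n_pos by (simp add: power2_eq_square power3_eq_cube mult_ac)
      finally have g1: "2 * real n * D^2 * TT / C0 \<le> 2 * H^2 * K^2 * real p^3 / C0" .
      have "8 * X4 * M2 \<le> 8 * (H * (\<rho>^2 * p)) * (H * w0)"
        using b4 b2 H w0 by (intro mult_mono) auto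
      also have "\<dots> = 8 * H^2 * K^2 * real p^3 / C0"
        unfolding \<rho>sq w0_def using n_pos by (simp add: power2_eq_square power3_eq_cube mult_ac)
      finally have "8 * X4 * M2 \<le> 8 * H^2 * K^2 * real p^3 / C0" .
      thus ?thesis unfolding \<Gamma>_def using g1 by (simp add: add_divide_distrib[symmetric])
    qed
    have "\<exists>l. el_feasible p {1..n} ?m l \<and> (\<forall>s<p. el_grad p {1..n} ?m l s = 0) \<and>
       \<bar>2 * el_log p {1..n} ?m l - TT\<bar> \<le> D * TT / C0 + 2 * X3 + 9 * \<Gamma> / (real n * C0)"
      unfolding TT_def X3_def \<Gamma>_def X4_def M2_def
    proof (rule el_quadratic_approximation[OF _ n_pos C0 R(1) V_low V_times_l0])
      show "finite {1..n}" by simp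
      have dev: "(\<Sum>i\<in>{1..n}. ?m i r * ?m i s) / real n - V r s = (\<Sum>i\<in>{1..n}. b r s i * ((\<eta> i \<omega>)^2 - 1))" if "r < p" "s < p" for r s
      proof -
        have "(\<Sum>i\<in>{1..n}. ?m i r * ?m i s) / real n = (\<Sum>i\<in>{1..n}. b r s i * (\<eta> i \<omega>)^2)"
          unfolding sum_divide_distrib m_def err_def b_def \<sigma>(2)[symmetric]
          by (intro sum.cong refl) (simp add: power2_eq_square mult_ac)
        moreover have "V r s = (\<Sum>i\<in>{1..n}. b r s i)" using that by (simp add: V_entry b_def sum_divide_distrib)
        ultimately show ?thesis by (simp add: sum_subtractf algebra_simps)
      qed
      have "(\<Sum>r<p. \<Sum>s<p. ((\<Sum>i\<in>{1..n}. ?m i r * ?m i s) / real n - V r s)^2)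
          = (\<Sum>r<p. \<Sum>s<p. (\<Sum>i\<in>{1..n}. b r s i * ((\<eta> i \<omega>)^2 - 1))^2)"
        by (intro sum.cong refl) (simp only: dev lessThan_iff)
      also have "\<dots> \<le> D^2" unfolding D2 using g by (simp add: good_def)
      finally show "(\<Sum>r<p. \<Sum>s<p. ((\<Sum>i\<in>{1..n}. ?m i r * ?m i s) / real n - V r s)^2) \<le> D^2" .
      show "0 \<le> D" unfolding D_def using H F0 by simp
      show "D \<le> C0 / 2" by (rule Db)
      show "ip p (?m i) (?m i) \<le> R^2" if "i \<in> {1..n}" for i
        unfolding ipm R(2) using wle[OF that] g that unfolding good_def by (intro mult_mono) auto
      have "4 * TT * R^2 \<le> 4 * (H * p) * R^2" using bT by (intro mult_right_mono) auto
      also have "\<dots> = (4 * H * K * y^2) * t^3" unfolding R(2) pyt by (simp add: power2_eq_square power3_eq_cube mult_ac)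
      also have "\<dots> \<le> C0 * t^3" using c2 t0 by (intro mult_right_mono) auto
      finally show "4 * (\<Sum>i\<in>{1..n}. ip p (l0 (err \<omega>)) (?m i)) * R^2 \<le> real n * C0"
        unfolding n3 TT_def[symmetric] by (simp add: mult.commute)
      \<comment> \<open>The smallness condition is \<Gamma> (72 R)^2 < (n C0)^2, and 51840 = 10 * 72^2.\<close>
      have "\<Gamma> * (72^2 * R^2) \<le> (10 * H^2 * K^2 * real p^3 / C0) * (72^2 * R^2)" using \<Gamma>b by (intro mult_right_mono) auto
      also have "\<dots> = 51840 * H^2 * K^3 * y^4 * t^5 / C0"
        unfolding R(2) pyt by (simp add: power2_eq_square power3_eq_cube power4_eq_xxxx eval_nat_numeral mult_ac)
      also have "\<dots> < C0^3 * t^5 / C0" using c3 t0 C0 by (intro divide_strict_right_mono mult_strict_right_mono) auto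
      also have "\<dots> = C0^2 * t^5" using C0 by (simp add: power2_eq_square power3_eq_cube)
      also have "\<dots> \<le> C0^2 * t^6" using t by (intro mult_left_mono power_increasing) auto
      also have "\<dots> = (real n * C0)^2" unfolding n3 by (simp add: power_mult_distrib power_mult[symmetric])
      finally have "\<Gamma> * (72 * R)^2 < (real n * C0)^2" by (simp add: power_mult_distrib)
      moreover have "(real n * (C0 / 2) / (36 * R))^2 * (72 * R)^2 = (real n * C0)^2"
        unfolding power_mult_distrib[symmetric] using R(1) by simp
      ultimately have "\<Gamma> * (72 * R)^2 < (real n * (C0 / 2) / (36 * R))^2 * (72 * R)^2" by simp
      hence "\<Gamma> < (real n * (C0 / 2) / (36 * R))^2" by (rule mult_right_less_imp_less) simp
      thus "2 * real n * D\<^sup>2 * (\<Sum>i\<in>{1..n}. ip p (l0 (err \<omega>)) (?m i)) / C0 + 8 * (\<Sum>i\<in>{1..n}. (ip p (l0 (err \<omega>)) (?m i))^4) *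
         (\<Sum>i\<in>{1..n}. ip p (?m i) (?m i)) < (real n * (C0 / 2) / (36 * R))\<^sup>2"
        unfolding \<Gamma>_def TT_def X4_def M2_def .
    qed
    then obtain l where l: "el_feasible p {1..n} ?m l" "\<And>s. s < p \<Longrightarrow> el_grad p {1..n} ?m l s = 0"
      "\<bar>2 * el_log p {1..n} ?m l - TT\<bar> \<le> D * TT / C0 + 2 * X3 + 9 * \<Gamma> / (real n * C0)" by blast
    have "EL c0 n k p (z0vec X (err \<omega>)) = 2 * el_log p {1..n} ?m l"
      by (rule EL_via_el_log(1)[OF l(1)]) (rule l(2))
    hence "\<bar>EL c0 n k p (z0vec X (err \<omega>)) - T \<omega>\<bar> \<le> D * TT / C0 + 2 * X3 + 9 * \<Gamma> / (real n * C0)"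
      using l(3) by (simp add: TT)
    also have "\<dots> \<le> H * sqrt H * (K / C0) * (y * sqrt y) * sqrt p + 2 * H * sqrt (K / C0) * y * sqrt p + 90 * H^2 * (K / C0)^2 * (y^2 * sqrt y) * sqrt p"
    proof (intro add_mono)
      have sy: "sqrt y * sqrt y = y" "sqrt t * sqrt t = t" using y0 t0 by simp_all
      have "D * TT / C0 \<le> D * (H * p) / C0" using bT C0 H F0 by (intro divide_right_mono mult_left_mono) (auto simp: D_def)
      also have "\<dots> = H * sqrt H * (K / C0) * (y / sqrt t * p)" unfolding Deq psn by (simp add: mult_ac)
      also have "y / sqrt t * p = y * sqrt y * sqrt p"
      proof -
        have "y / sqrt t * p = y * (y * (t / sqrt t))" unfolding pyt by simp
        also have "t / sqrt t = sqrt t" using t0 by (simp add: real_div_sqrt)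
        also have "y * (y * sqrt t) = y * ((sqrt y * sqrt y) * sqrt t)" unfolding sy ..
        finally show ?thesis unfolding sp by (simp only: mult.assoc)
      qed
      finally show "D * TT / C0 \<le> H * sqrt H * (K / C0) * (y * sqrt y) * sqrt p" by (simp add: mult.assoc)
      have "2 * X3 \<le> 2 * (H * (\<rho> * p))" using b3 by simp
      also have "\<dots> = 2 * H * sqrt (K / C0) * (p / sqrt n) * sqrt p" unfolding \<rho>eq by simp
      also have "\<dots> \<le> 2 * H * sqrt (K / C0) * y * sqrt p"
        unfolding psn using yst H K C0 by (intro mult_right_mono mult_left_mono) auto
      finally show "2 * X3 \<le> 2 * H * sqrt (K / C0) * y * sqrt p" .
      have "9 * \<Gamma> / (real n * C0) \<le> 9 * (10 * H^2 * K^2 * real p^3 / C0) / (real n * C0)"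
        using \<Gamma>b n_pos C0 by (intro divide_right_mono mult_left_mono) auto
      also have "\<dots> = 90 * H^2 * (K / C0)^2 * (real p^3 / n)" by (simp add: power2_eq_square mult_ac)
      also have "real p^3 / n = y^3" unfolding n3 pyt using t0 by (simp add: power_mult_distrib)
      also have "y^3 \<le> y^2 * sqrt y * sqrt p"
      proof -
        have "y^2 * (sqrt y * sqrt y) * 1 \<le> y^2 * (sqrt y * sqrt y) * sqrt t" using st y0 by (intro mult_left_mono) auto
        thus ?thesis unfolding sp sy(1) using y0 by (simp add: power2_eq_square power3_eq_cube mult_ac)
      qed
      hence "90 * H^2 * (K / C0)^2 * y^3 \<le> 90 * H^2 * (K / C0)^2 * (y^2 * sqrt y * sqrt p)"
        by (intro mult_left_mono) auto
      finally show "9 * \<Gamma> / (real n * C0) \<le> 90 * H^2 * (K / C0)^2 * (y^2 * sqrt y) * sqrt p" by (simp add: mult.assoc)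
    qed
    also have "\<dots> = bound" unfolding bound_def by (simp add: distrib_right)
    finally show ?thesis .
  qed
  have "prob {\<omega>\<in>space M. bound < \<bar>EL c0 n k p (z0vec X (err \<omega>)) - T \<omega>\<bar>} \<le> prob {\<omega>\<in>space M. \<not> good \<omega>}"
  proof (intro finite_measure_mono)
    show "{\<omega>\<in>space M. bound < \<bar>EL c0 n k p (z0vec X (err \<omega>)) - T \<omega>\<bar>} \<subseteq> {\<omega>\<in>space M. \<not> good \<omega>}"
      using key by force
    show "{\<omega>\<in>space M. \<not> good \<omega>} \<in> sets M" unfolding good_def
      by (intro sets.sets_Collect_neg sets.sets_Collect_conj sets.sets_Collect_finite_All)
         (measurable; simp)+
  qed
  also have "\<dots> \<le> (2 + \<kappa> + 44 * \<kappa>^2) / H + card {1..n} * \<kappa> / t^4"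
    unfolding good_def by (rule bad_event_bound) (use d_eq pp H t0 F0 bF wle w0 ww in auto)
  also have "card {1..n} * \<kappa> / t^4 = \<kappa> / t"
    using t0 n3 by (simp add: power3_eq_cube power4_eq_xxxx)
  finally show ?thesis unfolding bound_def .
qed

end

section \<open>Convergence in distribution\<close>

text \<open>
  Levy's continuity theorem for variables that need only be measurable from some index on.
\<close>

lemma (in prob_space) weak_conv_std_normal_from_char:
  assumes meas: "\<And>n. n \<ge> N \<Longrightarrow> f n \<in> borel_measurable M"
    and char: "\<And>t. (\<lambda>n. CLINT \<omega>|M. iexp (t * f n \<omega>)) \<longlonglongrightarrow> of_real (exp (- (t^2) / 2))"
  shows "weak_conv_m (\<lambda>n. distr M borel (f n)) std_normal_distribution"
proof -
  have "weak_conv_m (\<lambda>n. distr M borel (f (n + N))) std_normal_distribution"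
  proof (rule levy_continuity)
    show "real_distribution (distr M borel (f (n + N)))" for n by (rule real_distribution_distr) (use meas in auto)
    show "real_distribution std_normal_distribution" by (rule real_dist_normal_dist)
    fix t
    have "char (distr M borel (f (n + N))) t = (CLINT \<omega>|M. iexp (t * f (n + N) \<omega>))" for n
      unfolding char_def using meas[of "n + N"] by (subst integral_distr) auto
    thus "(\<lambda>n. char (distr M borel (f (n + N))) t) \<longlonglongrightarrow> char std_normal_distribution t"
      unfolding char_std_normal_distribution using LIMSEQ_ignore_initial_segment[OF char, of t N] by simp
  qed
  thus ?thesis unfolding weak_conv_m_def weak_conv_def
    by (auto intro: LIMSEQ_offset[where k=N])
qed

lemma abs_power_le_one_plus_powr:
  fixes x r :: real
  assumes "real m \<le> r"
  shows "\<bar>x\<bar>^m \<le> 1 + \<bar>x\<bar> powr r"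
proof (cases "\<bar>x\<bar> \<le> 1")
  case True
  have "\<bar>x\<bar>^m \<le> 1" using True by (intro power_le_one) auto
  thus ?thesis by (simp add: add_increasing2)
next
  case False
  hence "\<bar>x\<bar>^m = \<bar>x\<bar> powr (real m)" by (simp add: powr_realpow)
  also have "\<dots> \<le> \<bar>x\<bar> powr r" using False assms by (intro powr_mono) auto
  finally show ?thesis by simp
qed

text \<open>
  A vanishing error variance would make the covariance matrix zero; the errors can therefore be
  standardized.
\<close>

lemma eigval_pos_imp_variance_pos:
  assumes p: "p \<ge> 1" and C0: "0 < C0" "C0 < eigval (Vn n k p s2 X) p" and s2: "s2 \<ge> 0"
    and X: "\<And>i. i \<in> {1..n} \<Longrightarrow> X i \<in> carrier_vec p" and kn: "k < n"
  shows "0 < s2"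
proof (rule ccontr)
  assume "\<not> 0 < s2"
  hence s0: "s2 = 0" using s2 by simp
  have car: "Vn n k p s2 X \<in> carrier_mat p p" by (simp add: Vn_def Let_def)
  have ent: "Vn n k p s2 X $$ (r, s) = 0" if rs: "r < p" "s < p" for r s
  proof -
    have "Vi s2 X i $$ (r, s) = 0" if "i \<in> {1..n}" for i
      using X[OF that] rs by (simp add: Vi_def outer_def s0)
    hence "(\<Sum>i=1..k. Vi s2 X i $$ (r, s)) = 0" "(\<Sum>i=k+1..n. Vi s2 X i $$ (r, s)) = 0"
      using kn by (auto intro!: sum.neutral)
    thus ?thesis unfolding Vn_def Let_def using rs by simp
  qed
  have T: "transpose_mat (Vn n k p s2 X) = Vn n k p s2 X"
    using car by (intro eq_matI) (auto simp: ent)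
  let ?e = "\<lambda>s. if s = 0 then 1 else (0::real)"
  have "eigval (Vn n k p s2 X) p * (\<Sum>r<p. (?e r)^2) \<le> (\<Sum>r<p. \<Sum>s<p. ?e r * Vn n k p s2 X $$ (r, s) * ?e s)"
    by (rule quadratic_form_bound_by_eigval[OF car T p])
  also have "\<dots> = 0" by (intro sum.neutral ballI) (simp add: ent)
  also have "(\<Sum>r<p. (?e r)^2) = 1"
    using p by (simp add: if_distrib[of "\<lambda>x. x^2"] cong: if_cong)
  finally show False using C0 by simp
qed

theorem theorem1:
  fixes M :: "'a measure"
    and \<epsilon> :: "nat \<Rightarrow> 'a \<Rightarrow> real"
    and p k :: "nat \<Rightarrow> nat"
    and X :: "nat \<Rightarrow> nat \<Rightarrow> real Matrix.vec"
    and Y :: "nat \<Rightarrow> nat \<Rightarrow> 'a \<Rightarrow> real"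
    and \<beta>0 :: "nat \<Rightarrow> real Matrix.vec"
    and \<sigma> \<theta>0 q C0 C1 C2 C3 C4 C5 :: real
    and c :: "nat \<Rightarrow> real"
  defines "V \<equiv> (\<lambda>n. Vn n (k n) (p n) (\<sigma>^2) (X n))"
    and "w \<equiv> (\<lambda>n i \<omega>. w0vec n (k n) (p n) (\<sigma>^2) (X n) (\<lambda>j. \<epsilon> j \<omega>) i)"
    and "\<alpha> \<equiv> (\<lambda>n. alpha M n (k n)
            (\<lambda>i \<omega>. w0vec n (k n) (p n) (\<sigma>^2) (X n) (\<lambda>j. \<epsilon> j \<omega>) i))"
    and "\<psi> \<equiv> (\<lambda>n \<omega>. psi n (k n) (p n) (z0vec (X n) (\<lambda>j. \<epsilon> j \<omega>)))"
    and "\<Delta> \<equiv> (\<lambda>n. Delta n (k n) (p n) (\<sigma>^2) (\<integral>\<omega>. (\<epsilon> 1 \<omega>)^4 \<partial>M) (X n))"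
  assumes M: "prob_space M"
    and iid: "prob_space.indep_vars M (\<lambda>_. borel) \<epsilon> {1..}"
             "\<And>i. i \<ge> 1 \<Longrightarrow> distr M borel (\<epsilon> i) = distr M borel (\<epsilon> 1)"
    and mean: "integrable M (\<epsilon> 1)" "(\<integral>\<omega>. \<epsilon> 1 \<omega> \<partial>M) = 0"
    and var: "integrable M (\<lambda>\<omega>. (\<epsilon> 1 \<omega>)^2)" "prob_space.variance M (\<epsilon> 1) = \<sigma>^2"
    and p_pos: "\<And>n. n \<ge> 2 \<Longrightarrow> p n \<ge> 1"
    and p_lim: "filterlim p at_top sequentially"
    and k_range: "\<And>n. n \<ge> 2 \<Longrightarrow> 1 \<le> k n \<and> k n < n"
    and theta: "0 < \<theta>0" "\<theta>0 < 1" "(\<lambda>n. real (k n) / real n) \<longlonglongrightarrow> \<theta>0"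
    and X_dim: "\<And>n i. n \<ge> 2 \<Longrightarrow> i \<in> {1..n} \<Longrightarrow> X n i \<in> carrier_vec (p n)"
    and beta_dim: "\<And>n. n \<ge> 2 \<Longrightarrow> \<beta>0 n \<in> carrier_vec (p n)"
    and H0: "\<And>n i \<omega>. n \<ge> 2 \<Longrightarrow> i \<in> {1..n} \<Longrightarrow> \<omega> \<in> space M \<Longrightarrow>
               Y n i \<omega> = scalar_prod (X n i) (\<beta>0 n) + \<epsilon> i \<omega>"
    and q: "q \<ge> 4"
    and C_pos: "C0 > 0" "C1 > 0" "C2 > 0" "C3 > 0" "C4 > 0" "C5 > 0"
    and eig_low: "ereal C0 < (INF n\<in>{2..}. ereal (eigval (V n) (p n)))"
    and eig_up: "(SUP n\<in>{2..}. ereal (eigval (V n) 1)) < ereal C1"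
    and mom4: "integrable M (\<lambda>\<omega>. (\<epsilon> 1 \<omega>)^4)" "(\<integral>\<omega>. (\<epsilon> 1 \<omega>)^4 \<partial>M) < C2"
    and X_bound: "\<And>n i. n \<ge> 2 \<Longrightarrow> i \<in> {1..n} \<Longrightarrow>
               1 / real (p n) * (\<Sum>s<p n. \<bar>vec_index (X n i) s\<bar> powr q) < C3"
    and mom2q: "integrable M (\<lambda>\<omega>. \<bar>\<epsilon> 1 \<omega>\<bar> powr (2 * q))"
               "(\<integral>\<omega>. \<bar>\<epsilon> 1 \<omega>\<bar> powr (2 * q) \<partial>M) < C4"
    and rate1: "(\<lambda>n. real (p n) * real (k n) powr ((2 - q) / (2 * q))) \<longlonglongrightarrow> 0"
               "(\<lambda>n. real (p n) * real (n - k n) powr ((2 - q) / (2 * q))) \<longlonglongrightarrow> 0"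
    and rate2: "(\<lambda>n. real (p n) powr (2 + 4 / q) / real (k n)) \<longlonglongrightarrow> 0"
               "(\<lambda>n. real (p n) powr (2 + 4 / q) / real (n - k n)) \<longlonglongrightarrow> 0"
    and alpha4: "(\<lambda>n. \<Sum>r<p n. \<Sum>s<p n. \<alpha> n [r, r, s, s]) \<in> O(\<lambda>n. real (p n) ^ 2)"
    and alpha3: "(\<lambda>n. \<Sum>r<p n. \<Sum>s<p n. \<Sum>u<p n. \<alpha> n [r, s, u] * \<alpha> n [r, s, u])
                   \<in> O(\<lambda>n. real (p n) powr (5 / 2))"
                "(\<lambda>n. \<Sum>r<p n. \<Sum>s<p n. \<Sum>u<p n. \<alpha> n [r, s, s] * \<alpha> n [s, u, u])
                   \<in> O(\<lambda>n. real (p n) powr (5 / 2))"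
    and w_mom: "\<And>n i js ds. n \<ge> 2 \<Longrightarrow> i \<in> {1..n} \<Longrightarrow> length js \<ge> 1 \<Longrightarrow> length ds = length js \<Longrightarrow>
               set js \<subseteq> {..<p n} \<Longrightarrow> sum_list ds \<le> (6::nat) \<Longrightarrow>
               (\<integral>\<omega>. (\<Prod>m<length js. vec_index (w n i \<omega>) (js ! m) ^ (ds ! m)) \<partial>M) \<le> C5"
    and p_rate: "(\<lambda>n. real (p n)) \<in> o(\<lambda>n. real n powr (1 / 3))"
  shows "weak_conv_m
           (\<lambda>n. distr M borel (\<lambda>\<omega>.
              (real n * scalar_prod (\<psi> n \<omega>) (mat_inv (V n) *\<^sub>v \<psi> n \<omega>) - real (p n)) / (\<Delta> n / real n)))
           std_normal_distribution \<and>
         weak_conv_m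
           (\<lambda>n. distr M borel (\<lambda>\<omega>.
              (EL (c n) n (k n) (p n) (zvec (X n) (\<lambda>i. Y n i \<omega>) (\<beta>0 n)) - real (p n)) / (\<Delta> n / real n)))
           std_normal_distribution"
proof -
  interpret prob_space M by (rule M)
  have eig: "C0 < eigval (V n) (p n)" if "n \<ge> 2" for n
    using less_INF_D[OF eig_low, of n] that by simp
  have s2: "0 < \<sigma>^2"
    by (rule eigval_pos_imp_variance_pos[of "p 2" C0 2 "k 2" "\<sigma>^2" "X 2"])
       (use eig[of 2] p_pos[of 2] k_range[of 2] X_dim[of 2] C_pos in \<open>auto simp: V_def\<close>)
  define s where "s = \<bar>\<sigma>\<bar>"
  have s: "0 < s" "s^2 = \<sigma>^2" using s2 by (auto simp: s_def)
  define \<eta> where "\<eta> i \<omega> = \<epsilon> i \<omega> / s" for i \<omega>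
  define \<kappa> where "\<kappa> = 1 + expectation (\<lambda>\<omega>. \<bar>\<eta> 1 \<omega>\<bar>^8)"
  have rv\<epsilon> [measurable]: "\<epsilon> i \<in> borel_measurable M" if "i \<ge> 1" for i
    using iid(1) that by (auto simp: indep_vars_def)
  have same_law: "integrable M (\<lambda>\<omega>. f (\<epsilon> i \<omega>)) = integrable M (\<lambda>\<omega>. f (\<epsilon> 1 \<omega>))"
    "expectation (\<lambda>\<omega>. f (\<epsilon> i \<omega>)) = expectation (\<lambda>\<omega>. f (\<epsilon> 1 \<omega>))"
    if i: "i \<ge> 1" and [measurable]: "f \<in> borel_measurable borel" for i and f :: "real \<Rightarrow> real"
  proof -
    show "integrable M (\<lambda>\<omega>. f (\<epsilon> i \<omega>)) = integrable M (\<lambda>\<omega>. f (\<epsilon> 1 \<omega>))"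
      using integrable_distr_eq[of "\<epsilon> i" M borel f] integrable_distr_eq[of "\<epsilon> 1" M borel f] rv\<epsilon>[OF i] rv\<epsilon>[of 1] iid(2)[OF i] by simp
    show "expectation (\<lambda>\<omega>. f (\<epsilon> i \<omega>)) = expectation (\<lambda>\<omega>. f (\<epsilon> 1 \<omega>))"
      using integral_distr[of "\<epsilon> i" M borel f] integral_distr[of "\<epsilon> 1" M borel f] rv\<epsilon>[OF i] rv\<epsilon>[of 1] iid(2)[OF i] by simp
  qed
  have int8: "integrable M (\<lambda>\<omega>. \<bar>\<epsilon> 1 \<omega>\<bar>^8)"
  proof (rule Bochner_Integration.integrable_bound)
    show "integrable M (\<lambda>\<omega>. 1 + \<bar>\<epsilon> 1 \<omega>\<bar> powr (2 * q))" using mom2q(1) by simp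
    show "AE \<omega> in M. norm (\<bar>\<epsilon> 1 \<omega>\<bar>^8) \<le> norm (1 + \<bar>\<epsilon> 1 \<omega>\<bar> powr (2 * q))"
      using abs_power_le_one_plus_powr[of 8 "2 * q"] q by (intro AE_I2) simp
  qed (use rv\<epsilon>[of 1] in measurable)
  have errs: "standardized_errors M {1..n} \<eta> \<kappa>" for n
  proof
    show "finite {1..n}" by simp
    show "indep_vars (\<lambda>_. borel) \<eta> {1..n}"
      unfolding \<eta>_def[abs_def]
      using indep_vars_compose2[OF indep_vars_subset[OF iid(1), of "{1..n}"], of "\<lambda>_ x. x / s" "\<lambda>_. borel"] by auto
    have \<eta>8: "\<bar>\<eta> i \<omega>\<bar>^8 = \<bar>\<epsilon> i \<omega>\<bar>^8 / s^8" for i \<omega> using s by (simp add: \<eta>_def power_divide abs_divide)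
    fix i assume "i \<in> {1..n}"
    hence i: "i \<ge> 1" by simp
    show "integrable M (\<lambda>\<omega>. \<bar>\<eta> i \<omega>\<bar>^8)"
      unfolding \<eta>8 using same_law(1)[OF i, of "\<lambda>x. \<bar>x\<bar>^8 / s^8"] int8 by simp
    show "1 + expectation (\<lambda>\<omega>. \<bar>\<eta> i \<omega>\<bar>^8) \<le> \<kappa>"
      unfolding \<kappa>_def \<eta>8 using same_law(2)[OF i, of "\<lambda>x. \<bar>x\<bar>^8 / s^8"] s(1) by auto
    show "expectation (\<eta> i) = 0"
      unfolding \<eta>_def[abs_def] using same_law(2)[OF i, of "\<lambda>x. x / s"] mean by auto
    show "expectation (\<lambda>\<omega>. (\<eta> i \<omega>)^2) = 1"
    proof -
      have "expectation (\<lambda>\<omega>. (\<eta> i \<omega>)^2) = expectation (\<lambda>\<omega>. (\<epsilon> 1 \<omega>)^2 / s^2)"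
        unfolding \<eta>_def power_divide by (rule same_law(2)[OF i]) measurable
      also have "\<dots> = 1" using var mean s s2 by simp
      finally show ?thesis .
    qed
  next
    show "1 \<le> \<kappa>" unfolding \<kappa>_def by simp
  qed
  \<comment> \<open>Kc dominates both group weights as soon as \<theta> > \<theta>0/2 and 1 - \<theta> > (1 - \<theta>0)/2; Kx comes from
    x^2 \<le> 1 + |x|^q.\<close>
  define Kc where "Kc = 2 / \<theta>0 + 2 / (1 - \<theta>0)"
  define Kx where "Kx = 1 + C3"
  define K where "K = \<sigma>^2 * Kc^2 * Kx"
  define \<rho> where "\<rho> n = sqrt (K / C0 * (real (p n) / real n))" for n
  have Kpos: "Kc > 0" "Kx > 0" using theta C_pos by (simp_all add: Kc_def Kx_def add_pos_pos)
  have K0: "K > 0" unfolding K_def using Kpos s2 by (intro mult_pos_pos) auto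
  define t where "t n = real n powr (1/3)" for n
  define y where "y n = real (p n) / t n" for n
  have t1: "t n \<ge> 1" "t n ^ 3 = real n" if "n \<ge> 1" for n
  proof -
    show "t n \<ge> 1" unfolding t_def using that by (intro ge_one_powr_ge_zero) auto
    show "t n ^ 3 = real n" unfolding t_def using that by (simp add: powr_power)
  qed
  have t_lim: "filterlim t at_top sequentially"
    unfolding filterlim_at_top_gt[where c=0]
  proof (intro allI impI)
    fix z :: real assume z: "0 < z"
    have "eventually (\<lambda>n. z^3 \<le> real n) sequentially"
      using filterlim_real_sequentially by (auto simp: filterlim_at_top)
    thus "eventually (\<lambda>n. z \<le> t n) sequentially"
      using eventually_ge_at_top[of "1::nat"]
    proof eventually_elim
      case (elim n)
      have "z^3 \<le> (t n)^3" using elim(1) t1(2)[OF elim(2)] by simp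
      thus ?case using power_mono_iff[of z "t n" 3] z t1(1)[OF elim(2)] by simp
    qed
  qed
  have y_lim: "y \<longlonglongrightarrow> 0" unfolding y_def t_def using smalloD_tendsto[OF p_rate] .
  have pn_lim: "(\<lambda>n. real (p n) / real n) \<longlonglongrightarrow> 0"
  proof (rule tendsto_sandwich[OF _ _ tendsto_const y_lim])
    show "eventually (\<lambda>n. real (p n) / real n \<le> y n) sequentially"
    proof (rule eventually_sequentiallyI[of 1])
      fix n :: nat assume n: "n \<ge> 1"
      have "t n ^ 1 \<le> t n ^ 3" using t1(1)[OF n] by (intro power_increasing) auto
      hence tn: "t n \<le> real n" using t1(2)[OF n] by simp
      show "real (p n) / real n \<le> y n" unfolding y_def by (rule frac_le) (use t1(1)[OF n] tn in auto)
    qed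
  qed simp
  have \<rho>2_lim: "(\<lambda>n. K / C0 * (real (p n) / real n)) \<longlonglongrightarrow> 0"
    using tendsto_mult[OF tendsto_const pn_lim, of "K / C0"] by simp
  have \<rho>_lim: "\<rho> \<longlonglongrightarrow> 0" unfolding \<rho>_def using tendsto_real_sqrt[OF \<rho>2_lim] by simp
  have real_p_lim: "filterlim (\<lambda>n. real (p n)) at_top sequentially"
    using filterlim_compose[OF filterlim_real_sequentially p_lim] .
  have ev: "eventually (\<lambda>n. n \<ge> 2 \<and> \<rho> n \<le> 1 \<and> \<theta>0 / 2 < real (k n) / real n \<and> real (k n) / real n < (1 + \<theta>0) / 2) sequentially"
  proof -
    have "eventually (\<lambda>n. \<rho> n < 1) sequentially"
      by (rule order_tendstoD(2)[OF \<rho>_lim]) simp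
    moreover have "eventually (\<lambda>n. \<theta>0 / 2 < real (k n) / real n) sequentially"
      by (rule order_tendstoD(1)[OF theta(3)]) (use theta in simp)
    moreover have "eventually (\<lambda>n. real (k n) / real n < (1 + \<theta>0) / 2) sequentially"
      by (rule order_tendstoD(2)[OF theta(3)]) (use theta in simp)
    ultimately show ?thesis using eventually_ge_at_top[of "2::nat"]
      by eventually_elim auto
  qed
  then obtain N where N: "\<And>n. n \<ge> N \<Longrightarrow> n \<ge> 2 \<and> \<rho> n \<le> 1 \<and> \<theta>0 / 2 < real (k n) / real n \<and> real (k n) / real n < (1 + \<theta>0) / 2"
    by (auto simp: eventually_sequentially)
  have design: "two_phase_design n (k n) (p n) (\<sigma>^2) C0 (X n)" if "n \<ge> 2" for n
    by unfold_locales (use k_range[OF that] p_pos[OF that] s2 C_pos X_dim[OF that] eig[OF that] in \<open>auto simp: V_def\<close>)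
  have sample: "two_phase_sample n (k n) (p n) (\<sigma>^2) C0 (X n) M \<eta> \<kappa> s Kc Kx (\<rho> n)" if n: "n \<ge> N" for n
  proof -
    have n2: "n \<ge> 2" using N[OF n] by simp
    interpret D: two_phase_design n "k n" "p n" "\<sigma>^2" C0 "X n" by (rule design[OF n2])
    interpret E: standardized_errors M "{1..n}" \<eta> \<kappa> by (rule errs)
    have \<theta>n: "\<theta>0 / 2 < real (k n) / real n" "real (k n) / real n < (1 + \<theta>0) / 2" using N[OF n] by auto
    show ?thesis
    proof unfold_locales
      show "0 < s" "s^2 = \<sigma>^2" "0 < Kc" "0 < Kx" using s Kpos by auto
      show "0 < \<rho> n" unfolding \<rho>_def using K0 C_pos p_pos[OF n2] n2 by simp
      show "\<rho> n \<le> 1" using N[OF n] by simp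
      show "(\<rho> n)^2 = \<sigma>^2 * Kc^2 * Kx / C0 * (real (p n) / real n)"
      proof -
        have "0 \<le> K / C0 * (real (p n) / real n)" using K0 C_pos by simp
        thus ?thesis unfolding \<rho>_def K_def[symmetric] by simp
      qed
      fix i assume i: "i \<in> {1..n}"
      show "\<bar>D.c i\<bar> \<le> Kc"
      proof (cases "i \<le> k n")
        case True
        have "1 / (real (k n) / real n) \<le> 1 / (\<theta>0 / 2)" by (rule frac_le) (use \<theta>n theta in auto)
        also have "\<dots> \<le> Kc" using theta by (simp add: Kc_def)
        finally show ?thesis using D.weight_theta(1)[OF True] by simp
      next
        case False
        have lt: "(1 - \<theta>0) / 2 < 1 - real (k n) / real n" using \<theta>n by (simp add: field_simps)
        have "1 / (1 - real (k n) / real n) \<le> 1 / ((1 - \<theta>0) / 2)" by (rule frac_le) (use lt theta in auto)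
        also have "\<dots> \<le> Kc" using theta by (simp add: Kc_def)
        finally have "1 / (1 - real (k n) / real n) \<le> Kc" .
        moreover have "0 < 1 - real (k n) / real n" by (rule less_trans[OF _ lt]) (use theta in simp)
        ultimately show ?thesis using D.weight_theta(2)[of i] False by simp
      qed
      show "ip (p n) (D.x i) (D.x i) \<le> Kx * real (p n)"
      proof -
        have "ip (p n) (D.x i) (D.x i) \<le> (\<Sum>s<p n. 1 + \<bar>X n i $ s\<bar> powr q)"
          unfolding ip_def D.x_def using abs_power_le_one_plus_powr[of 2 q] q
          by (intro sum_mono) (simp add: power2_eq_square[symmetric])
        also have "\<dots> = real (p n) + (\<Sum>s<p n. \<bar>X n i $ s\<bar> powr q)" by (simp add: sum.distrib)
        also have "(\<Sum>s<p n. \<bar>X n i $ s\<bar> powr q) \<le> C3 * real (p n)"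
          using X_bound[OF n2 i] p_pos[OF n2] by (simp add: field_simps)
        finally show ?thesis by (simp add: Kx_def algebra_simps)
      qed
    qed
  qed
  define Tn where "Tn n \<omega> = real n * scalar_prod (\<psi> n \<omega>) (mat_inv (V n) *\<^sub>v \<psi> n \<omega>)" for n \<omega>
  define En where "En n \<omega> = EL (c n) n (k n) (p n) (zvec (X n) (\<lambda>i. Y n i \<omega>) (\<beta>0 n))" for n \<omega>
  define r where "r n = sqrt (2 * real (p n)) * real n / \<Delta> n" for n
  define S where "S n = (\<Sum>i=1..n. sigma_sq n (k n) (p n) (\<sigma>^2) (expectation (\<lambda>\<omega>. (\<epsilon> 1 \<omega>)^4)) (X n) i)" for n
  have En_eq: "En n \<omega> = EL (c n) n (k n) (p n) (z0vec (X n) (\<lambda>j. \<epsilon> j \<omega>))" if "n \<ge> 2" "\<omega> \<in> space M" for n \<omega>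
    unfolding En_def
  proof (rule EL_cong)
    show "zvec (X n) (\<lambda>i. Y n i \<omega>) (\<beta>0 n) i = z0vec (X n) (\<lambda>j. \<epsilon> j \<omega>) i" if i: "i \<in> {1..n}" for i
      unfolding zvec_def z0vec_def using H0[OF \<open>n \<ge> 2\<close> i \<open>\<omega> \<in> space M\<close>] by simp
    show "k n < n" using k_range that by simp
  qed
  have facts: "Tn n \<in> borel_measurable M" "En n \<in> borel_measurable M"
     "cmod ((CLINT \<omega>|M. iexp (u * ((Tn n \<omega> - real (p n)) / sqrt (2 * real (p n))))) - of_real (exp (- (u^2) / 2)))
       \<le> \<bar>u\<bar> * (2 * u^2 / sqrt (2 * real (p n)) + (1 + 2 * \<bar>u\<bar>) * (80 * \<kappa>^2 * \<rho> n * (\<bar>u\<bar> + u^2)))"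
     "H \<ge> 1 \<Longrightarrow> sqrt H * K * y n \<le> C0 / 2 \<Longrightarrow> 4 * H * K * (y n)^2 \<le> C0 \<Longrightarrow> 51840 * H^2 * K^3 * (y n)^4 < C0^3 \<Longrightarrow>
       prob {\<omega>\<in>space M. (H * sqrt H * (K / C0) * (y n * sqrt (y n)) + 2 * H * sqrt (K / C0) * y n + 90 * H^2 * (K / C0)^2 * ((y n)^2 * sqrt (y n))) * sqrt (real (p n))
      < \<bar>En n \<omega> - Tn n \<omega>\<bar>} \<le> (2 + \<kappa> + 44 * \<kappa>^2) / H + \<kappa> / t n"
     "\<bar>S n / real n^2 - 2 * real (p n)\<bar> \<le> (\<rho> n)^2 * real (p n) * ((3 + expectation (\<lambda>\<omega>. (\<epsilon> 1 \<omega>)^4) / (\<sigma>^2)^2)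
        + 4 * (1 + ((1 - real (k n) / real n) / (real (k n) / real n))^2) + (1 + (((1 - real (k n) / real n) / (real (k n) / real n))^2)^2) * (1 + expectation (\<lambda>\<omega>. (\<epsilon> 1 \<omega>)^4) / (\<sigma>^2)^2))"
    if n: "n \<ge> N" for n u H
  proof -
    have n2: "n \<ge> 2" using N[OF n] by simp
    interpret Q: two_phase_sample n "k n" "p n" "\<sigma>^2" C0 "X n" M \<eta> \<kappa> s Kc Kx "\<rho> n" by (rule sample[OF n])
    have err: "Q.err \<omega> = (\<lambda>j. \<epsilon> j \<omega>)" for \<omega>
      using s by (simp add: Q.err_def \<eta>_def fun_eq_iff)
    have Tn: "Tn n \<omega> = Q.T \<omega>" for \<omega>
      unfolding Tn_def \<psi>_def V_def using Q.quadratic_statistic[of \<omega>] unfolding err .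
    show "Tn n \<in> borel_measurable M" unfolding Tn[abs_def] by (rule Q.meas_TLBA(4))
    show "En n \<in> borel_measurable M"
      using Q.EL_measurable[of "c n"] unfolding err by (rule measurable_cong[THEN iffD1, rotated]) (simp add: En_eq[OF n2])
    show "cmod ((CLINT \<omega>|M. iexp (u * ((Tn n \<omega> - real (p n)) / sqrt (2 * real (p n))))) - of_real (exp (- (u^2) / 2)))
       \<le> \<bar>u\<bar> * (2 * u^2 / sqrt (2 * real (p n)) + (1 + 2 * \<bar>u\<bar>) * (80 * \<kappa>^2 * \<rho> n * (\<bar>u\<bar> + u^2)))"
      unfolding Tn using Q.char_quadratic_form_bound[unfolded Q.d_eq] p_pos[OF n2] by simp
    show "\<bar>S n / real n^2 - 2 * real (p n)\<bar> \<le> (\<rho> n)^2 * real (p n) * ((3 + expectation (\<lambda>\<omega>. (\<epsilon> 1 \<omega>)^4) / (\<sigma>^2)^2)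
        + 4 * (1 + ((1 - real (k n) / real n) / (real (k n) / real n))^2) + (1 + (((1 - real (k n) / real n) / (real (k n) / real n))^2)^2) * (1 + expectation (\<lambda>\<omega>. (\<epsilon> 1 \<omega>)^4) / (\<sigma>^2)^2))"
      unfolding S_def
    proof (rule Q.Delta_squared_approx[OF Q.P_diag_le_\<rho>2])
      show "(\<rho> n)^2 \<le> 1" using Q.\<rho>01 by (simp add: power_le_one)
      show "0 \<le> expectation (\<lambda>\<omega>. (\<epsilon> 1 \<omega>)^4)" by simp
    qed
    assume H: "H \<ge> 1" "sqrt H * K * y n \<le> C0 / 2" "4 * H * K * (y n)^2 \<le> C0" "51840 * H^2 * K^3 * (y n)^4 < C0^3"
    have "{\<omega>\<in>space M. b < \<bar>En n \<omega> - Tn n \<omega>\<bar>} = {\<omega>\<in>space M. b < \<bar>EL (c n) n (k n) (p n) (z0vec (X n) (Q.err \<omega>)) - Q.T \<omega>\<bar>}" for b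
      using En_eq[OF n2] by (auto simp: Tn err)
    thus "prob {\<omega>\<in>space M. (H * sqrt H * (K / C0) * (y n * sqrt (y n)) + 2 * H * sqrt (K / C0) * y n + 90 * H^2 * (K / C0)^2 * ((y n)^2 * sqrt (y n))) * sqrt (real (p n))
      < \<bar>En n \<omega> - Tn n \<omega>\<bar>} \<le> (2 + \<kappa> + 44 * \<kappa>^2) / H + \<kappa> / t n"
      using Q.el_remainder[OF H(1) _ _ y_def H(2-4)[unfolded K_def], of "c n"] t1[of n] n2 by (simp add: K_def)
  qed
  \<comment> \<open>Replacing \<Delta> n / n by sqrt (2 p) does not change the limit, since \<Delta>^2 / n^2 = 2 p (1 +
    O(\<rho>^2)).\<close>
  have r_lim: "r \<longlonglongrightarrow> 1"
  proof -
    define B where "B n = (3 + expectation (\<lambda>\<omega>. (\<epsilon> 1 \<omega>)^4) / (\<sigma>^2)^2)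
        + 4 * (1 + ((1 - real (k n) / real n) / (real (k n) / real n))^2) + (1 + (((1 - real (k n) / real n) / (real (k n) / real n))^2)^2) * (1 + expectation (\<lambda>\<omega>. (\<epsilon> 1 \<omega>)^4) / (\<sigma>^2)^2)" for n
    have "B \<longlonglongrightarrow> (3 + expectation (\<lambda>\<omega>. (\<epsilon> 1 \<omega>)^4) / (\<sigma>^2)^2)
        + 4 * (1 + ((1 - \<theta>0) / \<theta>0)^2) + (1 + (((1 - \<theta>0) / \<theta>0)^2)^2) * (1 + expectation (\<lambda>\<omega>. (\<epsilon> 1 \<omega>)^4) / (\<sigma>^2)^2)"
      unfolding B_def using theta(1) by (intro tendsto_intros theta(3)) auto
    from tendsto_mult[OF tendsto_power[OF \<rho>_lim, of 2] tendsto_mult[OF this tendsto_const[of "1/2"]]]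
    have B0: "(\<lambda>n. (\<rho> n)^2 * (B n * (1/2))) \<longlonglongrightarrow> 0" by simp
    define a where "a n = S n / (2 * real (p n) * real n^2)" for n
    have "(\<lambda>n. a n - 1) \<longlonglongrightarrow> 0"
    proof (rule Lim_null_comparison[OF _ B0])
      show "eventually (\<lambda>n. norm (a n - 1) \<le> (\<rho> n)^2 * (B n * (1/2))) sequentially"
      proof (rule eventually_sequentiallyI[of N])
        fix n assume n: "n \<ge> N"
        hence pn: "real (p n) > 0" using p_pos[of n] N[OF n] by simp
        have "a n - 1 = (S n / real n^2 - 2 * real (p n)) / (2 * real (p n))"
          unfolding a_def using pn by (simp add: field_simps)
        hence "norm (a n - 1) = \<bar>S n / real n^2 - 2 * real (p n)\<bar> / (2 * real (p n))" using pn by (simp add: abs_divide)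
        also have "\<dots> \<le> ((\<rho> n)^2 * real (p n) * B n) / (2 * real (p n))"
          using facts(5)[OF n] pn unfolding B_def by (intro divide_right_mono) auto
        also have "\<dots> = (\<rho> n)^2 * (B n * (1/2))" using pn by simp
        finally show "norm (a n - 1) \<le> (\<rho> n)^2 * (B n * (1/2))" .
      qed
    qed
    hence "a \<longlonglongrightarrow> 1" by (simp add: LIM_zero_iff)
    hence "(\<lambda>n. 1 / sqrt (a n)) \<longlonglongrightarrow> 1 / sqrt 1" by (intro tendsto_intros) auto
    hence lim: "(\<lambda>n. 1 / sqrt (a n)) \<longlonglongrightarrow> 1" by simp
    have req: "1 / sqrt (a n) = r n" if "n \<ge> 1" for n
      unfolding r_def a_def \<Delta>_def Delta_def S_def[symmetric] using that
      by (simp add: real_sqrt_divide real_sqrt_mult)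
    show ?thesis
      by (rule Lim_transform_eventually[OF lim eventually_sequentiallyI[of 1]]) (rule req)
  qed
  define Z1 where "Z1 n \<omega> = (Tn n \<omega> - real (p n)) / (\<Delta> n / real n)" for n \<omega>
  define Z2 where "Z2 n \<omega> = (En n \<omega> - real (p n)) / (\<Delta> n / real n)" for n \<omega>
  have Zm: "Z1 n \<in> borel_measurable M" "Z2 n \<in> borel_measurable M" if "n \<ge> N" for n
    unfolding Z1_def[abs_def] Z2_def[abs_def] using facts(1,2)[OF that] by measurable
  have char1: "(\<lambda>n. CLINT \<omega>|M. iexp (u * Z1 n \<omega>)) \<longlonglongrightarrow> of_real (exp (- (u^2) / 2))" for u
  proof -
    \<comment> \<open>The bound on the characteristic function is applied at the moving argument u * r n.\<close>
    define \<phi> where "\<phi> n v = (CLINT \<omega>|M. iexp (v * ((Tn n \<omega> - real (p n)) / sqrt (2 * real (p n)))))" for n v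
    define e where "e n = \<bar>u * r n\<bar> * (2 * (u * r n)^2 / sqrt (2 * real (p n)) + (1 + 2 * \<bar>u * r n\<bar>) * (80 * \<kappa>^2 * \<rho> n * (\<bar>u * r n\<bar> + (u * r n)^2)))" for n
    have sl: "(\<lambda>n. 2 * (u * r n)^2 / sqrt (2 * real (p n))) \<longlonglongrightarrow> 0"
    proof (rule tendsto_divide_0)
      show "(\<lambda>n. 2 * (u * r n)^2) \<longlonglongrightarrow> 2 * (u * 1)^2" by (intro tendsto_intros r_lim)
      show "filterlim (\<lambda>n. sqrt (2 * real (p n))) at_infinity sequentially"
        by (intro filterlim_at_top_imp_at_infinity filterlim_compose[OF sqrt_at_top]
             filterlim_tendsto_pos_mult_at_top[OF tendsto_const _ real_p_lim]) simp
    qed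
    have "e \<longlonglongrightarrow> \<bar>u * 1\<bar> * (0 + (1 + 2 * \<bar>u * 1\<bar>) * (80 * \<kappa>^2 * 0 * (\<bar>u * 1\<bar> + (u * 1)^2)))"
      unfolding e_def by (intro tendsto_intros r_lim \<rho>_lim sl)
    hence e0: "e \<longlonglongrightarrow> 0" by simp
    have "(\<lambda>n. \<phi> n (u * r n) - of_real (exp (- ((u * r n)^2) / 2))) \<longlonglongrightarrow> 0"
    proof (rule Lim_null_comparison[OF _ e0])
      show "eventually (\<lambda>n. norm (\<phi> n (u * r n) - of_real (exp (- ((u * r n)^2) / 2))) \<le> e n) sequentially"
        using facts(3) unfolding \<phi>_def e_def by (intro eventually_sequentiallyI[of N]) blast
    qed
    moreover have "(\<lambda>n. complex_of_real (exp (- ((u * r n)^2) / 2))) \<longlonglongrightarrow> of_real (exp (- ((u * 1)^2) / 2))"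
      by (intro tendsto_intros r_lim) simp
    ultimately have "(\<lambda>n. (\<phi> n (u * r n) - of_real (exp (- ((u * r n)^2) / 2))) + of_real (exp (- ((u * r n)^2) / 2)))
        \<longlonglongrightarrow> 0 + of_real (exp (- ((u * 1)^2) / 2))"
      by (rule tendsto_add)
    hence lim: "(\<lambda>n. \<phi> n (u * r n)) \<longlonglongrightarrow> of_real (exp (- (u^2) / 2))" by simp
    have eq: "\<phi> n (u * r n) = (CLINT \<omega>|M. iexp (u * Z1 n \<omega>))" if "n \<ge> N" for n
    proof -
      have "u * Z1 n \<omega> = u * r n * ((Tn n \<omega> - real (p n)) / sqrt (2 * real (p n)))" for \<omega>
        unfolding Z1_def r_def using p_pos[of n] N[OF that] by simp
      thus ?thesis unfolding \<phi>_def by simp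
    qed
    show ?thesis
      by (rule Lim_transform_eventually[OF lim eventually_sequentiallyI[of N]]) (rule eq)
  qed
  have close: "(\<lambda>n. prob {\<omega>\<in>space M. \<delta> < \<bar>Z2 n \<omega> - Z1 n \<omega>\<bar>}) \<longlonglongrightarrow> 0" if \<delta>: "\<delta> > 0" for \<delta>
  proof (rule LIMSEQ_I)
    fix e :: real assume e: "e > 0"
    define Q where "Q = 2 + \<kappa> + 44 * \<kappa>^2"
    \<comment> \<open>H is fixed before n tends to infinity: it makes the part O(1/H) of the exceptional
      probability at most e/2, and every other term vanishes with y n or 1 / t n.\<close>
    define H where "H = max 1 (2 * Q / e)"
    have H1: "H \<ge> 1" by (simp add: H_def)
    have "Q / H \<le> e / 2" using H1 e by (simp add: H_def field_simps max_def)
    define coef where "coef n = H * sqrt H * (K / C0) * (y n * sqrt (y n)) + 2 * H * sqrt (K / C0) * y n + 90 * H^2 * (K / C0)^2 * ((y n)^2 * sqrt (y n))" for n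
    have sy: "(\<lambda>n. sqrt (y n)) \<longlonglongrightarrow> 0" using tendsto_real_sqrt[OF y_lim] by simp
    have "coef \<longlonglongrightarrow> H * sqrt H * (K / C0) * (0 * 0) + 2 * H * sqrt (K / C0) * 0 + 90 * H^2 * (K / C0)^2 * (0^2 * 0)"
      unfolding coef_def by (intro tendsto_intros y_lim sy)
    from tendsto_mult[OF tendsto_rabs[OF r_lim] this] have "(\<lambda>n. \<bar>r n\<bar> * coef n) \<longlonglongrightarrow> 0" by simp
    hence e1: "eventually (\<lambda>n. \<bar>r n\<bar> * coef n < \<delta>) sequentially" by (rule order_tendstoD(2)) (rule \<delta>)
    have "(\<lambda>n. sqrt H * K * y n) \<longlonglongrightarrow> sqrt H * K * 0" by (intro tendsto_intros y_lim)
    hence e2: "eventually (\<lambda>n. sqrt H * K * y n < C0 / 2) sequentially" by (rule order_tendstoD(2)) (use C_pos in simp)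
    have "(\<lambda>n. 4 * H * K * (y n)^2) \<longlonglongrightarrow> 4 * H * K * 0^2" by (intro tendsto_intros y_lim)
    hence e3: "eventually (\<lambda>n. 4 * H * K * (y n)^2 < C0) sequentially" by (rule order_tendstoD(2)) (use C_pos in simp)
    have "(\<lambda>n. 51840 * H^2 * K^3 * (y n)^4) \<longlonglongrightarrow> 51840 * H^2 * K^3 * 0^4" by (intro tendsto_intros y_lim)
    hence e4: "eventually (\<lambda>n. 51840 * H^2 * K^3 * (y n)^4 < C0^3) sequentially" by (rule order_tendstoD(2)) (use C_pos in simp)
    have "(\<lambda>n. \<kappa> / t n) \<longlonglongrightarrow> 0"
      by (rule tendsto_divide_0[OF tendsto_const filterlim_at_top_imp_at_infinity[OF t_lim]])
    hence e5: "eventually (\<lambda>n. \<kappa> / t n < e / 2) sequentially" by (rule order_tendstoD(2)) (use e in simp)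
    have "eventually (\<lambda>n. norm (prob {\<omega>\<in>space M. \<delta> < \<bar>Z2 n \<omega> - Z1 n \<omega>\<bar>} - 0) < e) sequentially"
      using e1 e2 e3 e4 e5 eventually_ge_at_top[of N]
    proof eventually_elim
      case (elim n)
      have n: "n \<ge> N" by (rule elim(6))
      have pn: "real (p n) > 0" using p_pos[of n] N[OF n] by simp
      have [measurable]: "Tn n \<in> borel_measurable M" "En n \<in> borel_measurable M" using facts(1,2)[OF n] by auto
      have Zdiff: "\<bar>Z2 n \<omega> - Z1 n \<omega>\<bar> = \<bar>r n\<bar> * (\<bar>En n \<omega> - Tn n \<omega>\<bar> / sqrt (2 * real (p n)))" for \<omega>
      proof -
        have "Z2 n \<omega> - Z1 n \<omega> = r n * ((En n \<omega> - Tn n \<omega>) / sqrt (2 * real (p n)))"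
          unfolding Z1_def Z2_def r_def diff_divide_distrib[symmetric] using pn by simp
        thus ?thesis by (simp add: abs_mult abs_divide)
      qed
      have "prob {\<omega>\<in>space M. \<delta> < \<bar>Z2 n \<omega> - Z1 n \<omega>\<bar>} \<le> prob {\<omega>\<in>space M. coef n * sqrt (real (p n)) < \<bar>En n \<omega> - Tn n \<omega>\<bar>}"
      proof (intro finite_measure_mono subsetI)
        fix \<omega> assume \<omega>: "\<omega> \<in> {\<omega>\<in>space M. \<delta> < \<bar>Z2 n \<omega> - Z1 n \<omega>\<bar>}"
        have "coef n * sqrt (real (p n)) < \<bar>En n \<omega> - Tn n \<omega>\<bar>"
        proof (rule ccontr)
          assume "\<not> coef n * sqrt (real (p n)) < \<bar>En n \<omega> - Tn n \<omega>\<bar>"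
          hence le: "\<bar>En n \<omega> - Tn n \<omega>\<bar> \<le> coef n * sqrt (real (p n))" by simp
          have c0: "0 \<le> coef n * sqrt (real (p n))" using le by (meson abs_ge_zero order_trans)
          have "\<bar>En n \<omega> - Tn n \<omega>\<bar> / sqrt (2 * real (p n)) \<le> coef n * sqrt (real (p n)) / sqrt (real (p n))"
            by (rule frac_le) (use le pn c0 in auto)
          also have "\<dots> = coef n" using pn by simp
          finally have "\<bar>r n\<bar> * (\<bar>En n \<omega> - Tn n \<omega>\<bar> / sqrt (2 * real (p n))) \<le> \<bar>r n\<bar> * coef n" by (intro mult_left_mono) auto
          thus False using \<omega> elim(1) unfolding Zdiff by simp
        qed
        thus "\<omega> \<in> {\<omega>\<in>space M. coef n * sqrt (real (p n)) < \<bar>En n \<omega> - Tn n \<omega>\<bar>}" using \<omega> by simp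
      qed measurable
      also have "\<dots> \<le> Q / H + \<kappa> / t n"
        unfolding coef_def Q_def using facts(4)[OF n H1] elim(2-4) by simp
      also have "\<dots> < e / 2 + e / 2" by (rule add_le_less_mono[OF \<open>Q / H \<le> e / 2\<close> elim(5)])
      finally show ?case by simp
    qed
    thus "\<exists>no. \<forall>n\<ge>no. norm (prob {\<omega>\<in>space M. \<delta> < \<bar>Z2 n \<omega> - Z1 n \<omega>\<bar>} - 0) < e"
      by (simp add: eventually_sequentially)
  qed
  have char2: "(\<lambda>n. CLINT \<omega>|M. iexp (u * Z2 n \<omega>)) \<longlonglongrightarrow> of_real (exp (- (u^2) / 2))" for u
  proof -
    have "(\<lambda>n. (CLINT \<omega>|M. iexp (u * Z2 n \<omega>)) - (CLINT \<omega>|M. iexp (u * Z1 n \<omega>))) \<longlonglongrightarrow> 0"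
    proof (rule LIMSEQ_I)
      fix e :: real assume e: "e > 0"
      define \<delta> where "\<delta> = e / (2 * (\<bar>u\<bar> + 1))"
      have \<delta>: "\<delta> > 0" unfolding \<delta>_def using e by simp
      have ud: "\<bar>u\<bar> * \<delta> \<le> e / 2"
      proof -
        have "\<bar>u\<bar> * \<delta> \<le> (\<bar>u\<bar> + 1) * \<delta>" using \<delta> by (intro mult_right_mono) auto
        also have "\<dots> = e / 2"
          unfolding \<delta>_def times_divide_eq_right by (rule frac_eq_eq[THEN iffD2]) simp_all
        finally show ?thesis .
      qed
      have "eventually (\<lambda>n. prob {\<omega>\<in>space M. \<delta> < \<bar>Z2 n \<omega> - Z1 n \<omega>\<bar>} < e / 4) sequentially"
        by (rule order_tendstoD(2)[OF close[OF \<delta>]]) (use e in simp)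
      hence "eventually (\<lambda>n. norm ((CLINT \<omega>|M. iexp (u * Z2 n \<omega>)) - (CLINT \<omega>|M. iexp (u * Z1 n \<omega>)) - 0) < e) sequentially"
        using eventually_ge_at_top[of N]
      proof eventually_elim
        case (elim n)
        have "norm ((CLINT \<omega>|M. iexp (u * Z2 n \<omega>)) - (CLINT \<omega>|M. iexp (u * Z1 n \<omega>)))
           \<le> \<bar>u\<bar> * \<delta> + 2 * prob {\<omega>\<in>space M. \<delta> < \<bar>Z2 n \<omega> - Z1 n \<omega>\<bar>}"
          by (rule char_close) (use Zm[OF elim(2)] \<delta> in auto)
        thus ?case using elim(1) ud by simp
      qed
      thus "\<exists>no. \<forall>n\<ge>no. norm ((CLINT \<omega>|M. iexp (u * Z2 n \<omega>)) - (CLINT \<omega>|M. iexp (u * Z1 n \<omega>)) - 0) < e"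
        by (simp add: eventually_sequentially)
    qed
    from tendsto_add[OF this char1[of u]] show ?thesis by simp
  qed
  show ?thesis
    using weak_conv_std_normal_from_char[of N Z1, OF Zm(1) char1] weak_conv_std_normal_from_char[of N Z2, OF Zm(2) char2]
    unfolding Z1_def Z2_def Tn_def En_def by blast
qed

end
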